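(* Let $A\in\mathbb{R}^{M\times Q}$. Suppose that $y\mapsto\mu_\theta(y)=\Phi x_\theta(y)$ is weakly differentiable, so that its divergence is well defined in the weak sense, and let $y=\Phi x_0+w$ with $w\sim\mathcal{N}(0,\sigma^2\operatorname{Id}_Q)$. Then $$\mathbb{E}_w\left[\left(\mathrm{GSURE}^A(x_\theta(y))-\mathrm{SE}^A(x_\theta(y))\right)^2\right]=2\sigma^4\operatorname{tr}\left[(A^*A)^2\right]+4\sigma^2\,\mathbb{E}_w\|A^*A(\mu_0-\mu_\theta(y))\|_2^2-4\sigma^4\,\mathbb{E}_w\left(\operatorname{tr}\left[A\frac{\partial\mu_\theta(y)}{\partial y}A^*A\left(2\operatorname{Id}-\frac{\partial\mu_\theta(y)}{\partial y}\right)A^*\right]\right).$$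
   Context: $\Phi\in\mathbb{R}^{Q\times N}$, $x_0\in\mathbb{R}^N$ is a fixed unknown vector, $\mu_0=\Phi x_0$, and $\sigma>0$. $x_\theta(y)$ is an arbitrary estimator of $x_0$ from $y\in\mathbb{R}^Q$, with parameters $\theta$, such that $\mu_\theta(y)=\Phi x_\theta(y)$ is a single-valued mapping $\mathbb{R}^Q\to\mathbb{R}^Q$. $\partial\mu_\theta(y)/\partial y$ is its (weak) Jacobian matrix, $A^*$ is the adjoint (transpose) of $A$, $\operatorname{tr}$ the trace, and $\mathbb{E}_w$ is expectation with respect to $w$. Define $$\mathrm{GSURE}^A(x_\theta(y))=\|A(y-\mu_\theta(y))\|_2^2-\sigma^2\operatorname{tr}(A^*A)+2\sigma^2\operatorname{tr}\left(A\frac{\partial\mu_\theta(y)}{\partial y}A^*\right),\qquad \mathrm{SE}^A(x_\theta(y))=\|A\mu_0-A\mu_\theta(y)\|_2^2 .$$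
   Formalization: Beyond weak differentiability, it is assumed that A*A(μ0−μθ(y)) and A(∂μθ(y)/∂y)A* have finite expected squared norm; with weak differentiability alone the identity can fail. *)

theory Defs
  imports "HOL-Probability.Probability"
begin

definition partial :: "'q::finite \<Rightarrow> (real^'q \<Rightarrow> real) \<Rightarrow> real^'q \<Rightarrow> real" where
  "partial j f y = frechet_derivative f (at y) (axis j 1)"

fun C_k :: "nat \<Rightarrow> (real^'q::finite \<Rightarrow> real) \<Rightarrow> bool" where
  "C_k 0 f \<longleftrightarrow> continuous_on UNIV f"
| "C_k (Suc k) f \<longleftrightarrow> (\<forall>y. f differentiable (at y)) \<and> (\<forall>j. C_k k (partial j f))"

definition test_function :: "(real^'q::finite \<Rightarrow> real) \<Rightarrow> bool" where
  "test_function \<phi> \<longleftrightarrow> (\<forall>k. C_k k \<phi>) \<and> compact (closure {y. \<phi> y \<noteq> 0})"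

(* Borel measurability of f is implied, since f is the pointwise limit of f times the
   indicator of cball 0 n. *)
definition locally_integrable ::
    "('a::euclidean_space \<Rightarrow> 'b::euclidean_space) \<Rightarrow> bool" where
  "locally_integrable f \<longleftrightarrow> (\<forall>K. compact K \<longrightarrow> set_integrable lborel K f)"

(* J is a version of the weak Jacobian of f: the entry J y $ i $ j (row i, column j) is the
   weak partial derivative of the i-th component of f in the j-th coordinate.  J is determined
   by f only up to a Lebesgue null set.  f is weakly differentiable iff such a J exists. *)
definition has_weak_jacobian ::
    "(real^'q::finite \<Rightarrow> real^'m::finite) \<Rightarrow> (real^'q \<Rightarrow> real^'q^'m) \<Rightarrow> bool" where
  "has_weak_jacobian f J \<longleftrightarrow>
     locally_integrable f \<and> locally_integrable J \<and>
     (\<forall>\<phi>. test_function \<phi> \<longrightarrow>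
        (\<forall>i j. (LINT y|lborel. f y $ i * partial j \<phi> y)
             = - (LINT y|lborel. J y $ i $ j * \<phi> y)))"

(* Lebesgue density of N(0, \<sigma>^2 Id) *)
definition iso_gaussian_density :: "real \<Rightarrow> real^'q::finite \<Rightarrow> real" where
  "iso_gaussian_density \<sigma> v = (\<Prod>i\<in>UNIV. normal_density 0 \<sigma> (v $ i))"

(* x is the estimator at a fixed parameter value and J is a weak Jacobian of
   y \<mapsto> \<Phi> *v x y. *)
definition GSURE ::
    "real^'q::finite^'m::finite \<Rightarrow> real^'n::finite^'q \<Rightarrow> real \<Rightarrow> (real^'q \<Rightarrow> real^'n)
      \<Rightarrow> (real^'q \<Rightarrow> real^'q^'q) \<Rightarrow> real^'q \<Rightarrow> real" where
  "GSURE A \<Phi> \<sigma> x J y =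
     (norm (A *v (y - \<Phi> *v x y)))\<^sup>2 - \<sigma>\<^sup>2 * trace (transpose A ** A)
       + 2 * \<sigma>\<^sup>2 * trace (A ** J y ** transpose A)"

definition SE ::
    "real^'q::finite^'m::finite \<Rightarrow> real^'n::finite^'q \<Rightarrow> real^'n \<Rightarrow> (real^'q \<Rightarrow> real^'n)
      \<Rightarrow> real^'q \<Rightarrow> real" where
  "SE A \<Phi> x\<^sub>0 x y = (norm (A *v (\<Phi> *v x\<^sub>0) - A *v (\<Phi> *v x y)))\<^sup>2"

end

theory Submission
  imports Defs "HOL-Computational_Algebra.Polynomial"
begin

text \<open>
Put \<open>m = \<Phi> x\<^sub>0\<close> and let \<open>a\<^sub>k\<close> be the rows of \<open>A\<close>. With the scalar functions
\<open>v\<^sub>k(y) = a\<^sub>k \<bullet> (y - m) + 2 a\<^sub>k \<bullet> (m - \<mu>(y))\<close> the difference GSURE - SE is exactly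
\<open>\<delta> = \<Sum>k. (a\<^sub>k \<bullet> (y - m)) v\<^sub>k - \<sigma>\<^sup>2 T\<^sub>k\<^sub>k\<close>, where \<open>T\<^sub>k\<^sub>l\<close> is the weak derivative of
\<open>v\<^sub>k\<close> in direction \<open>a\<^sub>l\<close>. This is the Gaussian divergence (Skorokhod integral) of the field
\<open>\<Sum>k. v\<^sub>k a\<^sub>k\<close>, and the theorem is the isometry
\<open>E \<delta>\<^sup>2 = \<sigma>\<^sup>2 \<Sum>kl. (a\<^sub>k \<bullet> a\<^sub>l) E(v\<^sub>k v\<^sub>l) + \<sigma>\<^sup>4 \<Sum>kl. E(T\<^sub>k\<^sub>l T\<^sub>l\<^sub>k)\<close>
(\<open>skorokhod_isometry\<close>), expanded by bilinearity. The cross terms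
\<open>E((a\<^sub>k \<bullet> (y - m)) (a\<^sub>l \<bullet> (m - \<mu>)))\<close> are evaluated by Stein's identity (\<open>stein_identity\<close>).

Working with the directions \<open>a\<^sub>k\<close> instead of coordinates is what makes the hypotheses sufficient:
the Jacobian itself is only locally integrable, but the \<open>T\<^sub>k\<^sub>l\<close> are the entries of
\<open>A A\<^sup>T - 2 A J A\<^sup>T\<close> and hence square integrable for the Gaussian measure. The functions \<open>v\<^sub>k\<close> are
square integrable because \<open>A u\<close> is controlled by \<open>A\<^sup>T A u\<close> (\<open>norm_matrix_mult_le_gram\<close>).

For smooth fields the isometry is two integrations by parts. The fields here are merely weakly
differentiable, and these integrations by parts are replaced by two identities for a test function
\<open>\<psi>\<close> and functions that are locally square integrable together with the derivatives involved: the
product rule \<open>\<integral> \<psi> (\<partial>\<^sub>a f g + f \<partial>\<^sub>a g) = - \<integral> \<partial>\<^sub>a \<psi> f g\<close> (\<open>weak_product_rule\<close>) and the identity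
\<open>\<integral> \<psi> \<partial>\<^sub>a f \<partial>\<^sub>b g + \<integral> \<partial>\<^sub>a \<psi> f \<partial>\<^sub>b g = \<integral> \<psi> \<partial>\<^sub>b f \<partial>\<^sub>a g + \<integral> \<partial>\<^sub>b \<psi> f \<partial>\<^sub>a g\<close>
(\<open>weak_null_lagrangian\<close>), which expresses that \<open>\<partial>\<^sub>a f \<partial>\<^sub>b g - \<partial>\<^sub>b f \<partial>\<^sub>a g\<close> is a divergence. Both
are obtained without smoothing \<open>f\<close> or \<open>g\<close>: one evaluates \<open>f\<close> at \<open>x\<close> and \<open>g\<close> at \<open>y\<close>, couples the two points by a
smooth kernel \<open>k(x - y)\<close>, moves all derivatives to the kernel by the definition of weak derivatives
in each variable separately, and lets \<open>k\<close> concentrate at the origin. The limit is justified by the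
continuity of translations in \<open>L\<^sup>2\<close> (\<open>translation_L2_tendsto\<close>).

Both identities are applied with \<open>\<psi> = \<rho> \<eta>\<close>, where \<open>\<rho>\<close> is the Gaussian density and \<open>\<eta>\<close> runs through
cutoff functions of growing scale. The terms containing derivatives of \<open>\<eta>\<close> disappear in the limit,
because the gradient of the cutoff at scale \<open>n\<close> is \<open>O(1/n)\<close> and is supported where \<open>|y - m| \<le> n\<close>.
Since the integrand \<open>\<delta>\<^sup>2\<close> is nonnegative, Fatou's lemma also yields its integrability.
\<close>

section \<open>Smooth functions and test functions\<close>

definition smooth :: "(real^'q::finite \<Rightarrow> real) \<Rightarrow> bool" where
  "smooth f \<longleftrightarrow> (\<forall>k. C_k k f)"

text \<open>Derivatives are taken in arbitrary directions, because square integrability of the weak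
derivatives is only available along the rows of the matrix \<open>A\<close>.\<close>

definition dir_deriv :: "real^'q::finite \<Rightarrow> (real^'q \<Rightarrow> real) \<Rightarrow> real^'q \<Rightarrow> real" where
  "dir_deriv a f y = frechet_derivative f (at y) a"

lemma dir_deriv_eq: "(f has_derivative D) (at y) \<Longrightarrow> dir_deriv a f y = D a"
  unfolding dir_deriv_def by (metis frechet_derivative_at)

lemma partial_eq_dir_deriv: "partial j f = dir_deriv (axis j 1) f"
  by (simp add: partial_def dir_deriv_def fun_eq_iff)

lemma partial_eq: "(f has_derivative D) (at y) \<Longrightarrow> partial j f y = D (axis j 1)"
  unfolding partial_eq_dir_deriv by (rule dir_deriv_eq)

lemma C_k_Suc_imp_C_k: "C_k (Suc k) f \<Longrightarrow> C_k k f"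
proof (induction k arbitrary: f)
  case 0
  then show ?case
    by (simp add: continuous_at_imp_continuous_on differentiable_imp_continuous_within)
next
  case (Suc k)
  then show ?case by (auto simp: C_k.simps(2))
qed

lemma C_k_const: "C_k k (\<lambda>y. c)"
proof (induction k arbitrary: c)
  case (Suc k)
  have "partial j (\<lambda>y. c) = (\<lambda>y. 0)" for j :: 'a
    by (rule ext) (auto intro!: partial_eq derivative_eq_intros)
  then show ?case using Suc by simp
qed auto

lemma C_k_add: "C_k k f \<Longrightarrow> C_k k g \<Longrightarrow> C_k k (\<lambda>y. f y + g y)"
proof (induction k arbitrary: f g)
  case 0
  then show ?case by (auto intro: continuous_intros)
next
  case (Suc k)
  have "partial j (\<lambda>y. f y + g y) = (\<lambda>y. partial j f y + partial j g y)" for j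
  proof
    fix y
    have "(f has_derivative frechet_derivative f (at y)) (at y)"
      "(g has_derivative frechet_derivative g (at y)) (at y)"
      using Suc.prems by (auto simp: frechet_derivative_works[symmetric])
    then show "partial j (\<lambda>y. f y + g y) y = partial j f y + partial j g y"
      by (subst partial_eq[OF has_derivative_add]) (auto simp: partial_def)
  qed
  then show ?case using Suc by auto
qed

lemma C_k_mult: "C_k k f \<Longrightarrow> C_k k g \<Longrightarrow> C_k k (\<lambda>y. f y * g y)"
proof (induction k arbitrary: f g)
  case 0
  then show ?case by (auto intro: continuous_intros)
next
  case (Suc k)
  have "partial j (\<lambda>y. f y * g y) = (\<lambda>y. f y * partial j g y + partial j f y * g y)" for j
  proof
    fix y
    have "(f has_derivative frechet_derivative f (at y)) (at y)"
      "(g has_derivative frechet_derivative g (at y)) (at y)"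
      using Suc.prems by (auto simp: frechet_derivative_works[symmetric])
    then show "partial j (\<lambda>y. f y * g y) y = f y * partial j g y + partial j f y * g y"
      by (subst partial_eq[OF has_derivative_mult]) (auto simp: partial_def)
  qed
  moreover have "C_k k f" "C_k k g" using Suc.prems C_k_Suc_imp_C_k by auto
  ultimately show ?case using Suc by (auto intro!: C_k_add)
qed

text \<open>The family \<open>g\<close> lists a function with all its derivatives. Treating all members at once
makes the induction on \<open>k\<close> possible, since differentiating leads from \<open>g n\<close> to \<open>g (Suc n)\<close>.\<close>

lemma C_k_compose:
  assumes g: "\<And>n t. (g n has_real_derivative g (Suc n) t) (at t)"
  shows "C_k k f \<Longrightarrow> C_k k (\<lambda>y. g n (f y))"
proof (induction k arbitrary: f n)
  case 0
  have "continuous_on UNIV (g n)"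
    using g by (meson DERIV_isCont continuous_at_imp_continuous_on)
  then show ?case using 0 by (auto intro: continuous_on_compose2)
next
  case (Suc k)
  have D: "((\<lambda>y. g n (f y)) has_derivative (\<lambda>h. frechet_derivative f (at y) h * g (Suc n) (f y))) (at y)" for y
  proof -
    have "(f has_derivative frechet_derivative f (at y)) (at y)"
      using Suc.prems by (auto simp: frechet_derivative_works[symmetric])
    moreover have "(g n has_derivative (\<lambda>h. h * g (Suc n) (f y))) (at (f y))"
      using g[of n "f y"] by (simp add: has_field_derivative_def mult_commute_abs)
    ultimately show ?thesis by (rule has_derivative_compose)
  qed
  have "partial j (\<lambda>y. g n (f y)) = (\<lambda>y. partial j f y * g (Suc n) (f y))" for j
    by (rule ext) (subst partial_eq[OF D], simp add: partial_def)
  moreover have "C_k k f" using Suc.prems C_k_Suc_imp_C_k by auto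
  moreover have "(\<lambda>y. g n (f y)) differentiable at y" for y using D differentiable_def by blast
  ultimately show ?case using Suc by (auto intro!: C_k_mult)
qed

lemma C_k_affine: "C_k k f \<Longrightarrow> C_k k (\<lambda>x. f (c *\<^sub>R x + d))"
proof (induction k arbitrary: f)
  case 0
  then show ?case by (auto intro!: continuous_intros intro: continuous_on_compose2)
next
  case (Suc k)
  have D: "((\<lambda>x. f (c *\<^sub>R x + d)) has_derivative (\<lambda>h. frechet_derivative f (at (c *\<^sub>R x + d)) (c *\<^sub>R h))) (at x)" for x
    by (rule has_derivative_compose[of "\<lambda>x. c *\<^sub>R x + d" "\<lambda>h. c *\<^sub>R h" x UNIV f])
      (use Suc.prems in \<open>auto intro!: derivative_eq_intros simp: frechet_derivative_works[symmetric]\<close>)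
  have "partial j (\<lambda>x. f (c *\<^sub>R x + d)) = (\<lambda>x. c * partial j f (c *\<^sub>R x + d))" for j
  proof
    fix x
    have "linear (frechet_derivative f (at (c *\<^sub>R x + d)))"
      using Suc.prems by (auto intro: linear_frechet_derivative)
    then show "partial j (\<lambda>x. f (c *\<^sub>R x + d)) x = c * partial j f (c *\<^sub>R x + d)"
      by (subst partial_eq[OF D]) (simp add: partial_def linear_cmul)
  qed
  moreover have "(\<lambda>x. f (c *\<^sub>R x + d)) differentiable at x" for x using D differentiable_def by blast
  ultimately show ?case using Suc by (auto intro!: C_k_mult C_k_const)
qed

lemma C_k_inner: "C_k k (\<lambda>y. y \<bullet> a)"
proof (cases k)
  case (Suc k')
  have D: "((\<lambda>y. y \<bullet> a) has_derivative (\<lambda>h. h \<bullet> a)) (at y)" for y :: "real^'a"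
    by (auto intro!: derivative_eq_intros)
  have "partial j (\<lambda>y. y \<bullet> a) = (\<lambda>y. axis j 1 \<bullet> a)" for j
    by (rule ext) (rule partial_eq[OF D])
  moreover have "(\<lambda>y. y \<bullet> a) differentiable at y" for y using D differentiable_def by blast
  ultimately show ?thesis using Suc by (auto intro!: C_k_const)
qed (auto intro!: continuous_intros)

lemma C_k_square_norm: "C_k k (\<lambda>y. y \<bullet> y)"
proof (cases k)
  case (Suc k')
  have D: "((\<lambda>y. y \<bullet> y) has_derivative (\<lambda>h. 2 * (y \<bullet> h))) (at y)" for y :: "real^'a"
    by (auto intro!: derivative_eq_intros simp: inner_commute)
  have "partial j (\<lambda>y. y \<bullet> y) = (\<lambda>y. 2 * (y \<bullet> axis j 1))" for j :: 'a
    by (rule ext) (rule partial_eq[OF D])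
  moreover have "(\<lambda>y. y \<bullet> y) differentiable at y" for y :: "real^'a" using D differentiable_def by blast
  ultimately show ?thesis using Suc by (auto intro!: C_k_const C_k_mult C_k_inner)
qed (auto intro!: continuous_intros)

lemma smooth_const: "smooth (\<lambda>y. c)"
  and smooth_add: "smooth f \<Longrightarrow> smooth g \<Longrightarrow> smooth (\<lambda>y. f y + g y)"
  and smooth_mult: "smooth f \<Longrightarrow> smooth g \<Longrightarrow> smooth (\<lambda>y. f y * g y)"
  and smooth_affine: "smooth f \<Longrightarrow> smooth (\<lambda>x. f (c *\<^sub>R x + d))"
  and smooth_inner: "smooth (\<lambda>y. y \<bullet> a)"
  and smooth_square_norm: "smooth (\<lambda>y. y \<bullet> y)"
  by (auto simp: smooth_def intro: C_k_const C_k_add C_k_mult C_k_affine C_k_inner C_k_square_norm)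

lemma smooth_compose:
  assumes "\<And>n t. (g n has_real_derivative g (Suc n) t) (at t)" "smooth f"
  shows "smooth (\<lambda>y. g n (f y))"
  using C_k_compose[of g] assms unfolding smooth_def by blast

lemma smooth_sum: "(\<And>i. i \<in> I \<Longrightarrow> smooth (f i)) \<Longrightarrow> smooth (\<lambda>y. \<Sum>i\<in>I. f i y)"
  by (induction I rule: infinite_finite_induct) (auto intro: smooth_const smooth_add)

lemma smooth_inner_diff: "smooth (\<lambda>y. a \<bullet> (y - m))"
  using smooth_affine[OF smooth_inner, of 1 "-m" a] by (simp add: inner_commute)

lemma smooth_has_derivative:
  assumes "smooth f" shows "(f has_derivative (\<lambda>a. dir_deriv a f y)) (at y)"
proof -
  have "C_k (Suc 0) f" using assms unfolding smooth_def by blast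
  then show ?thesis by (auto simp: dir_deriv_def frechet_derivative_works[symmetric])
qed

lemma smooth_continuous: "smooth f \<Longrightarrow> continuous_on S f"
  by (meson has_derivative_continuous_on has_derivative_at_withinI smooth_has_derivative)

lemma smooth_partial: "smooth f \<Longrightarrow> smooth (partial j f)"
  unfolding smooth_def using C_k.simps(2) by blast

text \<open>Links arbitrary directions to the coordinate derivatives that define test functions and weak
Jacobians.\<close>

lemma dir_deriv_eq_sum_partial:
  assumes "smooth f" shows "dir_deriv a f y = (\<Sum>j\<in>UNIV. a $ j * partial j f y)"
proof -
  interpret linear "\<lambda>a. dir_deriv a f y"
    using smooth_has_derivative[OF assms] has_derivative_linear by blast
  have "dir_deriv a f y = dir_deriv (\<Sum>j\<in>UNIV. (a $ j) *\<^sub>R axis j 1) f y"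
    using basis_expansion[of a] by (simp add: scalar_mult_eq_scaleR)
  then show ?thesis by (simp add: sum scale partial_eq_dir_deriv)
qed

lemma smooth_dir_deriv:
  assumes "smooth f" shows "smooth (dir_deriv a f)"
proof -
  have "smooth (\<lambda>y. \<Sum>j\<in>UNIV. a $ j * partial j f y)"
    using assms by (intro smooth_sum smooth_mult smooth_const smooth_partial)
  then show ?thesis using dir_deriv_eq_sum_partial[OF assms] by presburger
qed

lemma dir_deriv_mult:
  assumes "smooth f" "smooth g"
  shows "dir_deriv a (\<lambda>y. f y * g y) y = f y * dir_deriv a g y + dir_deriv a f y * g y"
  using dir_deriv_eq[OF has_derivative_mult[OF smooth_has_derivative[OF assms(1)] smooth_has_derivative[OF assms(2)]]] .

lemma dir_deriv_inner_diff: "dir_deriv b (\<lambda>y. a \<bullet> (y - m)) y = a \<bullet> b"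
  by (rule dir_deriv_eq) (auto intro!: derivative_eq_intros)

lemma dir_deriv_affine:
  assumes "smooth f"
  shows "dir_deriv a (\<lambda>x. f (c *\<^sub>R x + d)) x = c * dir_deriv a f (c *\<^sub>R x + d)"
proof -
  interpret linear "\<lambda>a. dir_deriv a f (c *\<^sub>R x + d)"
    using smooth_has_derivative[OF assms] has_derivative_linear by blast
  have "((\<lambda>x. f (c *\<^sub>R x + d)) has_derivative (\<lambda>h. dir_deriv (c *\<^sub>R h) f (c *\<^sub>R x + d))) (at x)"
    by (rule has_derivative_compose[of "\<lambda>x. c *\<^sub>R x + d" "\<lambda>h. c *\<^sub>R h" x UNIV f])
      (auto intro!: derivative_eq_intros smooth_has_derivative assms)
  from dir_deriv_eq[OF this] show ?thesis by (simp add: scale)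
qed

lemma test_function_smooth: "test_function \<phi> \<Longrightarrow> smooth \<phi>"
  by (simp add: test_function_def smooth_def)

lemma test_functionI:
  assumes "smooth \<phi>" "\<And>y. norm y > R \<Longrightarrow> \<phi> y = 0"
  shows "test_function \<phi>"
proof -
  have "{y. \<phi> y \<noteq> 0} \<subseteq> cball 0 R" using assms(2) by (force simp: not_le[symmetric])
  then have "bounded {y. \<phi> y \<noteq> 0}" by (meson bounded_cball bounded_subset)
  then show ?thesis using assms(1) by (simp add: test_function_def smooth_def compact_closure)
qed

lemma test_function_support:
  assumes "test_function \<phi>"
  obtains R where "R > 0" "\<And>y. norm y > R \<Longrightarrow> \<phi> y = 0"
proof -
  have "bounded {y. \<phi> y \<noteq> 0}"
    using assms by (metis test_function_def bounded_subset closure_subset compact_imp_bounded)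
  then obtain R where "R > 0" "\<forall>y\<in>{y. \<phi> y \<noteq> 0}. norm y \<le> R" by (auto simp: bounded_pos)
  then show ?thesis using that[of R] by force
qed

lemma test_function_mult: "smooth f \<Longrightarrow> test_function \<phi> \<Longrightarrow> test_function (\<lambda>y. f y * \<phi> y)"
proof -
  assume f: "smooth f" and \<phi>: "test_function \<phi>"
  obtain R where R: "\<And>y. norm y > R \<Longrightarrow> \<phi> y = 0" using \<phi> test_function_support by blast
  show ?thesis
    by (rule test_functionI[of _ R, OF smooth_mult[OF f test_function_smooth[OF \<phi>]]]) (use R in auto)
qed

lemma dir_deriv_eq_0_outside_support:
  assumes "\<And>y. norm y > R \<Longrightarrow> \<phi> y = 0" "norm y > R"
  shows "dir_deriv a \<phi> y = 0"
proof -
  have "open {y::real^'a. norm y > R}" by (intro open_Collect_less continuous_intros)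
  then have "(\<phi> has_derivative (\<lambda>h. 0)) (at y)"
    by (rule has_derivative_transform_within_open[where f="\<lambda>y. 0", rotated])
      (use assms in auto)
  from dir_deriv_eq[OF this] show ?thesis .
qed

lemma test_function_dir_deriv:
  assumes "test_function \<phi>" shows "test_function (dir_deriv a \<phi>)"
proof -
  obtain R where R: "R > 0" "\<And>y. norm y > R \<Longrightarrow> \<phi> y = 0"
    by (rule test_function_support[OF assms(1)]) blast
  have "dir_deriv a \<phi> y = 0" if "norm y > R" for y
    by (rule dir_deriv_eq_0_outside_support[OF R(2) that])
  then show ?thesis
    by (rule test_functionI[OF smooth_dir_deriv[OF test_function_smooth[OF assms]]])
qed

lemma test_function_affine:
  assumes "test_function \<phi>" "c \<noteq> 0" shows "test_function (\<lambda>x. \<phi> (c *\<^sub>R x + d))"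
proof -
  obtain R where R: "R > 0" "\<And>y. norm y > R \<Longrightarrow> \<phi> y = 0"
    by (rule test_function_support[OF assms(1)]) blast
  have "\<phi> (c *\<^sub>R y + d) = 0" if "norm y > (R + norm d) / \<bar>c\<bar>" for y
  proof (rule R)
    have "R + norm d < norm (c *\<^sub>R y)" using that assms(2) by (simp add: field_simps)
    then show "R < norm (c *\<^sub>R y + d)" using norm_triangle_ineq4[of "c *\<^sub>R y + d" d] by simp
  qed
  then show ?thesis
    by (rule test_functionI[OF smooth_affine[OF test_function_smooth[OF assms(1)]]])
qed

lemma test_function_bounded:
  assumes "test_function \<phi>" obtains C where "C > 0" "\<And>y. \<bar>\<phi> y\<bar> \<le> C"
proof -
  obtain R where R: "R > 0" "\<And>y. norm y > R \<Longrightarrow> \<phi> y = 0"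
    by (rule test_function_support[OF assms(1)]) blast
  have "compact (\<phi> ` cball 0 R)"
    by (intro compact_continuous_image smooth_continuous test_function_smooth assms) auto
  then obtain C where C: "C > 0" "\<forall>z\<in>\<phi> ` cball 0 R. norm z \<le> C"
    using compact_imp_bounded bounded_pos by metis
  have "\<bar>\<phi> y\<bar> \<le> C" for y
    using R(2)[of y] C by (cases "norm y > R") auto
  then show ?thesis using that C by blast
qed

lemma borel_measurable_smooth [measurable_dest]: "smooth f \<Longrightarrow> f \<in> borel_measurable borel"
  using smooth_continuous borel_measurable_continuous_onI by blast

lemma borel_measurable_test_function [measurable_dest]: "test_function f \<Longrightarrow> f \<in> borel_measurable borel"
  using borel_measurable_smooth test_function_smooth by blast

section \<open>A smooth bump function\<close>

text \<open>The functions \<open>p(1/t) exp(-1/t)\<close>, extended by zero to \<open>t \<le> 0\<close>. For polynomials \<open>p\<close> this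
family is closed under differentiation, so it contains all derivatives of \<open>exp(-1/t)\<close>.\<close>

definition flat_exp :: "real poly \<Rightarrow> real \<Rightarrow> real" where
  "flat_exp p t = (if t > 0 then poly p (inverse t) * exp (- inverse t) else 0)"

lemma poly_over_exp_tendsto_0: "((\<lambda>s::real. poly p s * exp (- s)) \<longlongrightarrow> 0) at_top"
proof -
  have "((\<lambda>s::real. \<Sum>i\<le>degree p. coeff p i * (s ^ i / exp s)) \<longlongrightarrow> (\<Sum>i\<le>degree p. coeff p i * 0)) at_top"
    by (intro tendsto_intros tendsto_power_div_exp_0)
  then show ?thesis
    by (simp add: poly_altdef sum_distrib_right exp_minus divide_inverse mult.assoc)
qed

lemma flat_exp_tendsto_0: "(flat_exp p \<longlongrightarrow> 0) (at 0)"
proof (rule filterlim_split_at)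
  have "eventually (\<lambda>t. 0 = flat_exp p t) (at_left 0)"
    by (auto simp: eventually_at_filter flat_exp_def)
  then show "(flat_exp p \<longlongrightarrow> 0) (at_left 0)" using tendsto_const by (rule Lim_transform_eventually[rotated])
  have "eventually (\<lambda>t. poly p (inverse t) * exp (- inverse t) = flat_exp p t) (at_right 0)"
    by (auto simp: eventually_at_filter flat_exp_def)
  then show "(flat_exp p \<longlongrightarrow> 0) (at_right 0)"
    using filterlim_compose[OF poly_over_exp_tendsto_0 filterlim_inverse_at_top_right]
    by (rule Lim_transform_eventually[rotated])
qed

text \<open>The derivative of \<open>p(1/t) exp(-1/t)\<close> is \<open>q(1/t) exp(-1/t)\<close> with \<open>q(s) = s\<^sup>2 (p(s) - p'(s))\<close>.\<close>

definition flat_deriv :: "real poly \<Rightarrow> real poly" where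
  "flat_deriv p = pCons 0 (pCons 0 (p - pderiv p))"

lemma flat_exp_deriv: "(flat_exp p has_real_derivative flat_exp (flat_deriv p) t) (at t)"
proof -
  consider "t < 0" | "t = 0" | "t > 0" by linarith
  then show ?thesis
  proof cases
    case 1
    have "((\<lambda>t. 0) has_real_derivative flat_exp (flat_deriv p) t) (at t)"
      using 1 by (auto simp: flat_exp_def)
    then show ?thesis
      by (rule has_field_derivative_transform_within_open[of _ _ _ "{..<0}"])
        (use 1 in \<open>auto simp: flat_exp_def\<close>)
  next
    case 2
    \<comment> \<open>At the origin the difference quotient of \<open>flat_exp p\<close> is again a member of the family.\<close>
    have "((\<lambda>h. flat_exp (pCons 0 p) h) \<longlongrightarrow> 0) (at 0)" by (rule flat_exp_tendsto_0)
    moreover have "eventually (\<lambda>h. flat_exp (pCons 0 p) h = (flat_exp p (0 + h) - flat_exp p 0) / h) (at 0)"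
      by (auto simp: eventually_at_filter flat_exp_def field_simps)
    ultimately have "((\<lambda>h. (flat_exp p (0 + h) - flat_exp p 0) / h) \<longlongrightarrow> 0) (at 0)"
      by (rule Lim_transform_eventually)
    then show ?thesis using 2 by (simp add: DERIV_def flat_exp_def)
  next
    case 3
    have "((\<lambda>t. poly p (inverse t) * exp (- inverse t)) has_real_derivative flat_exp (flat_deriv p) t) (at t)"
      using 3
      by (auto intro!: derivative_eq_intros poly_DERIV[THEN DERIV_chain2]
          simp: flat_exp_def flat_deriv_def power2_eq_square algebra_simps)
    then show ?thesis
      by (rule has_field_derivative_transform_within_open[of _ _ _ "{0<..}"])
        (use 3 in \<open>auto simp: flat_exp_def\<close>)
  qed
qed

text \<open>The \<open>n\<close>-th derivative of \<open>exp(-1/t)\<close>, extended by zero.\<close>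

definition exp_inverse_deriv :: "nat \<Rightarrow> real \<Rightarrow> real" where
  "exp_inverse_deriv n = flat_exp ((flat_deriv ^^ n) 1)"

lemma exp_inverse_deriv_deriv: "(exp_inverse_deriv n has_real_derivative exp_inverse_deriv (Suc n) t) (at t)"
  using flat_exp_deriv[of "(flat_deriv ^^ n) 1"] by (simp add: exp_inverse_deriv_def)

lemma exp_inverse_deriv_0: "exp_inverse_deriv 0 t = (if t > 0 then exp (- inverse t) else 0)"
  by (simp add: exp_inverse_deriv_def flat_exp_def)

definition bump :: "real^'q::finite \<Rightarrow> real" where
  "bump z = exp_inverse_deriv 0 (1 - z \<bullet> z)"

lemma smooth_bump_arg: "smooth (\<lambda>z. 1 - z \<bullet> z)"
  using smooth_add[OF smooth_const[of 1] smooth_mult[OF smooth_const[of "-1"] smooth_square_norm]]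
  by simp

lemma smooth_bump: "smooth bump"
  unfolding bump_def by (rule smooth_compose[of exp_inverse_deriv, OF exp_inverse_deriv_deriv smooth_bump_arg])

lemma bump_range: "0 \<le> bump z" "bump z \<le> 1"
  by (auto simp: bump_def exp_inverse_deriv_0)

lemma bump_pos: "norm z < 1 \<Longrightarrow> bump z > 0"
proof -
  assume "norm z < 1"
  then have "(norm z)\<^sup>2 < 1" by (simp add: power_less_one_iff abs_square_less_1)
  then show ?thesis by (simp add: bump_def exp_inverse_deriv_0 dot_square_norm)
qed

lemma bump_eq_0: "norm z \<ge> 1 \<Longrightarrow> bump z = 0"
proof -
  assume "norm z \<ge> 1"
  then have "(norm z)\<^sup>2 \<ge> 1" by (simp add: one_le_power)
  then show ?thesis by (simp add: bump_def exp_inverse_deriv_0 dot_square_norm)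
qed

lemma test_function_bump: "test_function bump"
  by (rule test_functionI[OF smooth_bump, of 1]) (simp add: bump_eq_0)

text \<open>The bump depends on \<open>z\<close> only through \<open>z \<bullet> z\<close>, so the second derivative in directions \<open>a\<close> and \<open>b\<close>
is an explicit expression that is symmetric in \<open>a\<close> and \<open>b\<close>. This symmetry is the source of the
null Lagrangian identity.\<close>

lemma dir_deriv_bump_commute: "dir_deriv a (dir_deriv b bump) = dir_deriv b (dir_deriv a bump)"
proof -
  have arg: "((\<lambda>z. 1 - z \<bullet> z) has_derivative (\<lambda>h. - 2 * (h \<bullet> z))) (at z)" for z :: "real^'a"
    by (auto intro!: derivative_eq_intros simp: inner_commute)
  have step: "((\<lambda>z. exp_inverse_deriv n (1 - z \<bullet> z)) has_derivative
      (\<lambda>h. exp_inverse_deriv (Suc n) (1 - z \<bullet> z) * (- 2 * (h \<bullet> z)))) (at z)" for n and z :: "real^'a"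
    using has_derivative_compose[OF arg exp_inverse_deriv_deriv[unfolded has_field_derivative_def]] .
  have 1: "dir_deriv b bump = (\<lambda>z. exp_inverse_deriv 1 (1 - z \<bullet> z) * (- 2 * (b \<bullet> z)))" for b :: "real^'a"
    unfolding bump_def using dir_deriv_eq[OF step[of 0]] by (simp add: fun_eq_iff)
  have second: "dir_deriv a (dir_deriv b bump) z = exp_inverse_deriv 1 (1 - z \<bullet> z) * (- 2 * (b \<bullet> a))
      + (exp_inverse_deriv 2 (1 - z \<bullet> z) * (- 2 * (a \<bullet> z))) * (- 2 * (b \<bullet> z))" for a b z :: "real^'a"
  proof -
    have "((\<lambda>z. - 2 * (b \<bullet> z)) has_derivative (\<lambda>h. - 2 * (b \<bullet> h))) (at z)"
      by (auto intro!: derivative_eq_intros)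
    from dir_deriv_eq[OF has_derivative_mult[OF step[of 1 z] this]]
    show ?thesis unfolding 1[of b] by (simp add: numeral_2_eq_2)
  qed
  show ?thesis by (rule ext) (simp only: second, simp add: inner_commute)
qed

section \<open>Integrals against test functions\<close>

text \<open>A locally integrable function is the pointwise limit of its truncations to balls.\<close>

lemma locally_integrable_borel:
  fixes f :: "'a::euclidean_space \<Rightarrow> 'b::euclidean_space"
  assumes "locally_integrable f" shows "f \<in> borel_measurable borel"
proof (rule borel_measurable_LIMSEQ_metric)
  fix n :: nat
  have "set_integrable lborel (cball 0 (real n)) f" using assms by (simp add: locally_integrable_def)
  then show "(\<lambda>x. indicator (cball 0 (real n)) x *\<^sub>R f x) \<in> borel_measurable borel"
    unfolding set_integrable_def by (auto dest: borel_measurable_integrable)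
next
  fix x :: 'a
  obtain N :: nat where N: "norm x \<le> N" using real_arch_simple by blast
  have "eventually (\<lambda>n. f x = indicator (cball 0 (real n)) x *\<^sub>R f x) sequentially"
    using eventually_ge_at_top[of N] by eventually_elim (use N in \<open>auto simp: indicator_def\<close>)
  then show "(\<lambda>n. indicator (cball 0 (real n)) x *\<^sub>R f x) \<longlonglongrightarrow> f x"
    by (rule Lim_transform_eventually[OF tendsto_const])
qed

lemma integrable_locally_integrable_mult:
  fixes f \<phi> :: "'a::euclidean_space \<Rightarrow> real"
  assumes f: "locally_integrable f" and [measurable]: "\<phi> \<in> borel_measurable borel"
    and "\<And>y. \<bar>\<phi> y\<bar> \<le> C" "\<And>y. norm y > R \<Longrightarrow> \<phi> y = 0"
  shows "integrable lborel (\<lambda>y. f y * \<phi> y)"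
proof (rule Bochner_Integration.integrable_bound)
  show "integrable lborel (\<lambda>y. C *\<^sub>R (indicator (cball 0 R) y *\<^sub>R f y))"
    using f by (auto simp: locally_integrable_def set_integrable_def)
  show "(\<lambda>y. f y * \<phi> y) \<in> borel_measurable lborel"
    using locally_integrable_borel[OF f] by measurable
  have "norm (f y * \<phi> y) \<le> norm (C *\<^sub>R (indicator (cball 0 R) y *\<^sub>R f y))" for y
  proof (cases "norm y > R")
    case False
    have "C \<ge> 0" using assms(3)[of y] by linarith
    then show ?thesis using False assms(3)[of y]
      by (auto simp: abs_mult indicator_def mult.commute intro: mult_right_mono)
  qed (simp add: assms(4))
  then show "AE y in lborel. norm (f y * \<phi> y) \<le> norm (C *\<^sub>R (indicator (cball 0 R) y *\<^sub>R f y))" by simp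
qed

lemma locally_integrable_continuous:
  fixes f :: "'a::euclidean_space \<Rightarrow> 'b::euclidean_space"
  assumes "continuous_on UNIV f" shows "locally_integrable f"
  unfolding locally_integrable_def set_integrable_def
  by (auto intro!: borel_integrable_compact continuous_on_subset[OF assms])

lemma integrable_test_mult:
  assumes "locally_integrable f" "test_function \<phi>"
  shows "integrable lborel (\<lambda>y. f y * \<phi> y)"
proof -
  obtain C where "\<And>y. \<bar>\<phi> y\<bar> \<le> C" by (rule test_function_bounded[OF assms(2)]) blast
  moreover obtain R where "\<And>y. norm y > R \<Longrightarrow> \<phi> y = 0" by (rule test_function_support[OF assms(2)]) blast
  ultimately show ?thesis
    by (intro integrable_locally_integrable_mult[OF assms(1) borel_measurable_test_function[OF assms(2)]])
qed

lemma integrable_test_function: "test_function \<phi> \<Longrightarrow> integrable lborel \<phi>"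
  using integrable_test_mult[of "\<lambda>_. 1" \<phi>] locally_integrable_continuous[of "\<lambda>_. 1::real"] by simp

lemma lborel_integral_translate:
  fixes F :: "'a::euclidean_space \<Rightarrow> real"
  assumes "F \<in> borel_measurable borel"
  shows "(LINT y|lborel. F (c + y)) = (LINT y|lborel. F y)"
  using integral_distr[of "(+) c" lborel borel F] lborel_distr_plus[of c] assms by simp

lemma lborel_integrable_translate:
  fixes F :: "'a::euclidean_space \<Rightarrow> real"
  assumes "integrable lborel F" shows "integrable lborel (\<lambda>y. F (c + y))"
  using integrable_distr[of "(+) c" lborel borel F] lborel_distr_plus[of c] assms by simp

lemma lborel_distr_reflect: "distr lborel borel (\<lambda>z. x - z) = (lborel :: 'a::euclidean_space measure)"
  using lborel_affine[of "-1" x] by (simp add: density_1)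

lemma smooth_line_deriv:
  assumes "smooth f"
  shows "((\<lambda>t. f (y + t *\<^sub>R a)) has_real_derivative dir_deriv a f (y + t *\<^sub>R a)) (at t)"
proof -
  interpret linear "\<lambda>h. dir_deriv h f (y + t *\<^sub>R a)"
    by (rule has_derivative_linear[OF smooth_has_derivative[OF assms]])
  have "((\<lambda>t. f (y + t *\<^sub>R a)) has_derivative (\<lambda>h. dir_deriv (h *\<^sub>R a) f (y + t *\<^sub>R a))) (at t)"
    by (rule has_derivative_compose[OF _ smooth_has_derivative[OF assms]])
      (auto intro!: derivative_eq_intros)
  then show ?thesis by (simp add: scale has_field_derivative_def mult_commute_abs)
qed

text \<open>By translation invariance of Lebesgue measure every difference quotient has integral zero. The
mean value theorem bounds the difference quotients uniformly, and their supports lie in a common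
ball, so the integral of the limit is zero as well.\<close>

lemma integral_dir_deriv_eq_0:
  assumes \<phi>: "test_function \<phi>"
  shows "(LINT y|lborel. dir_deriv a \<phi> y) = 0"
proof -
  define t :: "nat \<Rightarrow> real" where "t n = inverse (real (Suc n))" for n
  have t: "0 < t n" "t n \<le> 1" for n by (auto simp: t_def inverse_le_1_iff)
  define D where "D n y = (\<phi> (y + t n *\<^sub>R a) - \<phi> y) / t n" for n y
  obtain R where R: "R > 0" "\<And>y. norm y > R \<Longrightarrow> \<phi> y = 0"
    by (rule test_function_support[OF \<phi>]) blast
  obtain C where C: "C > 0" "\<And>y. \<bar>dir_deriv a \<phi> y\<bar> \<le> C"
    by (rule test_function_bounded[OF test_function_dir_deriv[OF \<phi>]]) blast
  have [measurable]: "\<phi> \<in> borel_measurable borel" "dir_deriv a \<phi> \<in> borel_measurable borel"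
    by (intro borel_measurable_test_function test_function_dir_deriv \<phi>)+
  note deriv = smooth_line_deriv[OF test_function_smooth[OF \<phi>], of _ a]
  have "(\<lambda>n. LINT y|lborel. D n y) \<longlonglongrightarrow> (LINT y|lborel. dir_deriv a \<phi> y)"
  proof (rule integral_dominated_convergence[where w="\<lambda>y. C * indicator (cball 0 (R + norm a)) y"])
    show "D n \<in> borel_measurable lborel" for n unfolding D_def by measurable
    show "integrable lborel (\<lambda>y. C * indicator (cball 0 (R + norm a)) y :: real)"
      by (intro integrable_mult_right integrable_real_indicator) (use emeasure_bounded_finite[OF bounded_cball, of 0 "R + norm a"] in auto)
    have "(\<lambda>n. D n y) \<longlonglongrightarrow> dir_deriv a \<phi> y" for y
    proof -
      have "filterlim t (at 0) sequentially"
        unfolding t_def by (intro filterlim_atI LIMSEQ_inverse_real_of_nat) simp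
      moreover have "((\<lambda>h. (\<phi> (y + h *\<^sub>R a) - \<phi> y) / h) \<longlongrightarrow> dir_deriv a \<phi> y) (at 0)"
        using deriv[of y 0] by (simp add: DERIV_def)
      ultimately show ?thesis unfolding D_def by (rule filterlim_compose[rotated])
    qed
    then show "AE y in lborel. (\<lambda>n. D n y) \<longlonglongrightarrow> dir_deriv a \<phi> y" by simp
    have "norm (D n y) \<le> C * indicator (cball 0 (R + norm a)) y" for n y
    proof (cases "norm y > R + norm a")
      case True
      have "norm (t n *\<^sub>R a) \<le> norm a" using t[of n] by (auto simp: mult_left_le_one_le)
      then have "norm (y + t n *\<^sub>R a) > R" using True norm_diff_ineq[of y "t n *\<^sub>R a"] by linarith
      moreover have "norm y > R" using True norm_ge_zero[of a] by linarith
      ultimately show ?thesis using R True by (simp add: D_def)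
    next
      case False
      have "\<exists>z>0. z < t n \<and> \<phi> (y + t n *\<^sub>R a) - \<phi> (y + 0 *\<^sub>R a) = (t n - 0) * dir_deriv a \<phi> (y + z *\<^sub>R a)"
        using MVT2[of 0 "t n" "\<lambda>t. \<phi> (y + t *\<^sub>R a)" "\<lambda>t. dir_deriv a \<phi> (y + t *\<^sub>R a)"] t[of n] deriv[of y] by auto
      then obtain z where "D n y = dir_deriv a \<phi> (y + z *\<^sub>R a)" using t[of n] by (auto simp: D_def)
      then show ?thesis using C(2)[of "y + z *\<^sub>R a"] False by (simp add: indicator_def)
    qed
    then show "AE y in lborel. norm (D n y) \<le> C * indicator (cball 0 (R + norm a)) y" for n by simp
  qed measurable
  moreover have "(LINT y|lborel. D n y) = 0" for n
  proof -
    have "integrable lborel (\<lambda>y. \<phi> (t n *\<^sub>R a + y))"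
      by (intro lborel_integrable_translate integrable_test_function \<phi>)
    then have "(LINT y|lborel. D n y) = ((LINT y|lborel. \<phi> (t n *\<^sub>R a + y)) - (LINT y|lborel. \<phi> y)) / t n"
      unfolding D_def using integrable_test_function[OF \<phi>] by (simp add: add.commute)
    then show ?thesis by (simp add: lborel_integral_translate)
  qed
  ultimately show ?thesis by (simp add: LIMSEQ_const_iff)
qed

section \<open>Continuity of translations in L1 and L2\<close>

lemma tendsto_0_by_approximation:
  fixes u :: "nat \<Rightarrow> real"
  assumes "\<And>n. 0 \<le> u n" "\<And>e. e > 0 \<Longrightarrow> \<exists>h. h \<longlonglongrightarrow> 0 \<and> (\<forall>n. u n \<le> h n + e)"
  shows "u \<longlonglongrightarrow> 0"
proof (rule LIMSEQ_I)
  fix r :: real assume "r > 0"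
  then obtain h where h: "h \<longlonglongrightarrow> 0" "\<forall>n. u n \<le> h n + r / 2" using assms(2)[of "r / 2"] by auto
  obtain N where N: "\<forall>n\<ge>N. norm (h n - 0) < r / 2" using LIMSEQ_D[OF h(1), of "r / 2"] \<open>r > 0\<close> by auto
  have "norm (u n - 0) < r" if "n \<ge> N" for n
  proof -
    have "h n < r / 2" using N that by (auto simp: abs_less_iff)
    moreover have "u n \<le> h n + r / 2" "0 \<le> u n" using h(2) assms(1) by auto
    ultimately show ?thesis by simp
  qed
  then show "\<exists>no. \<forall>n\<ge>no. norm (u n - 0) < r" by blast
qed

definition translation_L1_dist :: "('a::euclidean_space \<Rightarrow> real) \<Rightarrow> 'a \<Rightarrow> real" where
  "translation_L1_dist f c = (LINT x|lborel. \<bar>f (c + x) - f x\<bar>)"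

lemma translation_L1_dist_nonneg: "0 \<le> translation_L1_dist f c"
  by (simp add: translation_L1_dist_def)

lemma translation_L1_dist_approx:
  fixes f g :: "'a::euclidean_space \<Rightarrow> real"
  assumes f: "integrable lborel f" and g: "integrable lborel g"
  shows "translation_L1_dist f c \<le> translation_L1_dist g c + 2 * (LINT x|lborel. \<bar>f x - g x\<bar>)"
proof -
  define h where "h x = \<bar>f x - g x\<bar>" for x
  have h: "integrable lborel h" unfolding h_def using f g by auto
  note fc = lborel_integrable_translate[OF f, of c] and gc = lborel_integrable_translate[OF g, of c]
    and hc = lborel_integrable_translate[OF h, of c]
  have "translation_L1_dist f c \<le> (LINT x|lborel. h (c + x) + \<bar>g (c + x) - g x\<bar> + h x)"
    unfolding translation_L1_dist_def
    by (rule integral_mono) (use f g h fc gc hc in \<open>auto simp: h_def\<close>)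
  also have "\<dots> = (LINT x|lborel. h (c + x)) + translation_L1_dist g c + (LINT x|lborel. h x)"
    unfolding translation_L1_dist_def using f g h fc gc hc by simp
  also have "(LINT x|lborel. h (c + x)) = (LINT x|lborel. h x)"
    using h by (intro lborel_integral_translate) auto
  finally show ?thesis by (simp add: h_def)
qed

text \<open>If \<open>U\<close> is open, a point of \<open>U\<close> stays in \<open>U\<close> under all small translations. Hence the overlap of
\<open>U\<close> with its translates converges to \<open>U\<close> pointwise, and the symmetric difference loses its
measure. For general measurable sets no pointwise argument is available.\<close>

lemma translation_L1_tendsto_open:
  fixes U :: "'a::euclidean_space set"
  assumes U: "open U" "emeasure lborel U < \<infinity>" and c: "c \<longlonglongrightarrow> 0"
  shows "(\<lambda>n. translation_L1_dist (indicator U) (c n)) \<longlonglongrightarrow> 0"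
proof -
  define i :: "'a \<Rightarrow> real" where "i = indicator U"
  have [measurable]: "U \<in> sets borel" "i \<in> borel_measurable borel" using U by (auto simp: i_def)
  have i: "integrable lborel i" unfolding i_def using U by (intro integrable_real_indicator) auto
  note ic = lborel_integrable_translate[OF i]
  have icc: "integrable lborel (\<lambda>x. i x * i (c n + x))" for n
    by (rule Bochner_Integration.integrable_bound[OF i]) (auto simp: i_def indicator_def)
  have "(\<lambda>n. LINT x|lborel. i x * i (c n + x)) \<longlonglongrightarrow> (LINT x|lborel. i x)"
  proof (rule integral_dominated_convergence[OF _ _ i])
    have "(\<lambda>n. i x * i (c n + x)) \<longlonglongrightarrow> i x" for x
    proof (cases "x \<in> U")
      case True
      have "(\<lambda>n. c n + x) \<longlonglongrightarrow> 0 + x" by (intro tendsto_intros c)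
      then have "eventually (\<lambda>n. c n + x \<in> U) sequentially"
        using U(1) True by (auto simp: tendsto_def)
      then have "eventually (\<lambda>n. i x = i x * i (c n + x)) sequentially"
        by eventually_elim (auto simp: i_def)
      then show ?thesis by (rule Lim_transform_eventually[OF tendsto_const])
    qed (simp add: i_def)
    then show "AE x in lborel. (\<lambda>n. i x * i (c n + x)) \<longlonglongrightarrow> i x" by simp
  qed (auto simp: i_def indicator_def)
  then have "(\<lambda>n. 2 * (LINT x|lborel. i x) - 2 * (LINT x|lborel. i x * i (c n + x)))
      \<longlonglongrightarrow> 2 * (LINT x|lborel. i x) - 2 * (LINT x|lborel. i x)"
    by (intro tendsto_intros)
  moreover have "translation_L1_dist i (c n) = 2 * (LINT x|lborel. i x) - 2 * (LINT x|lborel. i x * i (c n + x))" for n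
  proof -
    have "translation_L1_dist i (c n) = (LINT x|lborel. i (c n + x) + i x - 2 * (i x * i (c n + x)))"
      unfolding translation_L1_dist_def by (rule Bochner_Integration.integral_cong) (auto simp: i_def indicator_def)
    also have "\<dots> = (LINT x|lborel. i (c n + x)) + (LINT x|lborel. i x) - 2 * (LINT x|lborel. i x * i (c n + x))"
      using i ic icc by simp
    finally show ?thesis using lborel_integral_translate[of i "c n"] by simp
  qed
  ultimately show ?thesis by (simp add: i_def)
qed

text \<open>Outer regularity extends the result from open sets to all sets of finite measure, and the
property is stable under sums and \<open>L\<^sup>1\<close> limits.\<close>

lemma translation_L1_tendsto:
  fixes f :: "'a::euclidean_space \<Rightarrow> real"
  assumes f: "integrable lborel f" and c: "c \<longlonglongrightarrow> 0"
  shows "(\<lambda>n. translation_L1_dist f (c n)) \<longlonglongrightarrow> 0"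
  using f
proof (induction rule: integrable_induct)
  case (base A r)
  then have A: "A \<in> sets borel" "emeasure lborel A < \<infinity>" by auto
  have A_int: "integrable lborel (indicator A :: _ \<Rightarrow> real)"
    using base by (intro integrable_real_indicator) auto
  have "(\<lambda>n. translation_L1_dist (indicator A) (c n)) \<longlonglongrightarrow> 0"
  proof (rule tendsto_0_by_approximation[OF translation_L1_dist_nonneg])
    fix e :: real assume "e > 0"
    then obtain U where U: "open U" "A \<subseteq> U" "emeasure lborel (U - A) < ennreal (e / 2)"
      using outer_regular_lborel[OF A(1), of "e / 2"] by auto
    have UA: "emeasure lborel (U - A) < \<infinity>" using U(3) by (simp add: order_less_le_trans)
    have "emeasure lborel U = emeasure lborel (A \<union> (U - A))" using U(2) by (simp add: Un_absorb1)
    also have "\<dots> \<le> emeasure lborel A + emeasure lborel (U - A)"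
      using A U by (intro emeasure_subadditive) auto
    also have "\<dots> < \<infinity>" using A(2) UA by simp
    finally have Ufin: "emeasure lborel U < \<infinity>" .
    have U_int: "integrable lborel (indicator U :: _ \<Rightarrow> real)"
      using U Ufin by (intro integrable_real_indicator) auto
    have "(LINT x|lborel. \<bar>indicator A x - indicator U x :: real\<bar>) = (LINT x|lborel. indicator (U - A) x)"
      by (rule Bochner_Integration.integral_cong) (use U(2) in \<open>auto simp: indicator_def\<close>)
    also have "\<dots> = measure lborel (U - A)" by simp
    also have "\<dots> \<le> e / 2"
      unfolding measure_def using U(3) \<open>e > 0\<close> by (intro enn2real_leI) auto
    finally have "translation_L1_dist (indicator A) (c n) \<le> translation_L1_dist (indicator U) (c n) + e" for n
      using translation_L1_dist_approx[OF A_int U_int, of "c n"] by linarith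
    then show "\<exists>h. h \<longlonglongrightarrow> 0 \<and> (\<forall>n. translation_L1_dist (indicator A) (c n) \<le> h n + e)"
      using translation_L1_tendsto_open[OF U(1) Ufin c] by blast
  qed
  then have "(\<lambda>n. translation_L1_dist (indicator A) (c n) * \<bar>r\<bar>) \<longlonglongrightarrow> 0 * \<bar>r\<bar>"
    by (intro tendsto_intros)
  moreover have "translation_L1_dist (\<lambda>x. indicator A x *\<^sub>R r) (c n) = translation_L1_dist (indicator A) (c n) * \<bar>r\<bar>" for n
    unfolding translation_L1_dist_def
    by (simp add: left_diff_distrib[symmetric] abs_mult)
  ultimately show ?case by simp
next
  case (add f g)
  note fc = lborel_integrable_translate[OF add(1)] and gc = lborel_integrable_translate[OF add(2)]
  have "(\<lambda>n. translation_L1_dist f (c n) + translation_L1_dist g (c n)) \<longlonglongrightarrow> 0 + 0"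
    by (intro tendsto_add add)
  moreover have "translation_L1_dist (\<lambda>x. f x + g x) (c n) \<le> translation_L1_dist f (c n) + translation_L1_dist g (c n)" for n
  proof -
    have "translation_L1_dist (\<lambda>x. f x + g x) (c n) \<le> (LINT x|lborel. \<bar>f (c n + x) - f x\<bar> + \<bar>g (c n + x) - g x\<bar>)"
      unfolding translation_L1_dist_def
      by (rule integral_mono) (use add fc gc in auto)
    then show ?thesis unfolding translation_L1_dist_def using add fc gc by simp
  qed
  ultimately show ?case
    by - (rule Lim_null_comparison[where g="\<lambda>n. translation_L1_dist f (c n) + translation_L1_dist g (c n)"],
        simp_all add: translation_L1_dist_nonneg)
next
  case (lim f s)
  have "(\<lambda>i. LINT x|lborel. \<bar>f x - s i x\<bar>) \<longlonglongrightarrow> (LINT x|(lborel :: 'a measure). 0)"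
  proof (rule integral_dominated_convergence[where w="\<lambda>x. 3 * \<bar>f x\<bar>"])
    have [measurable]: "f \<in> borel_measurable borel" "\<And>i. s i \<in> borel_measurable borel"
      using lim by auto
    show "(\<lambda>x. \<bar>f x - s i x\<bar>) \<in> borel_measurable lborel" for i by measurable
    have "(\<lambda>i. \<bar>f x - s i x\<bar>) \<longlonglongrightarrow> \<bar>f x - f x\<bar>" for x
      using lim(2)[of x] by (intro tendsto_intros) auto
    then show "AE x in lborel. (\<lambda>i. \<bar>f x - s i x\<bar>) \<longlonglongrightarrow> 0" by simp
    have "norm \<bar>f x - s i x\<bar> \<le> 3 * \<bar>f x\<bar>" for i x using lim(3)[of x i] by auto
    then show "AE x in lborel. norm \<bar>f x - s i x\<bar> \<le> 3 * \<bar>f x\<bar>" for i by simp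
  qed (use lim in auto)
  then have approx: "(\<lambda>i. LINT x|lborel. \<bar>f x - s i x\<bar>) \<longlonglongrightarrow> 0" by simp
  show ?case
  proof (rule tendsto_0_by_approximation[OF translation_L1_dist_nonneg])
    fix e :: real assume "e > 0"
    then obtain i where "(LINT x|lborel. \<bar>f x - s i x\<bar>) < e / 2"
      using order_tendstoD(2)[OF approx, of "e / 2"] by (auto simp: eventually_sequentially)
    then have "translation_L1_dist f (c n) \<le> translation_L1_dist (s i) (c n) + e" for n
      using translation_L1_dist_approx[OF lim(4) lim(1), of "c n" i] by linarith
    then show "\<exists>h. h \<longlonglongrightarrow> 0 \<and> (\<forall>n. translation_L1_dist f (c n) \<le> h n + e)"
      using lim(5)[of i] by blast
  qed
qed

definition square_integrable :: "('a::euclidean_space \<Rightarrow> real) \<Rightarrow> bool" where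
  "square_integrable f \<longleftrightarrow> f \<in> borel_measurable borel \<and> integrable lborel (\<lambda>x. (f x)\<^sup>2)"

lemma abs_mult_le_sum_squares: "\<bar>a * b\<bar> \<le> a\<^sup>2 + b\<^sup>2" for a b :: real
proof -
  have "0 \<le> (\<bar>a\<bar> - \<bar>b\<bar>)\<^sup>2" by simp
  then have "2 * \<bar>a * b\<bar> \<le> a\<^sup>2 + b\<^sup>2" by (simp add: power2_diff abs_mult mult.assoc)
  then show ?thesis using abs_ge_zero[of "a * b"] by linarith
qed

lemma integrable_mult_of_squares:
  fixes f g :: "'a \<Rightarrow> real"
  assumes [measurable]: "f \<in> borel_measurable M" "g \<in> borel_measurable M"
    and "integrable M (\<lambda>x. (f x)\<^sup>2)" "integrable M (\<lambda>x. (g x)\<^sup>2)"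
  shows "integrable M (\<lambda>x. f x * g x)"
proof (rule Bochner_Integration.integrable_bound)
  show "integrable M (\<lambda>x. (f x)\<^sup>2 + (g x)\<^sup>2)" using assms by simp
  show "AE x in M. norm (f x * g x) \<le> norm ((f x)\<^sup>2 + (g x)\<^sup>2)"
    by (simp add: abs_mult_le_sum_squares)
qed measurable

text \<open>Reduction to \<open>L\<^sup>1\<close>: keeping only the values of \<open>f\<close> of modulus between \<open>1/k\<close> and \<open>k\<close> gives a
function \<open>g k\<close> that is both bounded and integrable, and a function bounded by \<open>k\<close> satisfies
\<open>(g(c + x) - g(x))\<^sup>2 \<le> 2 k |g(c + x) - g(x)|\<close>.\<close>

lemma translation_L2_tendsto:
  fixes f :: "'a::euclidean_space \<Rightarrow> real"
  assumes f: "square_integrable f" and c: "c \<longlonglongrightarrow> 0"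
  shows "(\<lambda>n. LINT x|lborel. (f (c n + x) - f x)\<^sup>2) \<longlonglongrightarrow> 0"
proof -
  have [measurable]: "f \<in> borel_measurable borel" and f2: "integrable lborel (\<lambda>x. (f x)\<^sup>2)"
    using f by (auto simp: square_integrable_def)
  define g where "g k x = (if 1 \<le> real k * \<bar>f x\<bar> \<and> \<bar>f x\<bar> \<le> real k then f x else 0)" for k x
  have g_meas [measurable]: "g k \<in> borel_measurable borel" for k unfolding g_def by measurable
  have g_bound: "\<bar>g k x\<bar> \<le> real k" for k x by (auto simp: g_def)
  have g_int: "integrable lborel (g k)" for k
  proof (rule Bochner_Integration.integrable_bound)
    show "integrable lborel (\<lambda>x. real k * (f x)\<^sup>2)" using f2 by simp
    have "\<bar>g k x\<bar> \<le> real k * (f x)\<^sup>2" for x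
    proof (cases "1 \<le> real k * \<bar>f x\<bar>")
      case True
      then have "1 * \<bar>f x\<bar> \<le> (real k * \<bar>f x\<bar>) * \<bar>f x\<bar>" by (intro mult_right_mono) auto
      then show ?thesis by (auto simp: g_def power2_eq_square mult.assoc)
    qed (auto simp: g_def)
    then show "AE x in lborel. norm (g k x) \<le> norm (real k * (f x)\<^sup>2)" by (simp add: abs_mult)
  qed measurable
  define h where "h k x = (f x - g k x)\<^sup>2" for k x
  have h_meas [measurable]: "h k \<in> borel_measurable borel" for k unfolding h_def by measurable
  have h_le: "h k x \<le> (f x)\<^sup>2" "0 \<le> h k x" for k x by (auto simp: h_def g_def)
  have h_int: "integrable lborel (h k)" for k
    by (rule Bochner_Integration.integrable_bound[OF f2]) (auto simp: h_le)
  have "(\<lambda>k. LINT x|lborel. h k x) \<longlonglongrightarrow> (LINT x|(lborel :: 'a measure). 0)"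
  proof (rule integral_dominated_convergence[OF _ _ f2])
    have "(\<lambda>k. h k x) \<longlonglongrightarrow> 0" for x
    proof (cases "f x = 0")
      case False
      obtain N :: nat where N: "max \<bar>f x\<bar> (inverse \<bar>f x\<bar>) \<le> real N" using real_arch_simple by blast
      have "eventually (\<lambda>k. 0 = h k x) sequentially"
        using eventually_ge_at_top[of N]
      proof eventually_elim
        case (elim k)
        then have "\<bar>f x\<bar> \<le> real k" "inverse \<bar>f x\<bar> \<le> real k" using N by auto
        moreover from this have "inverse \<bar>f x\<bar> * \<bar>f x\<bar> \<le> real k * \<bar>f x\<bar>" by (intro mult_right_mono) auto
        ultimately show ?case using False by (simp add: h_def g_def)
      qed
      then show ?thesis by (rule Lim_transform_eventually[OF tendsto_const])
    qed (simp add: h_def g_def)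
    then show "AE x in lborel. (\<lambda>k. h k x) \<longlonglongrightarrow> 0" by simp
  qed (auto simp: h_le)
  then have approx: "(\<lambda>k. LINT x|lborel. h k x) \<longlonglongrightarrow> 0" by simp
  show ?thesis
  proof (rule tendsto_0_by_approximation)
    fix e :: real assume "e > 0"
    then obtain k where k: "(LINT x|lborel. h k x) < e / 6"
      using order_tendstoD(2)[OF approx, of "e / 6"] by (auto simp: eventually_sequentially)
    have bound: "(f (c n + x) - f x)\<^sup>2 \<le> 3 * h k (c n + x) + 6 * real k * \<bar>g k (c n + x) - g k x\<bar> + 3 * h k x" for n x
    proof -
      \<comment> \<open>Applied to the errors \<open>f - g k\<close> at the two points and the increment of \<open>g k\<close> between them.\<close>
      have three: "(a + b + d)\<^sup>2 \<le> 3 * a\<^sup>2 + 3 * b\<^sup>2 + 3 * d\<^sup>2" for a b d :: real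
        using zero_le_power2[of "a - b"] zero_le_power2[of "a - d"] zero_le_power2[of "b - d"]
        by (simp add: power2_eq_square algebra_simps)
      have "\<bar>g k (c n + x) - g k x\<bar> * \<bar>g k (c n + x) - g k x\<bar> \<le> (2 * real k) * \<bar>g k (c n + x) - g k x\<bar>"
        using g_bound[of k x] g_bound[of k "c n + x"] by (intro mult_right_mono) linarith+
      then have "(g k (c n + x) - g k x)\<^sup>2 \<le> 2 * real k * \<bar>g k (c n + x) - g k x\<bar>"
        by (simp add: power2_eq_square)
      moreover have "(f (c n + x) - f x)\<^sup>2 \<le> 3 * (f (c n + x) - g k (c n + x))\<^sup>2 + 3 * (g k (c n + x) - g k x)\<^sup>2 + 3 * (g k x - f x)\<^sup>2"
        using three[of "f (c n + x) - g k (c n + x)" "g k (c n + x) - g k x" "g k x - f x"] by simp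
      ultimately show ?thesis unfolding h_def by (simp add: power2_commute[of "f x"])
    qed
    note gc = lborel_integrable_translate[OF g_int] and hc = lborel_integrable_translate[OF h_int]
    have "(LINT x|lborel. (f (c n + x) - f x)\<^sup>2) \<le> 6 * real k * translation_L1_dist (g k) (c n) + e" for n
    proof -
      have int: "integrable lborel (\<lambda>x. 3 * h k (c n + x) + 6 * real k * \<bar>g k (c n + x) - g k x\<bar> + 3 * h k x)"
        using h_int g_int gc hc by simp
      have "(LINT x|lborel. (f (c n + x) - f x)\<^sup>2) \<le> (LINT x|lborel. 3 * h k (c n + x) + 6 * real k * \<bar>g k (c n + x) - g k x\<bar> + 3 * h k x)"
      proof (rule integral_mono[OF _ int bound])
        show "integrable lborel (\<lambda>x. (f (c n + x) - f x)\<^sup>2)"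
        proof (rule Bochner_Integration.integrable_bound[OF int])
          show "AE x in lborel. norm ((f (c n + x) - f x)\<^sup>2) \<le> norm (3 * h k (c n + x) + 6 * real k * \<bar>g k (c n + x) - g k x\<bar> + 3 * h k x)"
            using bound by (auto intro!: AE_I2 order_trans[OF _ abs_ge_self])
        qed measurable
      qed
      also have "\<dots> = 3 * (LINT x|lborel. h k (c n + x)) + 6 * real k * translation_L1_dist (g k) (c n) + 3 * (LINT x|lborel. h k x)"
        unfolding translation_L1_dist_def using h_int g_int gc hc by simp
      also have "(LINT x|lborel. h k (c n + x)) = (LINT x|lborel. h k x)"
        by (intro lborel_integral_translate) measurable
      finally show ?thesis using k by simp
    qed
    moreover have "(\<lambda>n. 6 * real k * translation_L1_dist (g k) (c n)) \<longlonglongrightarrow> 6 * real k * 0"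
      by (intro tendsto_intros translation_L1_tendsto g_int c)
    ultimately show "\<exists>u. u \<longlonglongrightarrow> 0 \<and> (\<forall>n. (LINT x|lborel. (f (c n + x) - f x)\<^sup>2) \<le> u n + e)" by auto
  qed simp
qed

text \<open>The inequality \<open>|a b| \<le> d a\<^sup>2 + b\<^sup>2 / d\<close> with a small parameter \<open>d\<close> takes the place of the
Cauchy-Schwarz inequality here.\<close>

lemma translation_correlation_continuous:
  fixes F G :: "'a::euclidean_space \<Rightarrow> real"
  assumes F: "square_integrable F" and G: "square_integrable G"
  shows "isCont (\<lambda>z. LINT x|lborel. F x * G (z + x)) 0"
  unfolding continuous_at_sequentially comp_def
proof (intro allI impI)
  fix c :: "nat \<Rightarrow> 'a" assume c: "c \<longlonglongrightarrow> 0"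
  have [measurable]: "F \<in> borel_measurable borel" "G \<in> borel_measurable borel"
    and F2: "integrable lborel (\<lambda>x. (F x)\<^sup>2)" and G2: "integrable lborel (\<lambda>x. (G x)\<^sup>2)"
    using F G by (auto simp: square_integrable_def)
  have Gc: "integrable lborel (\<lambda>x. (G (z + x))\<^sup>2)" for z using lborel_integrable_translate[OF G2] .
  have FGc: "integrable lborel (\<lambda>x. F x * G (z + x))" for z
    by (rule integrable_mult_of_squares) (use F2 Gc in auto)
  have diff2: "integrable lborel (\<lambda>x. (G (z + x) - G x)\<^sup>2)" for z
  proof -
    have "integrable lborel (\<lambda>x. (G (z + x))\<^sup>2 + (G x)\<^sup>2 - 2 * (G (z + x) * G x))"
      using integrable_mult_of_squares[of "\<lambda>x. G (z + x)" lborel G] Gc G2 by simp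
    then show ?thesis by (simp add: power2_diff mult.assoc)
  qed
  define A where "A = (LINT x|lborel. (F x)\<^sup>2)"
  have "A \<ge> 0" by (simp add: A_def)
  define D where "D n = (LINT x|lborel. (G (c n + x) - G x)\<^sup>2)" for n
  have "(\<lambda>n. \<bar>(LINT x|lborel. F x * G (c n + x)) - (LINT x|lborel. F x * G (0 + x))\<bar>) \<longlonglongrightarrow> 0"
  proof (rule tendsto_0_by_approximation)
    fix e :: real assume "e > 0"
    \<comment> \<open>Adding 1 avoids a case distinction for \<open>A = 0\<close>.\<close>
    define d where "d = e / (A + 1)"
    have "d > 0" "d * A \<le> e" using \<open>e > 0\<close> \<open>A \<ge> 0\<close> by (auto simp: d_def field_simps)
    have "\<bar>(LINT x|lborel. F x * G (c n + x)) - (LINT x|lborel. F x * G (0 + x))\<bar> \<le> inverse d * D n + e" for n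
    proof -
      have int: "integrable lborel (\<lambda>x. F x * (G (c n + x) - G x))"
        using FGc[of "c n"] FGc[of 0] by (simp add: right_diff_distrib)
      have "(LINT x|lborel. F x * G (c n + x)) - (LINT x|lborel. F x * G (0 + x)) = (LINT x|lborel. F x * (G (c n + x) - G x))"
        using FGc[of "c n"] FGc[of 0] by (simp add: right_diff_distrib)
      also have "\<bar>\<dots>\<bar> \<le> (LINT x|lborel. \<bar>F x * (G (c n + x) - G x)\<bar>)" by (rule integral_abs_bound)
      also have "\<dots> \<le> (LINT x|lborel. d * (F x)\<^sup>2 + inverse d * (G (c n + x) - G x)\<^sup>2)"
      proof (rule integral_mono)
        show "integrable lborel (\<lambda>x. d * (F x)\<^sup>2 + inverse d * (G (c n + x) - G x)\<^sup>2)"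
          using F2 diff2 by simp
        have young: "\<bar>a * b\<bar> \<le> d * a\<^sup>2 + inverse d * b\<^sup>2" for a b :: real
        proof -
          have "0 \<le> (d * \<bar>a\<bar> - \<bar>b\<bar>)\<^sup>2" by simp
          then have "2 * d * \<bar>a * b\<bar> \<le> d\<^sup>2 * a\<^sup>2 + b\<^sup>2" by (simp add: power2_diff power_mult_distrib abs_mult mult_ac)
          then have "2 * \<bar>a * b\<bar> \<le> d * a\<^sup>2 + inverse d * b\<^sup>2"
            using \<open>d > 0\<close> by (simp add: field_simps power2_eq_square)
          then show ?thesis by linarith
        qed
        then show "\<bar>F x * (G (c n + x) - G x)\<bar> \<le> d * (F x)\<^sup>2 + inverse d * (G (c n + x) - G x)\<^sup>2" for x .
      qed (use int in simp)
      also have "\<dots> = d * A + inverse d * D n"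
        unfolding A_def D_def using F2 diff2 by simp
      finally show ?thesis using \<open>d * A \<le> e\<close> by linarith
    qed
    moreover have "(\<lambda>n. inverse d * D n) \<longlonglongrightarrow> inverse d * 0"
      unfolding D_def by (intro tendsto_intros translation_L2_tendsto G c)
    ultimately show "\<exists>h. h \<longlonglongrightarrow> 0 \<and> (\<forall>n. \<bar>(LINT x|lborel. F x * G (c n + x)) - (LINT x|lborel. F x * G (0 + x))\<bar> \<le> h n + e)"
      by auto
  qed simp
  then show "(\<lambda>n. LINT x|lborel. F x * G (c n + x)) \<longlonglongrightarrow> (LINT x|lborel. F x * G (0 + x))"
    unfolding tendsto_rabs_zero_iff by (simp add: LIM_zero_iff)
qed

section \<open>Products of weak derivatives\<close>

definition locally_square_integrable :: "('a::euclidean_space \<Rightarrow> real) \<Rightarrow> bool" where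
  "locally_square_integrable f \<longleftrightarrow>
     f \<in> borel_measurable borel \<and> locally_integrable (\<lambda>x. (f x)\<^sup>2)"

lemma square_integrable_mult_bounded:
  fixes f \<psi> :: "'a::euclidean_space \<Rightarrow> real"
  assumes f: "locally_square_integrable f" and [measurable]: "\<psi> \<in> borel_measurable borel"
    and \<psi>: "\<And>y. \<bar>\<psi> y\<bar> \<le> C" "\<And>y. norm y > R \<Longrightarrow> \<psi> y = 0"
  shows "square_integrable (\<lambda>y. \<psi> y * f y)"
  unfolding square_integrable_def
proof
  have [measurable]: "f \<in> borel_measurable borel" using f by (simp add: locally_square_integrable_def)
  show "(\<lambda>y. \<psi> y * f y) \<in> borel_measurable borel" by measurable
  have "integrable lborel (\<lambda>y. (f y)\<^sup>2 * (\<psi> y)\<^sup>2)"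
  proof (rule integrable_locally_integrable_mult)
    show "\<bar>(\<psi> y)\<^sup>2\<bar> \<le> C\<^sup>2" for y using \<psi>(1)[of y] by (metis abs_ge_zero abs_power2 power2_abs power_mono)
    show "norm y > R \<Longrightarrow> (\<psi> y)\<^sup>2 = 0" for y by (simp add: \<psi>(2))
  qed (use f in \<open>auto simp: locally_square_integrable_def\<close>)
  then show "integrable lborel (\<lambda>x. (\<psi> x * f x)\<^sup>2)" by (simp add: power_mult_distrib mult.commute)
qed

lemma square_integrable_mult_test:
  assumes "locally_square_integrable f" "test_function \<psi>"
  shows "square_integrable (\<lambda>y. \<psi> y * f y)"
proof -
  obtain C where "\<And>y. \<bar>\<psi> y\<bar> \<le> C" by (rule test_function_bounded[OF assms(2)]) blast
  moreover obtain R where "\<And>y. norm y > R \<Longrightarrow> \<psi> y = 0" by (rule test_function_support[OF assms(2)]) blast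
  ultimately show ?thesis
    by (rule square_integrable_mult_bounded[OF assms(1) borel_measurable_test_function[OF assms(2)]])
qed

text \<open>The analogue of a weak Jacobian for one scalar function and one direction.\<close>

definition weak_deriv :: "real^'q::finite \<Rightarrow> (real^'q \<Rightarrow> real) \<Rightarrow> (real^'q \<Rightarrow> real) \<Rightarrow> bool" where
  "weak_deriv a f f' \<longleftrightarrow> locally_integrable f \<and> locally_integrable f' \<and>
     (\<forall>\<phi>. test_function \<phi> \<longrightarrow>
        (LINT y|lborel. f y * dir_deriv a \<phi> y) = - (LINT y|lborel. f' y * \<phi> y))"

text \<open>The factors \<open>f\<close> and \<open>g\<close> sit at different points, so that each of them can be differentiated
weakly with the other variable held fixed, the kernel \<open>k(x - y)\<close> serving as test function. When
\<open>k\<close> concentrates at the origin, the form approaches a multiple of \<open>\<integral> \<psi> f g\<close>.\<close>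

definition two_point_form ::
  "(real^'q::finite \<Rightarrow> real) \<Rightarrow> (real^'q \<Rightarrow> real) \<Rightarrow> (real^'q \<Rightarrow> real) \<Rightarrow> (real^'q \<Rightarrow> real) \<Rightarrow> real" where
  "two_point_form \<psi> f g k = (LINT x|lborel. LINT y|lborel. \<psi> x * f x * g y * k (x - y))"

lemma integrable_two_point:
  assumes \<psi>: "test_function \<psi>" and k: "test_function k"
    and f: "locally_integrable f" and g: "locally_integrable g"
  shows "integrable (lborel \<Otimes>\<^sub>M lborel) (\<lambda>(x, y). \<psi> x * f x * g y * k (x - y))"
proof -
  obtain C where C: "\<And>y. \<bar>k y\<bar> \<le> C" by (rule test_function_bounded[OF k]) blast
  obtain R where R: "\<And>y. norm y > R \<Longrightarrow> \<psi> y = 0" by (rule test_function_support[OF \<psi>]) blast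
  obtain S where S: "\<And>y. norm y > S \<Longrightarrow> k y = 0" by (rule test_function_support[OF k]) blast
  have [measurable]: "f \<in> borel_measurable borel" "g \<in> borel_measurable borel"
    "\<psi> \<in> borel_measurable borel" "k \<in> borel_measurable borel"
    using f g \<psi> k by (auto intro: locally_integrable_borel borel_measurable_test_function)
  define g' where "g' y = indicator (cball 0 (R + S)) y * g y" for y
  have g': "integrable lborel g'"
    using g unfolding locally_integrable_def set_integrable_def g'_def[abs_def] by simp
  have f': "integrable lborel (\<lambda>x. \<psi> x * f x)"
    using integrable_test_mult[OF f \<psi>] by (simp add: mult.commute)
  have [measurable]: "g' \<in> borel_measurable borel" using g' by auto
  have "integrable (lborel \<Otimes>\<^sub>M lborel) (\<lambda>(x, y). C * (\<psi> x * f x) * g' y)"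
  proof (rule lborel_pair.Fubini_integrable)
    show "integrable lborel (\<lambda>x. LINT y|lborel. norm (case (x, y) of (x, y) \<Rightarrow> C * (\<psi> x * f x) * g' y))"
      using f' by (simp add: abs_mult mult.assoc)
        (simp add: abs_mult[symmetric] mult.assoc[symmetric] del: abs_mult)
    show "AE x in lborel. integrable lborel (\<lambda>y. case (x, y) of (x, y) \<Rightarrow> C * (\<psi> x * f x) * g' y)"
      using g' by simp
  qed measurable
  then show ?thesis
  proof (rule Bochner_Integration.integrable_bound)
    show "(\<lambda>(x, y). \<psi> x * f x * g y * k (x - y)) \<in> borel_measurable (lborel \<Otimes>\<^sub>M lborel)"
      by measurable
    have "\<bar>\<psi> x * f x * g y * k (x - y)\<bar> \<le> \<bar>C * (\<psi> x * f x) * g' y\<bar>" for x y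
    proof (cases "norm x > R \<or> norm (x - y) > S")
      case False
      then have "norm y \<le> R + S" using norm_triangle_ineq4[of x "x - y"] by simp
      then have "g' y = g y" by (simp add: g'_def)
      moreover have "\<bar>k (x - y)\<bar> \<le> \<bar>C\<bar>" using C[of "x - y"] by linarith
      then have "\<bar>\<psi> x * f x * g y\<bar> * \<bar>k (x - y)\<bar> \<le> \<bar>\<psi> x * f x * g y\<bar> * \<bar>C\<bar>"
        by (rule mult_left_mono) simp
      ultimately show ?thesis by (simp add: abs_mult mult_ac)
    qed (use R S in auto)
    then show "AE p in lborel \<Otimes>\<^sub>M lborel. norm (case p of (x, y) \<Rightarrow> \<psi> x * f x * g y * k (x - y))
        \<le> norm (case p of (x, y) \<Rightarrow> C * (\<psi> x * f x) * g' y)" by auto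
  qed
qed

lemma test_function_reflect:
  assumes "test_function k" shows "test_function (\<lambda>y. k (x - y))"
  using test_function_affine[OF assms, of "-1" x] by simp

lemma dir_deriv_reflect:
  assumes "test_function k" shows "dir_deriv a (\<lambda>y. k (x - y)) y = - dir_deriv a k (x - y)"
  using dir_deriv_affine[OF test_function_smooth[OF assms], of a "-1" x y] by simp

lemma test_function_translate:
  assumes "test_function k" shows "test_function (\<lambda>x. k (x - y))"
  using test_function_affine[OF assms, of 1 "- y"] by simp

lemma dir_deriv_translate:
  assumes "test_function k" shows "dir_deriv a (\<lambda>x. k (x - y)) x = dir_deriv a k (x - y)"
  using dir_deriv_affine[OF test_function_smooth[OF assms], of a 1 "- y" x] by simp

text \<open>The weak derivative produces one minus sign and the inner derivative of \<open>x - y\<close> with respect to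
\<open>y\<close> another one; they cancel.\<close>

lemma two_point_form_deriv_right:
  assumes g: "weak_deriv a g g'" and k: "test_function k"
  shows "two_point_form \<psi> f g' k = two_point_form \<psi> f g (dir_deriv a k)"
proof -
  have "(LINT y|lborel. g' y * k (x - y)) = (LINT y|lborel. g y * dir_deriv a k (x - y))" for x
  proof -
    have "(LINT y|lborel. g y * dir_deriv a (\<lambda>y. k (x - y)) y) = - (LINT y|lborel. g' y * k (x - y))"
      using g test_function_reflect[OF k] unfolding weak_deriv_def by blast
    then show ?thesis by (simp add: dir_deriv_reflect[OF k])
  qed
  then show ?thesis unfolding two_point_form_def by (simp add: mult.assoc)
qed

text \<open>In contrast to the variable \<open>y\<close>, the test function in \<open>x\<close> is the product \<open>\<psi>(x) k(x - y)\<close>, which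
accounts for the second term. Fubini's theorem brings the integral over \<open>x\<close> to the inside.\<close>

lemma two_point_form_deriv_left:
  assumes f: "weak_deriv a f f'" and g: "locally_integrable g"
    and \<psi>: "test_function \<psi>" and k: "test_function k"
  shows "two_point_form \<psi> f' g k =
    - two_point_form (dir_deriv a \<psi>) f g k - two_point_form \<psi> f g (dir_deriv a k)"
proof -
  have f0: "locally_integrable f" and f1: "locally_integrable f'"
    using f by (auto simp: weak_deriv_def)
  note d\<psi> = test_function_dir_deriv[OF \<psi>, of a] and dk = test_function_dir_deriv[OF k, of a]
  note I = integrable_two_point[OF \<psi> k f1 g] and I1 = integrable_two_point[OF d\<psi> k f0 g]
    and I2 = integrable_two_point[OF \<psi> dk f0 g]
  have swap: "two_point_form \<psi> f g k = (LINT y|lborel. g y * (LINT x|lborel. f x * (\<psi> x * k (x - y))))"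
    if "integrable (lborel \<Otimes>\<^sub>M lborel) (\<lambda>(x, y). \<psi> x * f x * g y * k (x - y))"
    for \<psi> f g k :: "real^'a \<Rightarrow> real"
  proof -
    have "two_point_form \<psi> f g k = (LINT y|lborel. LINT x|lborel. g y * (f x * (\<psi> x * k (x - y))))"
      unfolding two_point_form_def lborel_pair.Fubini_integral[OF that, symmetric] by (simp add: mult_ac)
    then show ?thesis by simp
  qed
  have inner: "g y * (LINT x|lborel. f' x * (\<psi> x * k (x - y))) =
      - (g y * (LINT x|lborel. f x * (dir_deriv a \<psi> x * k (x - y))))
      - g y * (LINT x|lborel. f x * (\<psi> x * dir_deriv a k (x - y)))" for y
  proof -
    note ky = test_function_translate[OF k, of y]
    note prod = test_function_mult[OF test_function_smooth[OF \<psi>] ky]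
    have "(LINT x|lborel. f x * dir_deriv a (\<lambda>x. \<psi> x * k (x - y)) x) = - (LINT x|lborel. f' x * (\<psi> x * k (x - y)))"
      using f prod unfolding weak_deriv_def by blast
    moreover have "dir_deriv a (\<lambda>x. \<psi> x * k (x - y)) x = dir_deriv a \<psi> x * k (x - y) + \<psi> x * dir_deriv a k (x - y)" for x
      by (subst dir_deriv_mult[OF test_function_smooth[OF \<psi>] test_function_smooth[OF ky]])
        (simp add: dir_deriv_translate[OF k])
    moreover have "integrable lborel (\<lambda>x. f x * (dir_deriv a \<psi> x * k (x - y)))"
      by (intro integrable_test_mult[OF f0] test_function_mult[OF test_function_smooth] d\<psi> ky)
    moreover have "integrable lborel (\<lambda>x. f x * (\<psi> x * dir_deriv a k (x - y)))"
      by (intro integrable_test_mult[OF f0] test_function_mult[OF test_function_smooth] \<psi> test_function_translate[OF dk])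
    ultimately have "(LINT x|lborel. f' x * (\<psi> x * k (x - y))) =
      - (LINT x|lborel. f x * (dir_deriv a \<psi> x * k (x - y)))
      - (LINT x|lborel. f x * (\<psi> x * dir_deriv a k (x - y)))"
      by (simp add: distrib_left)
    then show ?thesis by (simp add: right_diff_distrib)
  qed
  have outer: "integrable lborel (\<lambda>y. g y * (LINT x|lborel. f x * (\<psi> x * k (x - y))))"
    if "integrable (lborel \<Otimes>\<^sub>M lborel) (\<lambda>(x, y). \<psi> x * f x * g y * k (x - y))"
    for \<psi> f g k :: "real^'a \<Rightarrow> real"
  proof -
    have "integrable lborel (\<lambda>y. LINT x|lborel. g y * (f x * (\<psi> x * k (x - y))))"
      using lborel_pair.integrable_snd[OF that] by (simp add: mult_ac)
    then show ?thesis by simp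
  qed
  show ?thesis
    unfolding swap[OF I] swap[OF I1] swap[OF I2] inner
    using outer[OF I1] outer[OF I2] by simp
qed

text \<open>After the substitution \<open>z = x - y\<close> the double integral is the average, with weight \<open>k\<close>, of the
correlation \<open>z \<mapsto> \<integral> F(x) G(x - z)\<close>. It therefore differs from the value at \<open>z = 0\<close> by at most the
oscillation of the correlation on the support of \<open>k\<close>.\<close>

lemma mollified_correlation_error:
  fixes F G k :: "'a::euclidean_space \<Rightarrow> real"
  assumes F: "square_integrable F" and G: "square_integrable G"
    and k: "integrable lborel k" "\<And>z. 0 \<le> k z"
    and close: "\<And>z. k z \<noteq> 0 \<Longrightarrow> \<bar>(LINT x|lborel. F x * G (- z + x)) - (LINT x|lborel. F x * G x)\<bar> \<le> e"
  shows "\<bar>(LINT x|lborel. LINT y|lborel. F x * G y * k (x - y)) - (LINT x|lborel. F x * G x) * (LINT z|lborel. k z)\<bar>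
    \<le> e * (LINT z|lborel. k z)"
proof -
  have [measurable]: "F \<in> borel_measurable borel" "G \<in> borel_measurable borel" "k \<in> borel_measurable borel"
    and F2: "integrable lborel (\<lambda>x. (F x)\<^sup>2)" and G2: "integrable lborel (\<lambda>x. (G x)\<^sup>2)"
    using F G k by (auto simp: square_integrable_def)
  define c where "c z = (LINT x|lborel. F x * G (- z + x))" for z
  define c0 where "c0 = (LINT x|lborel. F x * G x)"
  have Gz: "integrable lborel (\<lambda>x. (G (- z + x))\<^sup>2)" for z using lborel_integrable_translate[OF G2] .
  have FG: "integrable lborel (\<lambda>x. F x * G (- z + x))" for z
    by (rule integrable_mult_of_squares) (use F2 Gz in auto)
  define B where "B = (LINT x|lborel. (F x)\<^sup>2) + (LINT x|lborel. (G x)\<^sup>2)"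
  have B: "(LINT x|lborel. \<bar>F x * G (- z + x)\<bar>) \<le> B" for z
  proof -
    have "(LINT x|lborel. \<bar>F x * G (- z + x)\<bar>) \<le> (LINT x|lborel. (F x)\<^sup>2 + (G (- z + x))\<^sup>2)"
    proof (rule integral_mono)
      show "\<bar>F x * G (- z + x)\<bar> \<le> (F x)\<^sup>2 + (G (- z + x))\<^sup>2" for x
        by (rule abs_mult_le_sum_squares)
    qed (use F2 Gz FG in auto)
    also have "\<dots> = B"
      unfolding B_def using F2 Gz lborel_integral_translate[of "\<lambda>x. (G x)\<^sup>2" "- z"] by simp
    finally show ?thesis .
  qed
  have int: "integrable (lborel \<Otimes>\<^sub>M lborel) (\<lambda>(z, x). k z * (F x * G (- z + x)))"
  proof (rule lborel_pair.Fubini_integrable)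
    have "integrable lborel (\<lambda>z. LINT x|lborel. \<bar>k z * (F x * G (- z + x))\<bar>)"
    proof (rule Bochner_Integration.integrable_bound)
      show "integrable lborel (\<lambda>z. k z * B)" using k by simp
      have "(LINT x|lborel. \<bar>k z * (F x * G (- z + x))\<bar>) = k z * (LINT x|lborel. \<bar>F x * G (- z + x)\<bar>)" for z
        by (simp only: abs_mult[of "k z"] integral_mult_right_zero abs_of_nonneg[OF k(2)])
      moreover have "k z * (LINT x|lborel. \<bar>F x * G (- z + x)\<bar>) \<le> k z * B" for z
        using B k(2) by (rule mult_left_mono)
      moreover have "0 \<le> k z * (LINT x|lborel. \<bar>F x * G (- z + x)\<bar>)" for z using k(2) by simp
      ultimately show "AE z in lborel. norm (LINT x|lborel. \<bar>k z * (F x * G (- z + x))\<bar>) \<le> norm (k z * B)"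
        by (auto intro!: AE_I2 order_trans[OF _ abs_ge_self])
    qed measurable
    then show "integrable lborel (\<lambda>z. LINT x|lborel. norm (case (z, x) of (z, x) \<Rightarrow> k z * (F x * G (- z + x))))"
      by simp
    show "AE z in lborel. integrable lborel (\<lambda>x. case (z, x) of (z, x) \<Rightarrow> k z * (F x * G (- z + x)))"
      using FG by simp
  qed measurable
  have kc_int: "integrable lborel (\<lambda>z. k z * c z)"
    using lborel_pair.integrable_fst[OF int] by (simp add: c_def)
  have "(LINT x|lborel. LINT y|lborel. F x * G y * k (x - y)) = (LINT x|lborel. LINT z|lborel. k z * (F x * G (- z + x)))"
  proof (rule Bochner_Integration.integral_cong[OF refl])
    fix x :: 'a
    have "(LINT y|lborel. F x * G y * k (x - y)) = (LINT y|distr lborel borel (\<lambda>z. x - z). F x * G y * k (x - y))"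
      by (simp add: lborel_distr_reflect)
    also have "\<dots> = (LINT z|lborel. F x * G (x - z) * k (x - (x - z)))"
      by (rule integral_distr) measurable
    finally show "(LINT y|lborel. F x * G y * k (x - y)) = (LINT z|lborel. k z * (F x * G (- z + x)))"
      by (simp add: mult_ac)
  qed
  also have "\<dots> = (LINT z|lborel. k z * c z)"
    unfolding lborel_pair.Fubini_integral[OF int] by (simp add: c_def)
  finally have "(LINT x|lborel. LINT y|lborel. F x * G y * k (x - y)) - c0 * (LINT z|lborel. k z)
      = (LINT z|lborel. k z * (c z - c0))"
    using kc_int k by (simp add: right_diff_distrib mult.commute)
  also have "\<bar>\<dots>\<bar> \<le> (LINT z|lborel. \<bar>k z * (c z - c0)\<bar>)" by (rule integral_abs_bound)
  also have "\<dots> \<le> (LINT z|lborel. e * k z)"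
  proof (rule integral_mono)
    show "\<bar>k z * (c z - c0)\<bar> \<le> e * k z" for z
      using close[of z] k(2)[of z] by (cases "k z = 0") (auto simp: c_def c0_def abs_mult mult.commute intro: mult_left_mono)
  qed (use kc_int k in \<open>auto simp: right_diff_distrib\<close>)
  finally show ?thesis by (simp add: c0_def)
qed

text \<open>Supported in a ball of radius \<open>1/(n+1)\<close>; limits of two-point forms are normalised by
dividing by its mass.\<close>

definition mollifier :: "nat \<Rightarrow> real^'q::finite \<Rightarrow> real" where
  "mollifier n z = bump (real (Suc n) *\<^sub>R z)"

lemma test_function_mollifier: "test_function (mollifier n)"
  using test_function_affine[OF test_function_bump, of "real (Suc n)" 0] by (simp add: mollifier_def[abs_def])

lemma mollifier_dir_deriv_commute: "dir_deriv a (dir_deriv b (mollifier n)) = dir_deriv b (dir_deriv a (mollifier n))"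
proof -
  define N where "N = real (Suc n)"
  have first: "dir_deriv b (mollifier n) = (\<lambda>z. N * dir_deriv b bump (N *\<^sub>R z))" for b :: "real^'a"
    using dir_deriv_affine[OF smooth_bump, of b N 0] by (simp add: mollifier_def[abs_def] N_def fun_eq_iff)
  have "dir_deriv a (\<lambda>z. N * dir_deriv b bump (N *\<^sub>R z)) z = N * (N * dir_deriv a (dir_deriv b bump) (N *\<^sub>R z))" for a b z :: "real^'a"
  proof -
    have sm: "smooth (dir_deriv b (bump :: real^'a \<Rightarrow> real))" by (rule smooth_dir_deriv[OF smooth_bump])
    have "dir_deriv a (\<lambda>z. N) z = 0" by (rule dir_deriv_eq[OF has_derivative_const])
    then show ?thesis
      using dir_deriv_mult[OF smooth_const[of N] smooth_affine[OF sm, of N 0], of a z] dir_deriv_affine[OF sm, of a N 0 z]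
      by simp
  qed
  then show ?thesis unfolding first by (simp add: fun_eq_iff dir_deriv_bump_commute[of a b])
qed

lemma integral_mollifier_pos: "(LINT z|lborel. mollifier n (z :: real^'q::finite)) > 0"
proof -
  have int: "integrable lborel (mollifier n :: real^'q \<Rightarrow> real)"
    by (rule integrable_test_function[OF test_function_mollifier])
  have nonneg: "0 \<le> mollifier n z" for z :: "real^'q" by (simp add: mollifier_def bump_range)
  have "(LINT z|lborel. mollifier n (z :: real^'q)) \<noteq> 0"
  proof
    assume "(LINT z|lborel. mollifier n (z :: real^'q)) = 0"
    then have "AE z in lborel. mollifier n (z :: real^'q) = 0"
      using integral_nonneg_eq_0_iff_AE[OF int] nonneg by simp
    moreover have "mollifier n z \<noteq> 0" if "z \<in> ball 0 (inverse (real (Suc n)))" for z :: "real^'q"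
    proof -
      have "norm (real (Suc n) *\<^sub>R z) < 1" using that by (simp add: field_simps del: of_nat_Suc)
      then show ?thesis using bump_pos by (fastforce simp: mollifier_def)
    qed
    ultimately have "AE z in lborel. z \<notin> ball (0 :: real^'q) (inverse (real (Suc n)))"
      by (auto elim!: eventually_mono)
    then have "ball (0 :: real^'q) (inverse (real (Suc n))) \<in> null_sets lborel"
      by (subst AE_iff_null_sets) auto
    then have "emeasure lborel (ball (0 :: real^'q) (inverse (real (Suc n)))) = 0"
      by (simp add: null_sets_def)
    then show False using unit_ball_vol_pos[of "real CARD('q)"] by (simp add: emeasure_ball)
  qed
  moreover have "(LINT z|lborel. mollifier n (z :: real^'q)) \<ge> 0" using nonneg by simp
  ultimately show ?thesis by linarith
qed

lemma two_point_form_tendsto: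
  assumes \<psi>: "test_function \<psi>" and f: "locally_square_integrable f" and g: "locally_square_integrable g"
  shows "(\<lambda>n. two_point_form \<psi> f g (mollifier n) / (LINT z|lborel. mollifier n (z :: real^'q::finite)))
    \<longlonglongrightarrow> (LINT x|lborel. \<psi> x * f x * g (x :: real^'q))"
proof (rule LIMSEQ_I)
  fix r :: real assume "r > 0"
  define m where "m n = (LINT z|lborel. mollifier n (z :: real^'q))" for n
  obtain R where R: "\<And>y. norm y > R \<Longrightarrow> \<psi> y = 0" by (rule test_function_support[OF \<psi>]) blast
  define F where "F x = \<psi> x * f x" for x
  \<comment> \<open>Since \<open>\<psi>\<close> vanishes outside the ball of radius \<open>R\<close> and the kernel outside the unit ball, only the values of \<open>g\<close> on this ball matter.\<close>
  define G where "G y = indicator (cball 0 (R + 1)) y * g y" for y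
  have F: "square_integrable F" unfolding F_def by (rule square_integrable_mult_test[OF f \<psi>])
  have G: "square_integrable G" unfolding G_def
    by (rule square_integrable_mult_bounded[OF g, of _ 1 "R + 1"]) (auto simp: indicator_def)
  have FG: "F x * G x = \<psi> x * f x * g x" for x
    using R[of x] by (cases "norm x > R") (auto simp: F_def G_def indicator_def)
  have mollifier_support: "mollifier n z = 0" if "norm z \<ge> inverse (real (Suc n))" for n and z :: "real^'q"
    using that unfolding mollifier_def by (intro bump_eq_0) (simp add: field_simps del: of_nat_Suc)
  have form: "two_point_form \<psi> f g (mollifier n) = (LINT x|lborel. LINT y|lborel. F x * G y * mollifier n (x - y))" for n
  proof -
    have "\<psi> x * f x * g y * mollifier n (x - y) = F x * G y * mollifier n (x - y)" for x y
    proof (cases "norm x > R \<or> norm (x - y) \<ge> inverse (real (Suc n))")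
      case False
      moreover have "inverse (real (Suc n)) \<le> 1" by (simp add: inverse_le_1_iff)
      ultimately have "norm y \<le> R + 1" using norm_triangle_ineq4[of x "x - y"] by simp
      then show ?thesis by (simp add: F_def G_def)
    qed (use R mollifier_support in \<open>auto simp: F_def\<close>)
    then show ?thesis unfolding two_point_form_def by (simp only:)
  qed
  obtain d where "d > 0" and d: "\<And>z. norm z < d \<Longrightarrow>
      \<bar>(LINT x|lborel. F x * G (z + x)) - (LINT x|lborel. F x * G x)\<bar> < r / 2"
    using translation_correlation_continuous[OF F G] \<open>r > 0\<close>
    unfolding continuous_at_eps_delta by (force simp: dist_norm dest: spec[of _ "r / 2"])
  obtain N where N: "inverse (real (Suc N)) < d" using reals_Archimedean[OF \<open>d > 0\<close>] by auto
  have "norm (two_point_form \<psi> f g (mollifier n) / m n - (LINT x|lborel. \<psi> x * f x * g x)) < r" if "n \<ge> N" for n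
  proof -
    have mn: "m n > 0" unfolding m_def by (rule integral_mollifier_pos)
    have "\<bar>two_point_form \<psi> f g (mollifier n) - (LINT x|lborel. F x * G x) * m n\<bar> \<le> r / 2 * m n"
      unfolding form m_def
    proof (rule mollified_correlation_error[OF F G])
      show "integrable lborel (mollifier n)" by (rule integrable_test_function[OF test_function_mollifier])
      show "0 \<le> mollifier n z" for z :: "real^'q" by (simp add: mollifier_def bump_range)
      show "\<bar>(LINT x|lborel. F x * G (- z + x)) - (LINT x|lborel. F x * G x)\<bar> \<le> r / 2" if "mollifier n z \<noteq> 0" for z
      proof -
        have "norm z < inverse (real (Suc n))" using mollifier_support that by (meson not_le)
        also have "\<dots> \<le> inverse (real (Suc N))" using \<open>n \<ge> N\<close> by (simp add: field_simps)
        finally show ?thesis using d[of "- z"] N by simp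
      qed
    qed
    then have "\<bar>two_point_form \<psi> f g (mollifier n) / m n - (LINT x|lborel. F x * G x)\<bar> \<le> r / 2"
      using mn by (simp add: field_simps abs_le_iff)
    then show ?thesis using \<open>r > 0\<close> by (simp add: FG)
  qed
  then show "\<exists>no. \<forall>n\<ge>no. norm (two_point_form \<psi> f g (mollifier n) / (LINT z|lborel. mollifier n (z :: real^'q))
      - (LINT x|lborel. \<psi> x * f x * g x)) < r"
    unfolding m_def by blast
qed

text \<open>For fixed kernel the two terms with a derivative on \<open>k\<close> cancel, and this leaves an exact product
rule for the two-point form, to which the concentration limit is applied.\<close>

lemma weak_product_rule:
  assumes f: "weak_deriv a f f'" and g: "weak_deriv a g g'" and \<psi>: "test_function \<psi>"
    and sq: "locally_square_integrable f" "locally_square_integrable f'"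
      "locally_square_integrable g" "locally_square_integrable g'"
  shows "(LINT x|lborel. \<psi> x * f' x * g x) + (LINT x|lborel. \<psi> x * f x * g' x)
    = - (LINT x|lborel. dir_deriv a \<psi> x * f x * g x)"
proof (rule LIMSEQ_unique)
  let ?m = "\<lambda>n. LINT z|lborel. mollifier n (z :: real^'a)"
  note lim = two_point_form_tendsto
  show "(\<lambda>n. two_point_form \<psi> f' g (mollifier n) / ?m n + two_point_form \<psi> f g' (mollifier n) / ?m n)
    \<longlonglongrightarrow> (LINT x|lborel. \<psi> x * f' x * g x) + (LINT x|lborel. \<psi> x * f x * g' x)"
    by (intro tendsto_add two_point_form_tendsto \<psi> sq)
  have "(\<lambda>n. - (two_point_form (dir_deriv a \<psi>) f g (mollifier n) / ?m n))
    \<longlonglongrightarrow> - (LINT x|lborel. dir_deriv a \<psi> x * f x * g x)"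
    by (intro tendsto_minus two_point_form_tendsto test_function_dir_deriv \<psi> sq)
  moreover have "two_point_form \<psi> f' g k + two_point_form \<psi> f g' k = - two_point_form (dir_deriv a \<psi>) f g k"
    if "test_function k" for k
    using two_point_form_deriv_left[OF f _ \<psi> that] two_point_form_deriv_right[OF g that] g
    by (simp add: weak_deriv_def)
  ultimately show "(\<lambda>n. two_point_form \<psi> f' g (mollifier n) / ?m n + two_point_form \<psi> f g' (mollifier n) / ?m n)
    \<longlonglongrightarrow> - (LINT x|lborel. dir_deriv a \<psi> x * f x * g x)"
    by (simp add: add_divide_distrib[symmetric] test_function_mollifier)
qed

text \<open>With a fixed kernel \<open>k\<close>, the two-point version of each side equals \<open>- \<integral>\<integral> \<psi>(x) f(x) g(y) (\<partial>\<^sub>a \<partial>\<^sub>b k)(x - y)\<close>, which is symmetric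
in \<open>a\<close> and \<open>b\<close>. This is how the second derivatives of \<open>g\<close> used in the classical argument are
avoided.\<close>

lemma weak_null_lagrangian:
  assumes f: "weak_deriv a f fa" "weak_deriv b f fb" and g: "weak_deriv a g ga" "weak_deriv b g gb"
    and \<psi>: "test_function \<psi>"
    and sq: "locally_square_integrable f" "locally_square_integrable fa" "locally_square_integrable fb"
      "locally_square_integrable ga" "locally_square_integrable gb"
  shows "(LINT x|lborel. \<psi> x * fa x * gb x) + (LINT x|lborel. dir_deriv a \<psi> x * f x * gb x)
    = (LINT x|lborel. \<psi> x * fb x * ga x) + (LINT x|lborel. dir_deriv b \<psi> x * f x * ga x)"
proof (rule LIMSEQ_unique)
  let ?m = "\<lambda>n. LINT z|lborel. mollifier n (z :: real^'a)"
  let ?L = "\<lambda>n. two_point_form \<psi> fa gb (mollifier n) / ?m n + two_point_form (dir_deriv a \<psi>) f gb (mollifier n) / ?m n"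
  show "?L \<longlonglongrightarrow> (LINT x|lborel. \<psi> x * fa x * gb x) + (LINT x|lborel. dir_deriv a \<psi> x * f x * gb x)"
    by (intro tendsto_add two_point_form_tendsto test_function_dir_deriv \<psi> sq)
  have "(\<lambda>n. two_point_form \<psi> fb ga (mollifier n) / ?m n + two_point_form (dir_deriv b \<psi>) f ga (mollifier n) / ?m n)
      \<longlonglongrightarrow> (LINT x|lborel. \<psi> x * fb x * ga x) + (LINT x|lborel. dir_deriv b \<psi> x * f x * ga x)"
    by (intro tendsto_add two_point_form_tendsto test_function_dir_deriv \<psi> sq)
  \<comment> \<open>The expression common to both sides.\<close>
  moreover have half: "two_point_form \<psi> fa gb k + two_point_form (dir_deriv a \<psi>) f gb k
      = - two_point_form \<psi> f g (dir_deriv a (dir_deriv b k))"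
    if "weak_deriv a f fa" "weak_deriv b g gb" "test_function k" for a b k fa gb
    using two_point_form_deriv_left[OF that(1) _ \<psi> test_function_dir_deriv[OF that(3)]]
      two_point_form_deriv_right[OF that(2,3)] that(2)
    by (simp add: weak_deriv_def)
  have "two_point_form \<psi> fa gb (mollifier n) + two_point_form (dir_deriv a \<psi>) f gb (mollifier n)
      = two_point_form \<psi> fb ga (mollifier n) + two_point_form (dir_deriv b \<psi>) f ga (mollifier n)" for n
    using half[OF f(1) g(2) test_function_mollifier] half[OF f(2) g(1) test_function_mollifier]
    by (simp add: mollifier_dir_deriv_commute[of a b])
  ultimately show "?L \<longlonglongrightarrow> (LINT x|lborel. \<psi> x * fb x * ga x) + (LINT x|lborel. dir_deriv b \<psi> x * f x * ga x)"
    by (simp add: add_divide_distrib[symmetric])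
qed

lemma locally_integrable_mult:
  assumes f: "locally_square_integrable f" and g: "locally_square_integrable g"
  shows "locally_integrable (\<lambda>x. f x * g x)"
  unfolding locally_integrable_def set_integrable_def
proof (intro allI impI)
  fix K :: "'a set" assume K: "compact K"
  have [measurable]: "f \<in> borel_measurable borel" "g \<in> borel_measurable borel" "K \<in> sets borel"
    using f g K by (auto simp: locally_square_integrable_def borel_compact)
  have sq: "integrable lborel (\<lambda>x. (indicator K x * h x)\<^sup>2)" if "locally_square_integrable h" for h :: "'a \<Rightarrow> real"
  proof -
    have "(\<lambda>x. (indicator K x * h x)\<^sup>2) = (\<lambda>x. indicator K x *\<^sub>R (h x)\<^sup>2)"
      by (auto simp: indicator_def)
    then show ?thesis
      using that K by (simp add: locally_square_integrable_def locally_integrable_def set_integrable_def)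
  qed
  from sq[OF f] sq[OF g] have "integrable lborel (\<lambda>x. (indicator K x * f x) * (indicator K x * g x))"
    by (intro integrable_mult_of_squares) auto
  moreover have "(\<lambda>x. (indicator K x * f x) * (indicator K x * g x)) = (\<lambda>x. indicator K x *\<^sub>R (f x * g x))"
    by (auto simp: indicator_def)
  ultimately show "integrable lborel (\<lambda>x. indicator K x *\<^sub>R (f x * g x))" by simp
qed

lemma integrable_test_mult2:
  assumes "test_function \<psi>" "locally_square_integrable f" "locally_square_integrable g"
  shows "integrable lborel (\<lambda>x. \<psi> x * f x * g x)"
  using integrable_test_mult[OF locally_integrable_mult[OF assms(2,3)] assms(1)] by (simp add: mult_ac)

text \<open>The classical product rule for \<open>(b \<bullet> (y - m)) \<phi>(y)\<close>, whose derivative has integral zero.\<close>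

lemma weak_deriv_inner_diff: "weak_deriv a (\<lambda>y. b \<bullet> (y - m)) (\<lambda>y. b \<bullet> a)"
  unfolding weak_deriv_def
proof (intro conjI allI impI)
  show loc: "locally_integrable (\<lambda>y. b \<bullet> (y - m))" "locally_integrable (\<lambda>y::real^'a. b \<bullet> a)"
    by (intro locally_integrable_continuous continuous_intros)+
  fix \<phi> :: "real^'a \<Rightarrow> real" assume \<phi>: "test_function \<phi>"
  have "(LINT y|lborel. dir_deriv a (\<lambda>y. (b \<bullet> (y - m)) * \<phi> y) y) = 0"
    by (rule integral_dir_deriv_eq_0[OF test_function_mult[OF smooth_inner_diff \<phi>]])
  moreover have "dir_deriv a (\<lambda>y. (b \<bullet> (y - m)) * \<phi> y) y = (b \<bullet> (y - m)) * dir_deriv a \<phi> y + (b \<bullet> a) * \<phi> y" for y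
    by (simp add: dir_deriv_mult[OF smooth_inner_diff test_function_smooth[OF \<phi>]] dir_deriv_inner_diff)
  ultimately show "(LINT y|lborel. b \<bullet> (y - m) * dir_deriv a \<phi> y) = - (LINT y|lborel. b \<bullet> a * \<phi> y)"
    using integrable_test_mult[OF loc(1) test_function_dir_deriv[OF \<phi>, of a]] integrable_test_mult[OF loc(2) \<phi>]
    by simp
qed

section \<open>Cutoff functions\<close>

text \<open>A bump of width \<open>n + 1\<close> centred at \<open>m\<close>, scaled to take the value 1 at its centre. It is not
constant near \<open>m\<close>; pointwise convergence to 1 suffices.\<close>

definition cutoff :: "real^'q::finite \<Rightarrow> nat \<Rightarrow> real^'q \<Rightarrow> real" where
  "cutoff m n y = bump (inverse (real (Suc n)) *\<^sub>R (y - m)) / bump (0 :: real^'q)"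

lemma cutoff_affine: "cutoff m n = (\<lambda>y. inverse (bump (0 :: real^'q::finite)) *
    bump (inverse (real (Suc n)) *\<^sub>R y + (- inverse (real (Suc n)) *\<^sub>R (m :: real^'q))))"
  by (auto simp: cutoff_def[abs_def] scaleR_diff_right divide_inverse mult.commute)

lemma test_function_cutoff: "test_function (cutoff m n)"
  unfolding cutoff_affine
  by (intro test_function_mult smooth_const test_function_affine test_function_bump) auto

lemma cutoff_nonneg: "0 \<le> cutoff m n y"
  by (simp add: cutoff_def bump_range)

lemma cutoff_le: "cutoff m n y \<le> inverse (bump (0 :: real^'q::finite))" for y m :: "real^'q"
proof -
  have "bump (inverse (real (Suc n)) *\<^sub>R (y - m)) / bump (0 :: real^'q) \<le> 1 / bump (0 :: real^'q)"
    by (intro divide_right_mono) (auto simp: bump_range)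
  then show ?thesis by (simp add: cutoff_def divide_inverse)
qed

lemma cutoff_tendsto_1: "(\<lambda>n. cutoff m n (y :: real^'q::finite)) \<longlonglongrightarrow> 1"
proof -
  have "(\<lambda>n. inverse (real (Suc n)) *\<^sub>R (y - m)) \<longlonglongrightarrow> 0 *\<^sub>R (y - m)"
    by (intro tendsto_scaleR LIMSEQ_inverse_real_of_nat tendsto_const)
  then have arg: "(\<lambda>n. inverse (real (Suc n)) *\<^sub>R (y - m)) \<longlonglongrightarrow> 0" by simp
  have "isCont bump (0 :: real^'q)"
    using smooth_continuous[OF smooth_bump, of "UNIV :: (real^'q) set"] by (simp add: continuous_on_eq_continuous_at)
  from isCont_tendsto_compose[OF this arg]
  have "(\<lambda>n. bump (inverse (real (Suc n)) *\<^sub>R (y - m))) \<longlonglongrightarrow> bump (0 :: real^'q)" .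
  then have "(\<lambda>n. cutoff m n y) \<longlonglongrightarrow> bump (0 :: real^'q) / bump (0 :: real^'q)"
    unfolding cutoff_def by (intro tendsto_divide tendsto_const) (use bump_pos[of "0 :: real^'q"] in auto)
  then show ?thesis using bump_pos[of "0 :: real^'q"] by simp
qed

text \<open>The second bound holds because the gradient is \<open>O(1/n)\<close> and vanishes for \<open>|y - m| > n + 1\<close>. It
allows the gradient of the cutoff to absorb one linear factor.\<close>

lemma cutoff_gradient_bound:
  obtains C where "C > 0"
    "\<And>n y. \<bar>dir_deriv a (cutoff m n) y\<bar> \<le> C / real (Suc n)"
    "\<And>n y. \<bar>dir_deriv a (cutoff m n) y\<bar> * norm (y - m) \<le> C"
proof -
  define \<beta> where "\<beta> = inverse (bump (0 :: real^'a))"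
  have "\<beta> > 0" using bump_pos[of "0 :: real^'a"] by (simp add: \<beta>_def)
  obtain B where B: "B > 0" "\<And>y. \<bar>dir_deriv a bump y\<bar> \<le> B"
    by (rule test_function_bounded[OF test_function_dir_deriv[OF test_function_bump]]) blast
  have deriv: "dir_deriv a (cutoff m n) y = \<beta> * (inverse (real (Suc n)) * dir_deriv a bump (inverse (real (Suc n)) *\<^sub>R (y - m)))" for n y
  proof -
    have "dir_deriv a (\<lambda>z. \<beta>) y = 0" by (rule dir_deriv_eq[OF has_derivative_const])
    moreover define N d where "N = inverse (real (Suc n))" and "d = - inverse (real (Suc n)) *\<^sub>R m"
    ultimately show ?thesis
      using dir_deriv_mult[OF smooth_const[of \<beta>] smooth_affine[OF smooth_bump, of N d], of a y]
        dir_deriv_affine[OF smooth_bump, of a N d y]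
      unfolding cutoff_affine \<beta>_def[symmetric] by (simp add: scaleR_diff_right)
  qed
  have 1: "\<bar>dir_deriv a (cutoff m n) y\<bar> \<le> \<beta> * B / real (Suc n)" for n y
  proof -
    have "\<bar>dir_deriv a (cutoff m n) y\<bar> = \<beta> * inverse (real (Suc n)) * \<bar>dir_deriv a bump (inverse (real (Suc n)) *\<^sub>R (y - m))\<bar>"
      unfolding deriv using \<open>\<beta> > 0\<close> by (simp add: abs_mult)
    also have "\<dots> \<le> \<beta> * inverse (real (Suc n)) * B"
      using \<open>\<beta> > 0\<close> by (intro mult_left_mono B) auto
    finally show ?thesis by (simp add: divide_inverse mult_ac)
  qed
  have 2: "\<bar>dir_deriv a (cutoff m n) y\<bar> * norm (y - m) \<le> \<beta> * B" for n y
  proof (cases "norm (y - m) \<le> real (Suc n)")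
    case True
    have "\<bar>dir_deriv a (cutoff m n) y\<bar> * norm (y - m) \<le> (\<beta> * B / real (Suc n)) * real (Suc n)"
      using 1 True \<open>\<beta> > 0\<close> B(1) by (intro mult_mono) auto
    then show ?thesis by simp
  next
    case False
    moreover have "norm (inverse (real (Suc n)) *\<^sub>R (y - m)) = norm (y - m) / real (Suc n)"
      by (simp add: divide_inverse mult.commute del: of_nat_Suc)
    ultimately have "norm (inverse (real (Suc n)) *\<^sub>R (y - m)) > 1" by (simp del: of_nat_Suc)
    then have "dir_deriv a bump (inverse (real (Suc n)) *\<^sub>R (y - m)) = 0"
      by (intro dir_deriv_eq_0_outside_support[of 1]) (auto simp: bump_eq_0)
    then show ?thesis using \<open>\<beta> > 0\<close> B(1) by (simp add: deriv)
  qed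
  show ?thesis using that[of "\<beta> * B"] 1 2 \<open>\<beta> > 0\<close> B(1) by simp
qed

section \<open>Integration by parts for the Gaussian weight\<close>

text \<open>Normalisation is assumed here because in the application it is inherited from the
law of the random vector.\<close>

locale gaussian_weight =
  fixes \<sigma> :: real and m :: "real^'q::finite"
  assumes \<sigma>: "\<sigma> > 0"
    and density_integrable: "integrable lborel (\<lambda>y. iso_gaussian_density \<sigma> (y - m))"
    and density_mass: "(LINT y|lborel. iso_gaussian_density \<sigma> (y - m)) = 1"
begin

definition \<rho> :: "real^'q \<Rightarrow> real" where
  "\<rho> y = iso_gaussian_density \<sigma> (y - m)"

lemma \<rho>_integrable: "integrable lborel \<rho>" and \<rho>_mass: "(LINT y|lborel. \<rho> y) = 1"
  using density_integrable density_mass by (simp_all add: \<rho>_def[abs_def])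

lemma \<rho>_eq: "\<rho> y = (1 / sqrt (2 * pi * \<sigma>\<^sup>2)) ^ CARD('q) * exp (- ((y - m) \<bullet> (y - m)) / (2 * \<sigma>\<^sup>2))"
proof -
  have "\<rho> y = (\<Prod>i\<in>(UNIV::'q set). 1 / sqrt (2 * pi * \<sigma>\<^sup>2)) * (\<Prod>i\<in>UNIV. exp (- ((y - m) $ i)\<^sup>2 / (2 * \<sigma>\<^sup>2)))"
    unfolding \<rho>_def iso_gaussian_density_def normal_density_def prod.distrib diff_zero by (rule refl)
  also have "(\<Prod>i\<in>UNIV. exp (- ((y - m) $ i)\<^sup>2 / (2 * \<sigma>\<^sup>2))) = exp (\<Sum>i\<in>UNIV. - ((y - m) $ i)\<^sup>2 / (2 * \<sigma>\<^sup>2))"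
    by (rule exp_sum[symmetric]) simp
  also have "(\<Sum>i\<in>UNIV. - ((y - m) $ i)\<^sup>2 / (2 * \<sigma>\<^sup>2)) = - ((y - m) \<bullet> (y - m)) / (2 * \<sigma>\<^sup>2)"
    by (simp add: inner_vec_def power2_eq_square sum_divide_distrib[symmetric] sum_negf)
  finally show ?thesis by (simp only: prod_constant)
qed

lemma \<rho>_pos: "\<rho> y > 0"
  unfolding \<rho>_eq using \<sigma> by simp

lemma \<rho>_smooth: "smooth \<rho>"
proof -
  have "smooth (\<lambda>y. (y + (- m)) \<bullet> (y + (- m)))"
    using smooth_affine[OF smooth_square_norm, of 1 "- m"] by simp
  then have "smooth (\<lambda>y. (- 1 / (2 * \<sigma>\<^sup>2)) * ((y + (- m)) \<bullet> (y + (- m))))"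
    by (intro smooth_mult smooth_const)
  then have "smooth (\<lambda>y. exp ((- 1 / (2 * \<sigma>\<^sup>2)) * ((y + (- m)) \<bullet> (y + (- m)))))"
    by (rule smooth_compose[of "\<lambda>_. exp", rotated]) (rule DERIV_exp)
  then have "smooth (\<lambda>y. (1 / sqrt (2 * pi * \<sigma>\<^sup>2)) ^ CARD('q) * exp ((- 1 / (2 * \<sigma>\<^sup>2)) * ((y + (- m)) \<bullet> (y + (- m)))))"
    by (intro smooth_mult smooth_const)
  moreover have "(\<lambda>y. (1 / sqrt (2 * pi * \<sigma>\<^sup>2)) ^ CARD('q) * exp ((- 1 / (2 * \<sigma>\<^sup>2)) * ((y + (- m)) \<bullet> (y + (- m))))) = \<rho>"
    by (simp add: fun_eq_iff \<rho>_eq)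
  ultimately show ?thesis by simp
qed

lemma \<rho>_measurable [measurable]: "\<rho> \<in> borel_measurable borel"
  by (rule borel_measurable_smooth[OF \<rho>_smooth])

lemma \<rho>_dir_deriv: "\<sigma>\<^sup>2 * dir_deriv a \<rho> y = - (a \<bullet> (y - m)) * \<rho> y"
proof -
  let ?c = "(1 / sqrt (2 * pi * \<sigma>\<^sup>2)) ^ CARD('q)"
  define k where "k = - 1 / (2 * \<sigma>\<^sup>2)"
  have \<rho>: "\<rho> = (\<lambda>y. ?c * exp (k * ((y - m) \<bullet> (y - m))))"
    by (simp add: fun_eq_iff \<rho>_eq k_def)
  have "(\<rho> has_derivative (\<lambda>h. ?c * (exp (k * ((y - m) \<bullet> (y - m))) * (k * (2 * (h \<bullet> (y - m))))))) (at y)"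
    unfolding \<rho> by (auto intro!: derivative_eq_intros simp: inner_commute)
  from dir_deriv_eq[OF this, of a] have "dir_deriv a \<rho> y = (2 * k) * (a \<bullet> (y - m)) * \<rho> y"
    by (simp add: \<rho>)
  moreover have "\<sigma>\<^sup>2 * (2 * k) = - 1" using \<sigma> by (simp add: k_def)
  ultimately show ?thesis by (metis mult.assoc mult_minus1)
qed

text \<open>Square integrability with respect to the Gaussian measure.\<close>

definition L2 :: "(real^'q \<Rightarrow> real) \<Rightarrow> bool" where
  "L2 f \<longleftrightarrow> f \<in> borel_measurable borel \<and> integrable lborel (\<lambda>y. \<rho> y * (f y)\<^sup>2)"

text \<open>The Gaussian density is bounded away from zero on compact sets.\<close>

lemma L2_locally_square_integrable:
  assumes "L2 f" shows "locally_square_integrable f"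
  unfolding locally_square_integrable_def locally_integrable_def set_integrable_def
proof (intro conjI allI impI)
  show f [measurable]: "f \<in> borel_measurable borel" using assms by (simp add: L2_def)
  fix K :: "(real^'q) set" assume K: "compact K"
  then have [measurable]: "K \<in> sets borel" by (rule borel_compact)
  show "integrable lborel (\<lambda>x. indicator K x *\<^sub>R (f x)\<^sup>2)"
  proof (cases "K = {}")
    case False
    obtain z where z: "z \<in> K" "\<And>y. y \<in> K \<Longrightarrow> \<rho> z \<le> \<rho> y"
      using continuous_attains_inf[OF K False smooth_continuous[OF \<rho>_smooth]] by auto
    show ?thesis
    proof (rule Bochner_Integration.integrable_bound)
      show "integrable lborel (\<lambda>y. inverse (\<rho> z) * (\<rho> y * (f y)\<^sup>2))" using assms by (simp add: L2_def)
      have "indicator K y *\<^sub>R (f y)\<^sup>2 \<le> inverse (\<rho> z) * (\<rho> y * (f y)\<^sup>2)" for y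
      proof (cases "y \<in> K")
        case True
        have "1 * (f y)\<^sup>2 \<le> (inverse (\<rho> z) * \<rho> y) * (f y)\<^sup>2"
          using z(2)[OF True] \<rho>_pos[of z] by (intro mult_right_mono) (auto simp: field_simps)
        then show ?thesis using True by (simp add: mult.assoc)
      qed (use \<rho>_pos in \<open>auto simp: less_imp_le\<close>)
      then show "AE y in lborel. norm (indicator K y *\<^sub>R (f y)\<^sup>2) \<le> norm (inverse (\<rho> z) * (\<rho> y * (f y)\<^sup>2))"
        by (auto intro!: AE_I2 order_trans[OF _ abs_ge_self])
    qed measurable
  qed simp
qed

lemma L2_mult: "L2 f \<Longrightarrow> L2 g \<Longrightarrow> integrable lborel (\<lambda>y. \<rho> y * (f y * g y))"
proof -
  assume f: "L2 f" and g: "L2 g"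
  have [measurable]: "f \<in> borel_measurable borel" "g \<in> borel_measurable borel"
    using f g by (auto simp: L2_def)
  have "integrable lborel (\<lambda>y. (sqrt (\<rho> y) * f y) * (sqrt (\<rho> y) * g y))"
  proof (rule integrable_mult_of_squares)
    show "integrable lborel (\<lambda>y. (sqrt (\<rho> y) * f y)\<^sup>2)" "integrable lborel (\<lambda>y. (sqrt (\<rho> y) * g y)\<^sup>2)"
      using f g \<rho>_pos by (auto simp: power_mult_distrib L2_def less_imp_le)
  qed measurable
  moreover have "(sqrt (\<rho> y) * f y) * (sqrt (\<rho> y) * g y) = \<rho> y * (f y * g y)" for y
    using \<rho>_pos[of y] by (simp add: mult_ac flip: mult.assoc[of "sqrt (\<rho> y)" "sqrt (\<rho> y)"])
  ultimately show ?thesis by simp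
qed

lemma L2_const: "L2 (\<lambda>y. c)"
  using \<rho>_integrable by (simp add: L2_def)

lemma L2_cmult: "L2 f \<Longrightarrow> L2 (\<lambda>y. c * f y)"
  by (auto simp: L2_def power_mult_distrib mult.left_commute[of _ "c\<^sup>2"])

lemma L2_add:
  assumes "L2 f" "L2 g" shows "L2 (\<lambda>y. f y + g y)"
proof -
  have "integrable lborel (\<lambda>y. \<rho> y * (f y)\<^sup>2 + \<rho> y * (g y)\<^sup>2 + 2 * (\<rho> y * (f y * g y)))"
    using assms L2_mult[OF assms] by (intro Bochner_Integration.integrable_add integrable_mult_right) (auto simp: L2_def)
  then have "integrable lborel (\<lambda>y. \<rho> y * (f y + g y)\<^sup>2)"
    by (simp add: power2_sum algebra_simps)
  then show ?thesis using assms by (auto simp: L2_def)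
qed

lemma cutoff_tendsto_integral:
  assumes F: "integrable lborel (\<lambda>y. \<rho> y * F y)"
  shows "(\<lambda>n. LINT y|lborel. \<rho> y * cutoff m n y * F y) \<longlonglongrightarrow> (LINT y|lborel. \<rho> y * F y)"
proof (rule integral_dominated_convergence)
  let ?b = "inverse (bump (0 :: real^'q))"
  show "integrable lborel (\<lambda>y. ?b * \<bar>\<rho> y * F y\<bar>)" using F by simp
  have [measurable]: "cutoff m n \<in> borel_measurable borel" for n
    by (rule borel_measurable_test_function[OF test_function_cutoff])
  show "(\<lambda>y. \<rho> y * F y) \<in> borel_measurable lborel" using F by auto
  then have [measurable]: "(\<lambda>y. \<rho> y * F y) \<in> borel_measurable borel" by simp
  have "(\<lambda>y. cutoff m n y * (\<rho> y * F y)) \<in> borel_measurable lborel" for n by measurable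
  then show "(\<lambda>y. \<rho> y * cutoff m n y * F y) \<in> borel_measurable lborel" for n by (simp add: mult_ac)
  have "(\<lambda>n. \<rho> y * cutoff m n y * F y) \<longlonglongrightarrow> \<rho> y * 1 * F y" for y
    by (intro tendsto_mult tendsto_const cutoff_tendsto_1)
  then show "AE y in lborel. (\<lambda>n. \<rho> y * cutoff m n y * F y) \<longlonglongrightarrow> \<rho> y * F y" by simp
  have "norm (\<rho> y * cutoff m n y * F y) \<le> ?b * \<bar>\<rho> y * F y\<bar>" for n y
  proof -
    have "norm (\<rho> y * cutoff m n y * F y) = cutoff m n y * \<bar>\<rho> y * F y\<bar>"
      by (simp add: abs_mult cutoff_nonneg mult_ac)
    also have "\<dots> \<le> ?b * \<bar>\<rho> y * F y\<bar>" by (intro mult_right_mono cutoff_le) auto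
    finally show ?thesis .
  qed
  then show "AE y in lborel. norm (\<rho> y * cutoff m n y * F y) \<le> ?b * \<bar>\<rho> y * F y\<bar>" for n by simp
qed

text \<open>The factor \<open>q\<close> of at most linear growth is needed for the linear functions \<open>a \<bullet> (y - m)\<close>, for which
the product \<open>q F\<close> need not be integrable.\<close>

lemma cutoff_gradient_tendsto_0:
  assumes F: "integrable lborel (\<lambda>y. \<rho> y * F y)" and q [measurable]: "q \<in> borel_measurable borel"
    and q_bound: "\<And>y. \<bar>q y\<bar> \<le> K * (1 + norm (y - m))"
  shows "(\<lambda>n. LINT y|lborel. \<rho> y * dir_deriv a (cutoff m n) y * (q y * F y)) \<longlonglongrightarrow> 0"
proof -
  obtain C where C: "C > 0" "\<And>n y. \<bar>dir_deriv a (cutoff m n) y\<bar> \<le> C / real (Suc n)"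
    "\<And>n y. \<bar>dir_deriv a (cutoff m n) y\<bar> * norm (y - m) \<le> C"
    by (rule cutoff_gradient_bound[of a m]) blast
  have [measurable]: "dir_deriv a (cutoff m n) \<in> borel_measurable borel" for n
    by (intro borel_measurable_test_function test_function_dir_deriv test_function_cutoff)
  have [measurable]: "(\<lambda>y. \<rho> y * F y) \<in> borel_measurable borel" using F by auto
  have "K \<ge> 0"
  proof -
    have "0 \<le> K * (1 + norm (m - m))" using q_bound[of m] by (meson abs_ge_zero order_trans)
    then show ?thesis by simp
  qed
  have "(\<lambda>n. LINT y|lborel. \<rho> y * dir_deriv a (cutoff m n) y * (q y * F y)) \<longlonglongrightarrow> (LINT y|(lborel :: (real^'q) measure). 0)"
  proof (rule integral_dominated_convergence)
    show "integrable lborel (\<lambda>y. 2 * C * K * \<bar>\<rho> y * F y\<bar>)" using F by simp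
    have "(\<lambda>y. dir_deriv a (cutoff m n) y * q y * (\<rho> y * F y)) \<in> borel_measurable lborel" for n by measurable
    then show "(\<lambda>y. \<rho> y * dir_deriv a (cutoff m n) y * (q y * F y)) \<in> borel_measurable lborel" for n
      by (simp add: mult_ac)
    have "(\<lambda>n. \<rho> y * dir_deriv a (cutoff m n) y * (q y * F y)) \<longlonglongrightarrow> 0" for y
    proof -
      have "(\<lambda>n. C * inverse (real (Suc n))) \<longlonglongrightarrow> C * 0"
        by (intro tendsto_mult tendsto_const LIMSEQ_inverse_real_of_nat)
      then have "(\<lambda>n. dir_deriv a (cutoff m n) y) \<longlonglongrightarrow> 0"
        by - (rule Lim_null_comparison[where g="\<lambda>n. C * inverse (real (Suc n))"],
            use C(2) in \<open>simp_all add: divide_inverse\<close>)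
      then have "(\<lambda>n. \<rho> y * dir_deriv a (cutoff m n) y * (q y * F y)) \<longlonglongrightarrow> \<rho> y * 0 * (q y * F y)"
        by (intro tendsto_mult tendsto_const)
      then show ?thesis by simp
    qed
    then show "AE y in lborel. (\<lambda>n. \<rho> y * dir_deriv a (cutoff m n) y * (q y * F y)) \<longlonglongrightarrow> 0" by simp
    have "norm (\<rho> y * dir_deriv a (cutoff m n) y * (q y * F y)) \<le> 2 * C * K * \<bar>\<rho> y * F y\<bar>" for n y
    proof -
      let ?D = "\<bar>dir_deriv a (cutoff m n) y\<bar>"
      have "C / real (Suc n) \<le> C / 1" using C(1) by (intro divide_left_mono) auto
      then have "?D \<le> C" using C(2)[of n y] by linarith
      then have "?D * (1 + norm (y - m)) \<le> 2 * C" using C(3)[of n y] by (simp add: distrib_left)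
      then have "K * (?D * (1 + norm (y - m))) \<le> K * (2 * C)" using \<open>K \<ge> 0\<close> by (rule mult_left_mono)
      moreover have "?D * \<bar>q y\<bar> \<le> ?D * (K * (1 + norm (y - m)))" by (intro mult_left_mono q_bound) auto
      ultimately have "?D * \<bar>q y\<bar> \<le> 2 * C * K" by (simp add: mult_ac)
      then have "(?D * \<bar>q y\<bar>) * \<bar>\<rho> y * F y\<bar> \<le> 2 * C * K * \<bar>\<rho> y * F y\<bar>" by (rule mult_right_mono) simp
      then show ?thesis by (simp add: abs_mult mult_ac)
    qed
    then show "AE y in lborel. norm (\<rho> y * dir_deriv a (cutoff m n) y * (q y * F y)) \<le> 2 * C * K * \<bar>\<rho> y * F y\<bar>" for n
      by simp
  qed simp
  then show ?thesis by simp
qed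

text \<open>Fatou's lemma gives integrability from the convergence of the truncated integrals; the value then
follows by dominated convergence.\<close>

lemma integral_from_cutoff:
  assumes F [measurable]: "F \<in> borel_measurable borel" and nonneg: "\<And>y. 0 \<le> F y"
    and int: "\<And>n. integrable lborel (\<lambda>y. \<rho> y * cutoff m n y * F y)"
    and lim: "(\<lambda>n. LINT y|lborel. \<rho> y * cutoff m n y * F y) \<longlonglongrightarrow> l"
  shows "integrable lborel (\<lambda>y. \<rho> y * F y)" "(LINT y|lborel. \<rho> y * F y) = l"
proof -
  have [measurable]: "cutoff m n \<in> borel_measurable borel" for n
    by (rule borel_measurable_test_function[OF test_function_cutoff])
  have pos: "0 \<le> \<rho> y * cutoff m n y * F y" for n y
    using \<rho>_pos[of y] cutoff_nonneg[of m n y] nonneg[of y] by simp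
  have "(\<integral>\<^sup>+y. ennreal (\<rho> y * F y) \<partial>lborel) = (\<integral>\<^sup>+y. liminf (\<lambda>n. ennreal (\<rho> y * cutoff m n y * F y)) \<partial>lborel)"
  proof (rule nn_integral_cong)
    fix y
    have "(\<lambda>n. \<rho> y * cutoff m n y * F y) \<longlonglongrightarrow> \<rho> y * 1 * F y"
      by (intro tendsto_mult tendsto_const cutoff_tendsto_1)
    then have "(\<lambda>n. ennreal (\<rho> y * cutoff m n y * F y)) \<longlonglongrightarrow> ennreal (\<rho> y * F y)"
      by (intro tendsto_ennrealI) simp
    then show "ennreal (\<rho> y * F y) = liminf (\<lambda>n. ennreal (\<rho> y * cutoff m n y * F y))"
      using lim_imp_Liminf[OF trivial_limit_sequentially] by metis
  qed
  also have "\<dots> \<le> liminf (\<lambda>n. \<integral>\<^sup>+y. ennreal (\<rho> y * cutoff m n y * F y) \<partial>lborel)"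
    by (rule nn_integral_liminf) measurable
  also have "\<dots> = liminf (\<lambda>n. ennreal (LINT y|lborel. \<rho> y * cutoff m n y * F y))"
    using nn_integral_eq_integral[OF int] pos by simp
  also have "\<dots> = ennreal l"
    by (rule lim_imp_Liminf[OF trivial_limit_sequentially tendsto_ennrealI[OF lim]])
  finally have "(\<integral>\<^sup>+y. ennreal (\<rho> y * F y) \<partial>lborel) < \<infinity>" by (simp add: le_less_trans)
  then show *: "integrable lborel (\<lambda>y. \<rho> y * F y)"
    by (intro integrableI_nonneg) (auto simp: nonneg less_imp_le[OF \<rho>_pos])
  show "(LINT y|lborel. \<rho> y * F y) = l"
    by (rule LIMSEQ_unique[OF cutoff_tendsto_integral[OF *] lim])
qed

lemma test_function_weight: "test_function \<eta> \<Longrightarrow> test_function (\<lambda>y. \<rho> y * \<eta> y)"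
  by (rule test_function_mult[OF \<rho>_smooth])

lemma dir_deriv_weight:
  assumes "test_function \<eta>"
  shows "\<sigma>\<^sup>2 * dir_deriv a (\<lambda>y. \<rho> y * \<eta> y) y = \<sigma>\<^sup>2 * (\<rho> y * dir_deriv a \<eta> y) - (a \<bullet> (y - m)) * (\<rho> y * \<eta> y)"
proof -
  have "\<sigma>\<^sup>2 * dir_deriv a (\<lambda>y. \<rho> y * \<eta> y) y = \<sigma>\<^sup>2 * (\<rho> y * dir_deriv a \<eta> y) + (\<sigma>\<^sup>2 * dir_deriv a \<rho> y) * \<eta> y"
    by (simp add: dir_deriv_mult[OF \<rho>_smooth test_function_smooth[OF assms]] distrib_left)
  then show ?thesis unfolding \<rho>_dir_deriv by simp
qed

text \<open>The definition of the weak derivative with the test function \<open>\<rho> \<eta>\<close>, where the derivative of the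
Gaussian density contributes the factor \<open>a \<bullet> (y - m)\<close>.\<close>

lemma stein_cutoff:
  assumes f: "weak_deriv a f f'" and \<eta>: "test_function \<eta>"
  shows "(LINT y|lborel. \<rho> y * \<eta> y * (a \<bullet> (y - m) * f y))
    = \<sigma>\<^sup>2 * (LINT y|lborel. \<rho> y * \<eta> y * f' y) + \<sigma>\<^sup>2 * (LINT y|lborel. \<rho> y * dir_deriv a \<eta> y * f y)"
proof -
  have loc: "locally_integrable f" "locally_integrable f'" using f by (auto simp: weak_deriv_def)
  note w = test_function_weight[OF \<eta>] and dw = test_function_weight[OF test_function_dir_deriv[OF \<eta>, of a]]
  have "(LINT y|lborel. f y * (\<sigma>\<^sup>2 * dir_deriv a (\<lambda>y. \<rho> y * \<eta> y) y)) = \<sigma>\<^sup>2 * (LINT y|lborel. f y * dir_deriv a (\<lambda>y. \<rho> y * \<eta> y) y)"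
    by (subst integral_mult_right_zero[symmetric]) (simp add: mult_ac)
  also have "\<dots> = - \<sigma>\<^sup>2 * (LINT y|lborel. f' y * (\<rho> y * \<eta> y))"
    using f w unfolding weak_deriv_def by simp
  finally have "(LINT y|lborel. \<sigma>\<^sup>2 * (f y * (\<rho> y * dir_deriv a \<eta> y)) - f y * (a \<bullet> (y - m) * (\<rho> y * \<eta> y)))
      = - \<sigma>\<^sup>2 * (LINT y|lborel. f' y * (\<rho> y * \<eta> y))"
    unfolding dir_deriv_weight[OF \<eta>] by (simp add: right_diff_distrib mult_ac)
  moreover have "(LINT y|lborel. \<sigma>\<^sup>2 * (f y * (\<rho> y * dir_deriv a \<eta> y)) - f y * (a \<bullet> (y - m) * (\<rho> y * \<eta> y)))
      = \<sigma>\<^sup>2 * (LINT y|lborel. f y * (\<rho> y * dir_deriv a \<eta> y)) - (LINT y|lborel. f y * (a \<bullet> (y - m) * (\<rho> y * \<eta> y)))"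
    using integrable_test_mult[OF loc(1) dw]
      integrable_test_mult[OF loc(1) test_function_mult[OF smooth_inner_diff w, of a m]] by simp
  ultimately have "(LINT y|lborel. f y * (a \<bullet> (y - m) * (\<rho> y * \<eta> y)))
      = \<sigma>\<^sup>2 * (LINT y|lborel. f' y * (\<rho> y * \<eta> y)) + \<sigma>\<^sup>2 * (LINT y|lborel. f y * (\<rho> y * dir_deriv a \<eta> y))"
    by linarith
  then show ?thesis by (simp add: mult_ac)
qed

lemma abs_inner_le: "\<bar>a \<bullet> (y - m)\<bar> \<le> norm a * (1 + norm (y - m))"
  using Cauchy_Schwarz_ineq2[of a "y - m"] by (simp add: distrib_left add_increasing)

text \<open>Stein's identity for the linear function itself bounds its truncated second moments.\<close>

lemma L2_inner: "L2 (\<lambda>y. a \<bullet> (y - m))"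
proof -
  have "(\<lambda>n. \<sigma>\<^sup>2 * (LINT y|lborel. \<rho> y * cutoff m n y * (a \<bullet> a))
      + \<sigma>\<^sup>2 * (LINT y|lborel. \<rho> y * dir_deriv a (cutoff m n) y * (a \<bullet> (y - m) * 1)))
      \<longlonglongrightarrow> \<sigma>\<^sup>2 * (LINT y|lborel. \<rho> y * (a \<bullet> a)) + \<sigma>\<^sup>2 * 0"
    by (intro tendsto_add tendsto_mult tendsto_const cutoff_tendsto_integral cutoff_gradient_tendsto_0[OF _ _ abs_inner_le])
      (use \<rho>_integrable in auto)
  then have lim: "(\<lambda>n. LINT y|lborel. \<rho> y * cutoff m n y * (a \<bullet> (y - m))\<^sup>2)
      \<longlonglongrightarrow> \<sigma>\<^sup>2 * (LINT y|lborel. \<rho> y * (a \<bullet> a))"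
    using stein_cutoff[OF weak_deriv_inner_diff[of a a m] test_function_cutoff[of m]] by (simp add: power2_eq_square)
  have int: "integrable lborel (\<lambda>y. \<rho> y * cutoff m n y * (a \<bullet> (y - m))\<^sup>2)" for n
  proof -
    have "test_function (\<lambda>y. (a \<bullet> (y - m) * (a \<bullet> (y - m))) * (\<rho> y * cutoff m n y))"
      by (rule test_function_mult[OF smooth_mult[OF smooth_inner_diff smooth_inner_diff] test_function_weight[OF test_function_cutoff]])
    from integrable_test_function[OF this] show ?thesis by (simp add: power2_eq_square mult_ac)
  qed
  show ?thesis unfolding L2_def using integral_from_cutoff(1)[OF _ _ int lim] by simp
qed

lemma stein_identity:
  assumes f: "weak_deriv a f f'" and "L2 f" "L2 f'"
  shows "(LINT y|lborel. \<rho> y * (a \<bullet> (y - m) * f y)) = \<sigma>\<^sup>2 * (LINT y|lborel. \<rho> y * f' y)"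
proof -
  have int: "integrable lborel (\<lambda>y. \<rho> y * f y)" "integrable lborel (\<lambda>y. \<rho> y * f' y)"
    using L2_mult[OF assms(2) L2_const[of 1]] L2_mult[OF assms(3) L2_const[of 1]] by auto
  have "(\<lambda>n. \<sigma>\<^sup>2 * (LINT y|lborel. \<rho> y * cutoff m n y * f' y)
      + \<sigma>\<^sup>2 * (LINT y|lborel. \<rho> y * dir_deriv a (cutoff m n) y * (1 * f y)))
      \<longlonglongrightarrow> \<sigma>\<^sup>2 * (LINT y|lborel. \<rho> y * f' y) + \<sigma>\<^sup>2 * 0"
    by (intro tendsto_add tendsto_mult tendsto_const cutoff_tendsto_integral cutoff_gradient_tendsto_0[where K=1])
      (use int in auto)
  then have "(\<lambda>n. LINT y|lborel. \<rho> y * cutoff m n y * (a \<bullet> (y - m) * f y)) \<longlonglongrightarrow> \<sigma>\<^sup>2 * (LINT y|lborel. \<rho> y * f' y)"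
    using stein_cutoff[OF f test_function_cutoff] by simp
  moreover have "(\<lambda>n. LINT y|lborel. \<rho> y * cutoff m n y * (a \<bullet> (y - m) * f y)) \<longlonglongrightarrow> (LINT y|lborel. \<rho> y * (a \<bullet> (y - m) * f y))"
    by (intro cutoff_tendsto_integral L2_mult L2_inner assms)
  ultimately show ?thesis by (rule LIMSEQ_unique[symmetric])
qed

text \<open>Write \<open>\<psi> = \<rho> \<eta>\<close>, \<open>p\<^sub>a = a \<bullet> (y - m)\<close>, and note \<open>s \<partial>\<^sub>a \<psi> = - p\<^sub>a \<psi> + s \<rho> \<partial>\<^sub>a \<eta>\<close>. In the expanded
product the term \<open>s\<^sup>2 \<psi> \<partial>\<^sub>a f \<partial>\<^sub>b g\<close> is exchanged for \<open>s\<^sup>2 \<psi> \<partial>\<^sub>b f \<partial>\<^sub>a g\<close> by the null Lagrangian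
identity. This turns the mixed terms into \<open>- s p\<^sub>b \<psi> (\<partial>\<^sub>a f g + f \<partial>\<^sub>a g)\<close>, and the product rule with the
test function \<open>p\<^sub>b \<psi>\<close> then cancels the quadratic term \<open>p\<^sub>a p\<^sub>b \<psi> f g\<close>. Apart from the main terms only
terms with a derivative of \<open>\<eta>\<close> survive.\<close>

lemma skorokhod_pairing_cutoff:
  assumes f: "weak_deriv a f fa" "weak_deriv b f fb" and g: "weak_deriv a g ga" "weak_deriv b g gb"
    and \<eta>: "test_function \<eta>"
    and sq: "locally_square_integrable f" "locally_square_integrable fa" "locally_square_integrable fb"
      "locally_square_integrable g" "locally_square_integrable ga" "locally_square_integrable gb"
  defines "s \<equiv> \<sigma>\<^sup>2"
  shows "integrable lborel (\<lambda>y. \<rho> y * \<eta> y * ((a \<bullet> (y - m) * f y - s * fa y) * (b \<bullet> (y - m) * g y - s * gb y)))" (is ?int)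
    and "(LINT y|lborel. \<rho> y * \<eta> y * ((a \<bullet> (y - m) * f y - s * fa y) * (b \<bullet> (y - m) * g y - s * gb y)))
    = s * (a \<bullet> b) * (LINT y|lborel. \<rho> y * \<eta> y * (f y * g y))
      + s\<^sup>2 * (LINT y|lborel. \<rho> y * \<eta> y * (fb y * ga y))
      + s\<^sup>2 * (LINT y|lborel. \<rho> y * dir_deriv b \<eta> y * (f y * ga y))
      - s\<^sup>2 * (LINT y|lborel. \<rho> y * dir_deriv a \<eta> y * (f y * gb y))
      + s * (LINT y|lborel. \<rho> y * dir_deriv a \<eta> y * (b \<bullet> (y - m) * (f y * g y)))" (is ?eq)
proof -
  have s: "s > 0" using \<sigma> by (simp add: s_def)
  define p where "p a y = a \<bullet> (y - m)" for a y
  define \<Psi> where "\<Psi> y = \<rho> y * \<eta> y" for y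
  define R where "R c y = \<rho> y * dir_deriv c \<eta> y" for c y
  have \<Psi>: "test_function \<Psi>" unfolding \<Psi>_def by (rule test_function_weight[OF \<eta>])
  have R: "test_function (R c)" for c unfolding R_def by (rule test_function_weight[OF test_function_dir_deriv[OF \<eta>]])
  have pm: "test_function (\<lambda>y. p c y * \<phi> y)" if "test_function \<phi>" for c \<phi>
    unfolding p_def by (rule test_function_mult[OF smooth_inner_diff that])
  have d\<Psi>: "dir_deriv c \<Psi> y = R c y - p c y * \<Psi> y / s" for c y
  proof -
    have "s * dir_deriv c \<Psi> y = s * R c y - p c y * \<Psi> y"
      using dir_deriv_weight[OF \<eta>, of c y] by (simp add: \<Psi>_def[abs_def] R_def s_def p_def)
    then show ?thesis using s by (simp add: field_simps)
  qed
  note I = integrable_test_mult2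
  define I1 where "I1 = (LINT y|lborel. (p a y * (p b y * \<Psi> y)) * f y * g y)"
  define I2 where "I2 = (LINT y|lborel. (p a y * \<Psi> y) * f y * gb y)"
  define I3 where "I3 = (LINT y|lborel. (p b y * \<Psi> y) * fa y * g y)"
  define I4 where "I4 = (LINT y|lborel. \<Psi> y * fa y * gb y)"
  define I5 where "I5 = (LINT y|lborel. (p b y * \<Psi> y) * f y * ga y)"
  note int1 = I[OF pm[OF pm[OF \<Psi>]] sq(1) sq(4), of a b] and int2 = I[OF pm[OF \<Psi>] sq(1) sq(6), of a]
    and int3 = I[OF pm[OF \<Psi>] sq(2) sq(4), of b] and int4 = I[OF \<Psi> sq(2) sq(6)]
    and int5 = I[OF pm[OF \<Psi>] sq(1) sq(5), of b]
  have expand: "\<rho> y * \<eta> y * ((a \<bullet> (y - m) * f y - s * fa y) * (b \<bullet> (y - m) * g y - s * gb y))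
      = (p a y * (p b y * \<Psi> y)) * f y * g y - s * ((p a y * \<Psi> y) * f y * gb y)
        - s * ((p b y * \<Psi> y) * fa y * g y) + s\<^sup>2 * (\<Psi> y * fa y * gb y)" for y
    by (simp add: \<Psi>_def p_def algebra_simps power2_eq_square)
  show ?int unfolding expand using int1 int2 int3 int4 by simp
  have lhs: "(LINT y|lborel. \<rho> y * \<eta> y * ((a \<bullet> (y - m) * f y - s * fa y) * (b \<bullet> (y - m) * g y - s * gb y)))
      = I1 - s * I2 - s * I3 + s\<^sup>2 * I4"
    unfolding expand I1_def I2_def I3_def I4_def using int1 int2 int3 int4 by simp
  have da: "(LINT y|lborel. dir_deriv a \<Psi> y * f y * gb y) = (LINT y|lborel. R a y * f y * gb y) - I2 / s"
  proof -
    have "dir_deriv a \<Psi> y * f y * gb y = R a y * f y * gb y - ((p a y * \<Psi> y) * f y * gb y) / s" for y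
      unfolding d\<Psi> by (simp add: algebra_simps)
    then show ?thesis unfolding I2_def using int2 I[OF R sq(1) sq(6), of a] by simp
  qed
  have db: "(LINT y|lborel. dir_deriv b \<Psi> y * f y * ga y) = (LINT y|lborel. R b y * f y * ga y) - I5 / s"
  proof -
    have "dir_deriv b \<Psi> y * f y * ga y = R b y * f y * ga y - ((p b y * \<Psi> y) * f y * ga y) / s" for y
      unfolding d\<Psi> by (simp add: algebra_simps)
    then show ?thesis unfolding I5_def using int5 I[OF R sq(1) sq(5), of b] by simp
  qed
  have dp: "(LINT y|lborel. dir_deriv a (\<lambda>y. p b y * \<Psi> y) y * f y * g y)
      = (a \<bullet> b) * (LINT y|lborel. \<Psi> y * f y * g y) + (LINT y|lborel. (p b y * R a y) * f y * g y) - I1 / s"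
  proof -
    have dd: "dir_deriv a (\<lambda>y. p b y * \<Psi> y) y = p b y * dir_deriv a \<Psi> y + (a \<bullet> b) * \<Psi> y" for y
      unfolding p_def
      by (simp add: dir_deriv_mult[OF smooth_inner_diff test_function_smooth[OF \<Psi>]] dir_deriv_inner_diff inner_commute)
    have "dir_deriv a (\<lambda>y. p b y * \<Psi> y) y * f y * g y
      = (a \<bullet> b) * (\<Psi> y * f y * g y) + (p b y * R a y) * f y * g y - ((p a y * (p b y * \<Psi> y)) * f y * g y) / s" for y
      unfolding dd d\<Psi> by (simp add: algebra_simps)
    then show ?thesis
      unfolding I1_def using int1 I[OF pm[OF R] sq(1) sq(4), of b a] I[OF \<Psi> sq(1) sq(4)] by simp
  qed
  have A: "I3 + I5 = - ((a \<bullet> b) * (LINT y|lborel. \<Psi> y * f y * g y) + (LINT y|lborel. (p b y * R a y) * f y * g y) - I1 / s)"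
    using weak_product_rule[OF f(1) g(1) pm[OF \<Psi>, of b] sq(1,2,4,5)] unfolding dp I3_def I5_def .
  have B: "I4 + ((LINT y|lborel. R a y * f y * gb y) - I2 / s)
      = (LINT y|lborel. \<Psi> y * fb y * ga y) + ((LINT y|lborel. R b y * f y * ga y) - I5 / s)"
    using weak_null_lagrangian[OF f g \<Psi> sq(1,2,3,5,6)] unfolding da db I4_def .
  have "s\<^sup>2 * I4 = s\<^sup>2 * (LINT y|lborel. \<Psi> y * fb y * ga y) + s\<^sup>2 * (LINT y|lborel. R b y * f y * ga y) - s * I5
      - s\<^sup>2 * (LINT y|lborel. R a y * f y * gb y) + s * I2"
  proof -
    have "I4 = (LINT y|lborel. \<Psi> y * fb y * ga y) + ((LINT y|lborel. R b y * f y * ga y) - I5 / s)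
       - ((LINT y|lborel. R a y * f y * gb y) - I2 / s)" using B by linarith
    then show ?thesis using s by (simp add: power2_eq_square field_simps)
  qed
  moreover have "s * (I3 + I5) = I1 - s * (a \<bullet> b) * (LINT y|lborel. \<Psi> y * f y * g y) - s * (LINT y|lborel. (p b y * R a y) * f y * g y)"
    unfolding A using s by (simp add: field_simps)
  ultimately show ?eq
    unfolding lhs by (simp add: \<Psi>_def R_def p_def mult_ac distrib_left)
qed

lemma skorokhod_pairing_tendsto:
  assumes f: "weak_deriv a f fa" "weak_deriv b f fb" and g: "weak_deriv a g ga" "weak_deriv b g gb"
    and L2: "L2 f" "L2 fa" "L2 fb" "L2 g" "L2 ga" "L2 gb"
  shows "(\<lambda>n. LINT y|lborel. \<rho> y * cutoff m n y * ((a \<bullet> (y - m) * f y - \<sigma>\<^sup>2 * fa y) * (b \<bullet> (y - m) * g y - \<sigma>\<^sup>2 * gb y)))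
    \<longlonglongrightarrow> \<sigma>\<^sup>2 * (a \<bullet> b) * (LINT y|lborel. \<rho> y * (f y * g y)) + \<sigma>^4 * (LINT y|lborel. \<rho> y * (fb y * ga y))"
proof -
  note sq = L2[THEN L2_locally_square_integrable]
  have zero1: "(\<lambda>n. LINT y|lborel. \<rho> y * dir_deriv c (cutoff m n) y * F y) \<longlonglongrightarrow> 0"
    if "integrable lborel (\<lambda>y. \<rho> y * F y)" for c F
    using cutoff_gradient_tendsto_0[OF that, of "\<lambda>_. 1" 1 c] by simp
  have zero2: "(\<lambda>n. LINT y|lborel. \<rho> y * dir_deriv a (cutoff m n) y * (b \<bullet> (y - m) * (f y * g y))) \<longlonglongrightarrow> 0"
    by (rule cutoff_gradient_tendsto_0[OF L2_mult[OF L2(1,4)] _ abs_inner_le]) simp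
  have "(\<lambda>n. \<sigma>\<^sup>2 * (a \<bullet> b) * (LINT y|lborel. \<rho> y * cutoff m n y * (f y * g y))
      + (\<sigma>\<^sup>2)\<^sup>2 * (LINT y|lborel. \<rho> y * cutoff m n y * (fb y * ga y))
      + (\<sigma>\<^sup>2)\<^sup>2 * (LINT y|lborel. \<rho> y * dir_deriv b (cutoff m n) y * (f y * ga y))
      - (\<sigma>\<^sup>2)\<^sup>2 * (LINT y|lborel. \<rho> y * dir_deriv a (cutoff m n) y * (f y * gb y))
      + \<sigma>\<^sup>2 * (LINT y|lborel. \<rho> y * dir_deriv a (cutoff m n) y * (b \<bullet> (y - m) * (f y * g y))))
    \<longlonglongrightarrow> \<sigma>\<^sup>2 * (a \<bullet> b) * (LINT y|lborel. \<rho> y * (f y * g y)) + (\<sigma>\<^sup>2)\<^sup>2 * (LINT y|lborel. \<rho> y * (fb y * ga y))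
      + (\<sigma>\<^sup>2)\<^sup>2 * 0 - (\<sigma>\<^sup>2)\<^sup>2 * 0 + \<sigma>\<^sup>2 * 0"
    by (intro tendsto_add tendsto_diff tendsto_mult tendsto_const cutoff_tendsto_integral zero1 zero2 L2_mult L2)
  then show ?thesis
    using skorokhod_pairing_cutoff(2)[OF f g test_function_cutoff sq] by simp
qed

text \<open>The sum \<open>\<delta>\<close> is the Gaussian divergence of the vector field \<open>\<Sum>k. v\<^sub>k a\<^sub>k\<close>. Since its square is a
finite sum of pairings, the truncated second moments converge, and nonnegativity of the
square allows the cutoff to be removed.\<close>

theorem skorokhod_isometry:
  fixes a :: "'k::finite \<Rightarrow> real^'q" and v :: "'k \<Rightarrow> real^'q \<Rightarrow> real" and T :: "'k \<Rightarrow> 'k \<Rightarrow> real^'q \<Rightarrow> real"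
  assumes wd: "\<And>k l. weak_deriv (a l) (v k) (T k l)" and v: "\<And>k. L2 (v k)" and T: "\<And>k l. L2 (T k l)"
  defines "\<delta> \<equiv> (\<lambda>y. \<Sum>k\<in>UNIV. a k \<bullet> (y - m) * v k y - \<sigma>\<^sup>2 * T k k y)"
  shows "integrable lborel (\<lambda>y. \<rho> y * (\<delta> y)\<^sup>2)"
    and "(LINT y|lborel. \<rho> y * (\<delta> y)\<^sup>2) =
      (\<Sum>k\<in>UNIV. \<Sum>l\<in>UNIV. \<sigma>\<^sup>2 * (a k \<bullet> a l) * (LINT y|lborel. \<rho> y * (v k y * v l y))
        + \<sigma>^4 * (LINT y|lborel. \<rho> y * (T k l y * T l k y)))"
proof -
  define D where "D k y = a k \<bullet> (y - m) * v k y - \<sigma>\<^sup>2 * T k k y" for k y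
  have [measurable]: "v k \<in> borel_measurable borel" "T k l \<in> borel_measurable borel" for k l
    using v T by (auto simp: L2_def)
  have \<delta>: "\<delta> = (\<lambda>y. \<Sum>k\<in>UNIV. D k y)" by (simp add: \<delta>_def D_def)
  have [measurable]: "\<delta> \<in> borel_measurable borel" unfolding \<delta>_def by measurable
  have square: "\<rho> y * cutoff m n y * (\<delta> y)\<^sup>2 = (\<Sum>k\<in>UNIV. \<Sum>l\<in>UNIV. \<rho> y * cutoff m n y * (D k y * D l y))" for n y
  proof -
    have "(\<delta> y)\<^sup>2 = (\<Sum>k\<in>UNIV. \<Sum>l\<in>UNIV. D k y * D l y)" by (simp add: \<delta> power2_eq_square sum_product)
    then show ?thesis by (simp add: sum_distrib_left)
  qed
  note pair_int = skorokhod_pairing_cutoff(1)[OF wd wd wd wd test_function_cutoff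
      v[THEN L2_locally_square_integrable] T[THEN L2_locally_square_integrable] T[THEN L2_locally_square_integrable]
      v[THEN L2_locally_square_integrable] T[THEN L2_locally_square_integrable] T[THEN L2_locally_square_integrable]]
  have int: "integrable lborel (\<lambda>y. \<rho> y * cutoff m n y * (D k y * D l y))" for n k l
    unfolding D_def by (rule pair_int)
  have lim: "(\<lambda>n. LINT y|lborel. \<rho> y * cutoff m n y * (\<delta> y)\<^sup>2) \<longlonglongrightarrow>
      (\<Sum>k\<in>UNIV. \<Sum>l\<in>UNIV. \<sigma>\<^sup>2 * (a k \<bullet> a l) * (LINT y|lborel. \<rho> y * (v k y * v l y))
        + \<sigma>^4 * (LINT y|lborel. \<rho> y * (T k l y * T l k y)))"
  proof -
    have "(LINT y|lborel. \<rho> y * cutoff m n y * (\<delta> y)\<^sup>2) = (\<Sum>k\<in>UNIV. \<Sum>l\<in>UNIV. LINT y|lborel. \<rho> y * cutoff m n y * (D k y * D l y))" for n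
      unfolding square using int by simp
    then show ?thesis
      unfolding D_def by (simp only:) (intro tendsto_sum skorokhod_pairing_tendsto wd v T)
  qed
  have int\<delta>: "integrable lborel (\<lambda>y. \<rho> y * cutoff m n y * (\<delta> y)\<^sup>2)" for n
    unfolding square by (intro Bochner_Integration.integrable_sum int)
  show "integrable lborel (\<lambda>y. \<rho> y * (\<delta> y)\<^sup>2)"
    by (rule integral_from_cutoff(1)[OF _ _ int\<delta> lim]) auto
  show "(LINT y|lborel. \<rho> y * (\<delta> y)\<^sup>2) =
      (\<Sum>k\<in>UNIV. \<Sum>l\<in>UNIV. \<sigma>\<^sup>2 * (a k \<bullet> a l) * (LINT y|lborel. \<rho> y * (v k y * v l y))
        + \<sigma>^4 * (LINT y|lborel. \<rho> y * (T k l y * T l k y)))"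
    by (rule integral_from_cutoff(2)[OF _ _ int\<delta> lim]) auto
qed

end

section \<open>Weak Jacobians and directional derivatives\<close>

lemma locally_integrable_bounded_linear:
  fixes f :: "'a::euclidean_space \<Rightarrow> 'b::euclidean_space" and T :: "'b \<Rightarrow> 'c::euclidean_space"
  assumes "bounded_linear T" "locally_integrable f"
  shows "locally_integrable (\<lambda>y. T (f y))"
  unfolding locally_integrable_def set_integrable_def
proof (intro allI impI)
  fix K :: "'a set" assume "compact K"
  then have "integrable lborel (\<lambda>y. T (indicator K y *\<^sub>R f y))"
    using assms(2) by (intro integrable_bounded_linear[OF assms(1)]) (auto simp: locally_integrable_def set_integrable_def)
  then show "integrable lborel (\<lambda>y. indicator K y *\<^sub>R T (f y))"
    using assms(1) by (simp add: linear_simps)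
qed

lemma locally_integrable_add:
  "locally_integrable f \<Longrightarrow> locally_integrable g \<Longrightarrow> locally_integrable (\<lambda>y. f y + g y)"
  by (auto simp: locally_integrable_def set_integrable_def scaleR_add_right)

lemma weak_deriv_add:
  assumes "weak_deriv a f f'" "weak_deriv a g g'"
  shows "weak_deriv a (\<lambda>y. f y + g y) (\<lambda>y. f' y + g' y)"
  unfolding weak_deriv_def
proof (intro conjI allI impI)
  have loc: "locally_integrable f" "locally_integrable f'" "locally_integrable g" "locally_integrable g'"
    using assms by (auto simp: weak_deriv_def)
  then show "locally_integrable (\<lambda>y. f y + g y)" "locally_integrable (\<lambda>y. f' y + g' y)"
    by (auto intro: locally_integrable_add)
  fix \<phi> :: "real^'a \<Rightarrow> real" assume \<phi>: "test_function \<phi>"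
  have "(LINT y|lborel. f y * dir_deriv a \<phi> y) = - (LINT y|lborel. f' y * \<phi> y)"
    "(LINT y|lborel. g y * dir_deriv a \<phi> y) = - (LINT y|lborel. g' y * \<phi> y)"
    using assms \<phi> by (auto simp: weak_deriv_def)
  then show "(LINT y|lborel. (f y + g y) * dir_deriv a \<phi> y) = - (LINT y|lborel. (f' y + g' y) * \<phi> y)"
    using loc[THEN integrable_test_mult, OF \<phi>] loc[THEN integrable_test_mult, OF test_function_dir_deriv[OF \<phi>, of a]]
    by (simp add: distrib_right)
qed

lemma weak_deriv_cmult:
  assumes "weak_deriv a f f'" shows "weak_deriv a (\<lambda>y. c * f y) (\<lambda>y. c * f' y)"
  using assms unfolding weak_deriv_def
  by (auto simp: mult.assoc intro: locally_integrable_bounded_linear[OF bounded_linear_mult_right])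

lemma weak_deriv_const: "weak_deriv a (\<lambda>y. c) (\<lambda>y. 0)"
  unfolding weak_deriv_def
  by (auto simp: integral_dir_deriv_eq_0 intro: locally_integrable_continuous)

lemma weak_jacobian_weak_deriv:
  assumes J: "has_weak_jacobian f J"
  shows "weak_deriv a (\<lambda>y. c \<bullet> f y) (\<lambda>y. c \<bullet> (J y *v a))"
  unfolding weak_deriv_def
proof (intro conjI allI impI)
  have loc: "locally_integrable f" "locally_integrable J" using J by (auto simp: has_weak_jacobian_def)
  show "locally_integrable (\<lambda>y. c \<bullet> f y)"
    by (rule locally_integrable_bounded_linear[OF bounded_linear_inner_right loc(1)])
  have "linear (\<lambda>X. c \<bullet> (X *v a))"
    by (rule linearI) (auto simp: matrix_vector_mult_add_rdistrib inner_add_right scaleR_matrix_vector_assoc[symmetric])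
  then show "locally_integrable (\<lambda>y. c \<bullet> (J y *v a))"
    using locally_integrable_bounded_linear[OF _ loc(2)] linear_conv_bounded_linear by blast
  fix \<phi> :: "real^'a \<Rightarrow> real" assume \<phi>: "test_function \<phi>"
  have fi: "locally_integrable (\<lambda>y. f y $ i)" for i
    by (rule locally_integrable_bounded_linear[OF bounded_linear_vec_nth loc(1)])
  have Jij: "locally_integrable (\<lambda>y. J y $ i $ j)" for i j
    by (rule locally_integrable_bounded_linear[OF bounded_linear_compose[OF bounded_linear_vec_nth bounded_linear_vec_nth] loc(2)])
  have p\<phi>: "test_function (partial j \<phi>)" for j
    unfolding partial_eq_dir_deriv by (rule test_function_dir_deriv[OF \<phi>])
  have lhs: "(c \<bullet> f y) * dir_deriv a \<phi> y = (\<Sum>i\<in>UNIV. \<Sum>j\<in>UNIV. (c $ i * a $ j) * (f y $ i * partial j \<phi> y))" for y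
    unfolding dir_deriv_eq_sum_partial[OF test_function_smooth[OF \<phi>]] inner_vec_def sum_product
    by (simp add: mult_ac)
  have rhs: "(c \<bullet> (J y *v a)) * \<phi> y = (\<Sum>i\<in>UNIV. \<Sum>j\<in>UNIV. (c $ i * a $ j) * (J y $ i $ j * \<phi> y))" for y
    unfolding inner_vec_def matrix_vector_mult_def by (simp add: sum_distrib_left sum_distrib_right mult_ac)
  have "(LINT y|lborel. (c \<bullet> f y) * dir_deriv a \<phi> y)
      = (\<Sum>i\<in>UNIV. \<Sum>j\<in>UNIV. (c $ i * a $ j) * (LINT y|lborel. f y $ i * partial j \<phi> y))"
    unfolding lhs using integrable_test_mult[OF fi p\<phi>] by simp
  also have "\<dots> = - (\<Sum>i\<in>UNIV. \<Sum>j\<in>UNIV. (c $ i * a $ j) * (LINT y|lborel. J y $ i $ j * \<phi> y))"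
    using J \<phi> by (simp add: has_weak_jacobian_def sum_negf)
  also have "(\<Sum>i\<in>UNIV. \<Sum>j\<in>UNIV. (c $ i * a $ j) * (LINT y|lborel. J y $ i $ j * \<phi> y))
      = (LINT y|lborel. (c \<bullet> (J y *v a)) * \<phi> y)"
    unfolding rhs using integrable_test_mult[OF Jij \<phi>] by simp
  finally show "(LINT y|lborel. (c \<bullet> f y) * dir_deriv a \<phi> y) = - (LINT y|lborel. (c \<bullet> (J y *v a)) * \<phi> y)" .
qed

section \<open>Gram matrices\<close>

text \<open>The transpose of \<open>A\<close> is injective on the range of \<open>A\<close>, hence bounded below there, the dimension
being finite.\<close>

lemma norm_matrix_mult_le_gram:
  fixes A :: "real^'q::finite^'m::finite"
  obtains C where "C \<ge> 0" "\<And>u. norm (A *v u) \<le> C * norm ((transpose A ** A) *v u)"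
proof -
  have sub: "subspace (range ((*v) A))"
    by (rule linear_subspace_image[OF matrix_vector_mul_linear subspace_UNIV])
  have "\<exists>e>0. \<forall>x\<in>range ((*v) A). norm (transpose A *v x) \<ge> e * norm x"
  proof (rule injective_imp_isometric[OF closed_subspace[OF sub] sub])
    show "bounded_linear ((*v) (transpose A))" by (rule matrix_vector_mul_bounded_linear)
    show "\<forall>x\<in>range ((*v) A). transpose A *v x = 0 \<longrightarrow> x = 0"
    proof (intro ballI impI)
      fix x assume "x \<in> range ((*v) A)" "transpose A *v x = 0"
      then obtain u where "x = A *v u" by blast
      then have "x \<bullet> x = (transpose A *v x) \<bullet> u" by (metis dot_lmul_matrix inner_commute vector_transpose_matrix transpose_matrix_vector)
      then show "x = 0" using \<open>transpose A *v x = 0\<close> by simp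
    qed
  qed
  then obtain e where e: "e > 0" "\<And>u. norm (transpose A *v (A *v u)) \<ge> e * norm (A *v u)" by auto
  show ?thesis
  proof (rule that[of "inverse e"])
    show "norm (A *v u) \<le> inverse e * norm ((transpose A ** A) *v u)" for u
      using e(1) e(2)[of u] by (simp add: field_simps matrix_vector_mul_assoc)
  qed (use e in simp)
qed

lemma sandwich_entry: "(A ** X ** transpose B) $ k $ l = A $ k \<bullet> (X *v (B $ l))"
  for A :: "real^'q::finite^'m::finite" and X :: "real^'q^'q" and B :: "real^'q^'m"
proof -
  have "(A ** X ** transpose B) $ k $ l = (\<Sum>j\<in>UNIV. \<Sum>i\<in>UNIV. A $ k $ i * X $ i $ j * B $ l $ j)"
    by (simp add: matrix_matrix_mult_def transpose_def sum_distrib_right)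
  also have "\<dots> = (\<Sum>i\<in>UNIV. \<Sum>j\<in>UNIV. A $ k $ i * X $ i $ j * B $ l $ j)"
    by (rule sum.swap)
  also have "\<dots> = A $ k \<bullet> (X *v (B $ l))"
    by (simp add: inner_vec_def matrix_vector_mult_def sum_distrib_left mult.assoc)
  finally show ?thesis .
qed

lemma gram_entry: "(A ** transpose A) $ k $ l = A $ k \<bullet> A $ l"
  for A :: "real^'q::finite^'m::finite"
  using sandwich_entry[of A "mat 1" A] by simp

lemma trace_matrix_mult: "trace (X ** Y) = (\<Sum>k\<in>UNIV. \<Sum>l\<in>UNIV. X $ k $ l * Y $ l $ k)"
  for X Y :: "real^'m::finite^'m"
  by (simp add: trace_def matrix_matrix_mult_def)

lemma trace_gram: "trace (transpose A ** A) = (\<Sum>k\<in>UNIV. A $ k \<bullet> A $ k)"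
  for A :: "real^'q::finite^'m::finite"
  by (subst trace_mul_sym) (simp only: trace_def gram_entry)

lemma trace_gram_square:
  "trace ((transpose A ** A) ** (transpose A ** A)) = (\<Sum>k\<in>UNIV. \<Sum>l\<in>UNIV. (A $ k \<bullet> A $ l)\<^sup>2)"
  for A :: "real^'q::finite^'m::finite"
proof -
  have "trace ((transpose A ** A) ** (transpose A ** A)) = trace (transpose A ** (A ** transpose A ** A))"
    by (simp add: matrix_mul_assoc)
  also have "\<dots> = trace ((A ** transpose A ** A) ** transpose A)" by (rule trace_mul_sym)
  also have "\<dots> = trace ((A ** transpose A) ** (A ** transpose A))" by (simp add: matrix_mul_assoc)
  also have "\<dots> = (\<Sum>k\<in>UNIV. \<Sum>l\<in>UNIV. (A $ k \<bullet> A $ l)\<^sup>2)"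
    unfolding trace_matrix_mult gram_entry by (simp add: power2_eq_square inner_commute)
  finally show ?thesis .
qed

lemma norm_gram_mult_square:
  "(norm ((transpose A ** A) *v u))\<^sup>2 = (\<Sum>k\<in>UNIV. \<Sum>l\<in>UNIV. (A $ k \<bullet> A $ l) * ((A $ k \<bullet> u) * (A $ l \<bullet> u)))"
  for A :: "real^'q::finite^'m::finite"
proof -
  have "(transpose A ** A) *v u = transpose A *v (A *v u)" by (simp add: matrix_vector_mul_assoc)
  also have "\<dots> = (\<Sum>k\<in>UNIV. (A *v u) $ k *\<^sub>R A $ k)"
    unfolding matrix_vector_mult_def[of "transpose A"] by (simp add: vec_eq_iff transpose_def mult.commute)
  also have "\<dots> = (\<Sum>k\<in>UNIV. (A $ k \<bullet> u) *\<^sub>R A $ k)" by (simp add: matrix_vector_mul_component)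
  finally show ?thesis
    unfolding power2_norm_eq_inner by (simp add: inner_sum_left inner_sum_right sum_distrib_left inner_commute mult_ac)
qed

lemma trace_sandwich_product:
  fixes A :: "real^'q::finite^'m::finite" and X :: "real^'q^'q"
  shows "trace (A ** X ** transpose A ** A ** (2 *\<^sub>R mat 1 - X) ** transpose A)
    = (\<Sum>k\<in>UNIV. \<Sum>l\<in>UNIV. (A $ k \<bullet> (X *v A $ l)) * (2 * (A $ k \<bullet> A $ l) - A $ l \<bullet> (X *v A $ k)))"
proof -
  have entry: "A $ l \<bullet> ((2 *\<^sub>R mat 1 - X) *v A $ k) = 2 * (A $ k \<bullet> A $ l) - A $ l \<bullet> (X *v A $ k)" for k l
    by (simp add: matrix_vector_mult_diff_rdistrib inner_diff_right scaleR_matrix_vector_assoc[symmetric] inner_commute)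
  have "trace (A ** X ** transpose A ** A ** (2 *\<^sub>R mat 1 - X) ** transpose A)
    = trace ((A ** X ** transpose A) ** (A ** (2 *\<^sub>R mat 1 - X) ** transpose A))"
    by (simp add: matrix_mul_assoc)
  then show ?thesis unfolding trace_matrix_mult sandwich_entry entry by simp
qed

lemma norm_matrix_vector_square: "(norm (A *v u))\<^sup>2 = (\<Sum>k\<in>UNIV. (A $ k \<bullet> u)\<^sup>2)"
  for A :: "real^'q::finite^'m::finite"
  unfolding power2_norm_eq_inner
  by (simp add: inner_vec_def[of "A *v u"] matrix_vector_mul_component power2_eq_square)

text \<open>With \<open>p = a\<^sub>k \<bullet> (y - m)\<close> and \<open>z = a\<^sub>k \<bullet> (m - \<mu>(y))\<close>, where \<open>m = \<Phi> x\<^sub>0\<close>, the two squared norms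
contribute \<open>(p + z)\<^sup>2 - z\<^sup>2 = p (p + 2 z)\<close> for each row \<open>a\<^sub>k\<close>.\<close>

lemma GSURE_minus_SE:
  fixes A :: "real^'q::finite^'m::finite"
  shows "GSURE A \<Phi> \<sigma> x J y - SE A \<Phi> x\<^sub>0 x y =
    (\<Sum>k\<in>UNIV. A $ k \<bullet> (y - \<Phi> *v x\<^sub>0) * (A $ k \<bullet> (y - \<Phi> *v x\<^sub>0) + 2 * (A $ k \<bullet> (\<Phi> *v x\<^sub>0 - \<Phi> *v x y)))
      - \<sigma>\<^sup>2 * (A $ k \<bullet> A $ k - 2 * (A $ k \<bullet> (J y *v A $ k))))"
proof -
  let ?p = "\<lambda>k. A $ k \<bullet> (y - \<Phi> *v x\<^sub>0)" and ?z = "\<lambda>k. A $ k \<bullet> (\<Phi> *v x\<^sub>0 - \<Phi> *v x y)"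
  have 1: "(norm (A *v (y - \<Phi> *v x y)))\<^sup>2 = (\<Sum>k\<in>UNIV. (?p k + ?z k)\<^sup>2)"
    unfolding norm_matrix_vector_square inner_add_right[symmetric] by simp
  have 2: "SE A \<Phi> x\<^sub>0 x y = (\<Sum>k\<in>UNIV. (?z k)\<^sup>2)"
    unfolding SE_def matrix_vector_mult_diff_distrib[symmetric] norm_matrix_vector_square ..
  have 3: "trace (A ** J y ** transpose A) = (\<Sum>k\<in>UNIV. A $ k \<bullet> (J y *v A $ k))"
    unfolding trace_def sandwich_entry ..
  show ?thesis
    unfolding GSURE_def 1 2 3 trace_gram
    by (simp add: sum_subtractf sum.distrib sum_distrib_left power2_eq_square algebra_simps)
qed

section \<open>The second moment of the difference of GSURE and SE\<close>

context gaussian_weight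
begin

lemma L2_bound:
  assumes [measurable]: "f \<in> borel_measurable borel"
    and h: "integrable lborel (\<lambda>y. \<rho> y * h y)" and le: "\<And>y. (f y)\<^sup>2 \<le> h y"
  shows "L2 f"
  unfolding L2_def
proof
  show "integrable lborel (\<lambda>y. \<rho> y * (f y)\<^sup>2)"
  proof (rule Bochner_Integration.integrable_bound[OF h])
    have "norm (\<rho> y * (f y)\<^sup>2) \<le> norm (\<rho> y * h y)" for y
      using mult_left_mono[OF le, of "\<rho> y"] \<rho>_pos[of y] by (auto intro: order_trans[OF _ abs_ge_self])
    then show "AE y in lborel. norm (\<rho> y * (f y)\<^sup>2) \<le> norm (\<rho> y * h y)" by simp
  qed measurable
qed measurable

text \<open>The isometry for \<open>v\<^sub>k = p\<^sub>k + 2 z\<^sub>k\<close>, whose weak derivative in direction \<open>a\<^sub>l\<close> is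
\<open>T\<^sub>k\<^sub>l = G\<^sub>k\<^sub>l - 2 s\<^sub>k\<^sub>l\<close> with the Gram matrix \<open>G = A A\<^sup>T\<close> and \<open>s = A J A\<^sup>T\<close>. Stein's identity
gives \<open>E(p\<^sub>k p\<^sub>l) = \<sigma>\<^sup>2 G\<^sub>k\<^sub>l\<close> and \<open>E(p\<^sub>k z\<^sub>l) = - \<sigma>\<^sup>2 E(s\<^sub>l\<^sub>k)\<close>; the rest is bilinear algebra.\<close>

lemma gaussian_second_moment:
  fixes A :: "real^'q^'m::finite"
  assumes J: "has_weak_jacobian \<mu> J"
    and h: "integrable lborel (\<lambda>y. \<rho> y * (norm ((transpose A ** A) *v (m - \<mu> y)))\<^sup>2)"
    and S: "integrable lborel (\<lambda>y. \<rho> y * (norm (A ** J y ** transpose A))\<^sup>2)"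
  defines "\<delta> \<equiv> (\<lambda>y. \<Sum>k\<in>UNIV. A $ k \<bullet> (y - m) * (A $ k \<bullet> (y - m) + 2 * (A $ k \<bullet> (m - \<mu> y)))
      - \<sigma>\<^sup>2 * (A $ k \<bullet> A $ k - 2 * (A $ k \<bullet> (J y *v A $ k))))"
  shows "integrable lborel (\<lambda>y. \<rho> y * (\<delta> y)\<^sup>2)"
    and "(LINT y|lborel. \<rho> y * (\<delta> y)\<^sup>2) = 2 * \<sigma>^4 * trace ((transpose A ** A) ** (transpose A ** A))
        + 4 * \<sigma>\<^sup>2 * (LINT y|lborel. \<rho> y * (norm ((transpose A ** A) *v (m - \<mu> y)))\<^sup>2)
        - 4 * \<sigma>^4 * (LINT y|lborel. \<rho> y * trace (A ** J y ** transpose A ** A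
                                      ** (2 *\<^sub>R mat 1 - J y) ** transpose A))"
proof -
  define p where "p k y = A $ k \<bullet> (y - m)" for k y
  define z where "z k y = A $ k \<bullet> (m - \<mu> y)" for k y
  define s where "s k l y = A $ k \<bullet> (J y *v A $ l)" for k l y
  define G where "G k l = A $ k \<bullet> A $ l" for k l
  define v where "v k y = p k y + 2 * z k y" for k y
  define T where "T k l y = G k l - 2 * s k l y" for k l y
  have wd_z: "weak_deriv (A $ l) (z k) (\<lambda>y. - s k l y)" for k l
    using weak_deriv_add[OF weak_deriv_const[of _ "A $ k \<bullet> m"] weak_deriv_cmult[OF weak_jacobian_weak_deriv[OF J, of "A $ l" "A $ k"], of "- 1"]]
    by (simp add: z_def[abs_def] s_def inner_diff_right)
  have wd: "weak_deriv (A $ l) (v k) (T k l)" for k l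
    using weak_deriv_add[OF weak_deriv_inner_diff[of "A $ l" "A $ k" m] weak_deriv_cmult[OF wd_z[of l k], of 2]]
    by (simp add: v_def[abs_def] p_def T_def[abs_def] G_def)
  have meas: "z k \<in> borel_measurable borel" "s k l \<in> borel_measurable borel" for k l
  proof -
    have "locally_integrable (z k)" "locally_integrable (\<lambda>y. - s k l y)"
      using wd_z[of l k] by (auto simp: weak_deriv_def)
    then have "z k \<in> borel_measurable borel" "(\<lambda>y. - (- s k l y)) \<in> borel_measurable borel"
      by (auto dest: locally_integrable_borel)
    then show "z k \<in> borel_measurable borel" "s k l \<in> borel_measurable borel" by auto
  qed
  have L2_p: "L2 (p k)" for k unfolding p_def[abs_def] by (rule L2_inner)
  have L2_z: "L2 (z k)" for k
  proof -
    obtain C where C: "C \<ge> 0" "\<And>u. norm (A *v u) \<le> C * norm ((transpose A ** A) *v u)"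
      by (rule norm_matrix_mult_le_gram[of A]) blast
    have bound: "(z k y)\<^sup>2 \<le> C\<^sup>2 * (norm ((transpose A ** A) *v (m - \<mu> y)))\<^sup>2" for y
    proof -
      have "\<bar>z k y\<bar> \<le> norm (A *v (m - \<mu> y))"
        using component_le_norm_cart[of "A *v (m - \<mu> y)" k] by (simp add: z_def matrix_vector_mul_component)
      also have "\<dots> \<le> C * norm ((transpose A ** A) *v (m - \<mu> y))" by (rule C(2))
      finally have "\<bar>z k y\<bar>\<^sup>2 \<le> (C * norm ((transpose A ** A) *v (m - \<mu> y)))\<^sup>2" by (rule power_mono) simp
      then show ?thesis by (simp add: power_mult_distrib)
    qed
    have "integrable lborel (\<lambda>y. \<rho> y * (C\<^sup>2 * (norm ((transpose A ** A) *v (m - \<mu> y)))\<^sup>2))"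
      using integrable_mult_right[OF h, of "C\<^sup>2"] by (simp add: mult.left_commute)
    from L2_bound[OF meas(1) this bound] show ?thesis .
  qed
  have L2_s: "L2 (s k l)" for k l
  proof (rule L2_bound[OF meas(2) S])
    show "(s k l y)\<^sup>2 \<le> (norm (A ** J y ** transpose A))\<^sup>2" for y
    proof -
      have "\<bar>s k l y\<bar> \<le> norm ((A ** J y ** transpose A) $ k)"
        using component_le_norm_cart[of "(A ** J y ** transpose A) $ k" l] by (simp add: s_def sandwich_entry)
      also have "\<dots> \<le> norm (A ** J y ** transpose A)" by (rule Finite_Cartesian_Product.norm_nth_le)
      finally have "\<bar>s k l y\<bar>\<^sup>2 \<le> (norm (A ** J y ** transpose A))\<^sup>2" by (rule power_mono) simp
      then show ?thesis by simp
    qed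
  qed
  have L2_v: "L2 (v k)" for k unfolding v_def[abs_def] by (intro L2_add L2_cmult L2_p L2_z)
  have L2_T: "L2 (T k l)" for k l
    using L2_add[OF L2_const[of "G k l"] L2_cmult[OF L2_s[of k l], of "- 2"]] by (simp add: T_def[abs_def])
  have \<delta>: "\<delta> = (\<lambda>y. \<Sum>k\<in>UNIV. A $ k \<bullet> (y - m) * v k y - \<sigma>\<^sup>2 * T k k y)"
    by (simp add: \<delta>_def v_def p_def z_def T_def G_def s_def)
  note iso = skorokhod_isometry[of "\<lambda>k. A $ k" v T, OF wd L2_v L2_T]
  show "integrable lborel (\<lambda>y. \<rho> y * (\<delta> y)\<^sup>2)" using iso(1) by (simp add: \<delta>)
  define E where "E f = (LINT y|lborel. \<rho> y * f y)" for f
  have E_s: "integrable lborel (\<lambda>y. \<rho> y * s k l y)" for k l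
    using L2_mult[OF L2_s[of k l] L2_const[of 1]] by simp
  have E_pp: "E (\<lambda>y. p k y * p l y) = \<sigma>\<^sup>2 * G k l" for k l
    using stein_identity[OF weak_deriv_inner_diff[of "A $ k" "A $ l" m] L2_inner L2_const] \<rho>_mass
    by (simp add: E_def p_def G_def inner_commute)
  have E_pz: "E (\<lambda>y. p k y * z l y) = - \<sigma>\<^sup>2 * E (s l k)" for k l
  proof -
    have "L2 (\<lambda>y. - s l k y)" using L2_cmult[OF L2_s[of l k], of "- 1"] by simp
    from stein_identity[OF wd_z[of k l] L2_z this] show ?thesis by (simp add: E_def p_def)
  qed
  have E_vv: "E (\<lambda>y. v k y * v l y) = \<sigma>\<^sup>2 * G k l - 2 * \<sigma>\<^sup>2 * E (s l k) - 2 * \<sigma>\<^sup>2 * E (s k l) + 4 * E (\<lambda>y. z k y * z l y)" for k l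
  proof -
    have "\<rho> y * (v k y * v l y) = \<rho> y * (p k y * p l y) + 2 * (\<rho> y * (p k y * z l y)) + 2 * (\<rho> y * (p l y * z k y)) + 4 * (\<rho> y * (z k y * z l y))" for y
      by (simp add: v_def algebra_simps)
    then have "E (\<lambda>y. v k y * v l y) = E (\<lambda>y. p k y * p l y) + 2 * E (\<lambda>y. p k y * z l y) + 2 * E (\<lambda>y. p l y * z k y) + 4 * E (\<lambda>y. z k y * z l y)"
      unfolding E_def using L2_mult[OF L2_p L2_p] L2_mult[OF L2_p L2_z] L2_mult[OF L2_z L2_z] by simp
    then show ?thesis by (simp add: E_pp E_pz)
  qed
  have E_TT: "E (\<lambda>y. T k l y * T l k y) = (G k l)\<^sup>2 - 2 * G k l * E (s k l) - 2 * G k l * E (s l k) + 4 * E (\<lambda>y. s k l y * s l k y)" for k l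
  proof -
    have "G l k = G k l" by (simp add: G_def inner_commute)
    then have "\<rho> y * (T k l y * T l k y) = (G k l)\<^sup>2 * \<rho> y - 2 * G k l * (\<rho> y * s k l y) - 2 * G k l * (\<rho> y * s l k y) + 4 * (\<rho> y * (s k l y * s l k y))" for y
      by (simp add: T_def algebra_simps power2_eq_square)
    then show ?thesis
      unfolding E_def using E_s L2_mult[OF L2_s L2_s] \<rho>_integrable \<rho>_mass by simp
  qed
  have E_h: "E (\<lambda>y. (norm ((transpose A ** A) *v (m - \<mu> y)))\<^sup>2) = (\<Sum>k\<in>UNIV. \<Sum>l\<in>UNIV. G k l * E (\<lambda>y. z k y * z l y))"
  proof -
    have "\<rho> y * (norm ((transpose A ** A) *v (m - \<mu> y)))\<^sup>2 = (\<Sum>k\<in>UNIV. \<Sum>l\<in>UNIV. G k l * (\<rho> y * (z k y * z l y)))" for y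
      unfolding norm_gram_mult_square by (simp add: G_def z_def sum_distrib_left mult_ac)
    then show ?thesis unfolding E_def using L2_mult[OF L2_z L2_z] by simp
  qed
  have E_tr: "E (\<lambda>y. trace (A ** J y ** transpose A ** A ** (2 *\<^sub>R mat 1 - J y) ** transpose A))
      = (\<Sum>k\<in>UNIV. \<Sum>l\<in>UNIV. 2 * G k l * E (s k l) - E (\<lambda>y. s k l y * s l k y))"
  proof -
    have "\<rho> y * trace (A ** J y ** transpose A ** A ** (2 *\<^sub>R mat 1 - J y) ** transpose A)
        = (\<Sum>k\<in>UNIV. \<Sum>l\<in>UNIV. 2 * G k l * (\<rho> y * s k l y) - \<rho> y * (s k l y * s l k y))" for y
      unfolding trace_sandwich_product by (simp add: G_def s_def sum_distrib_left algebra_simps)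
    then show ?thesis unfolding E_def using E_s L2_mult[OF L2_s L2_s] by simp
  qed
  have swap: "(\<Sum>k\<in>UNIV. \<Sum>l\<in>UNIV. G k l * E (s l k)) = (\<Sum>k\<in>UNIV. \<Sum>l\<in>UNIV. G k l * E (s k l))"
    by (subst sum.swap) (simp add: G_def inner_commute)
  have "(LINT y|lborel. \<rho> y * (\<delta> y)\<^sup>2)
      = (\<Sum>k\<in>UNIV. \<Sum>l\<in>UNIV. \<sigma>\<^sup>2 * G k l * E (\<lambda>y. v k y * v l y) + \<sigma>^4 * E (\<lambda>y. T k l y * T l k y))"
    using iso(2) by (simp add: \<delta> E_def G_def)
  also have "\<dots> = (\<Sum>k\<in>UNIV. \<Sum>l\<in>UNIV. 2 * \<sigma>^4 * (G k l)\<^sup>2 - 4 * \<sigma>^4 * (G k l * E (s k l)) - 4 * \<sigma>^4 * (G k l * E (s l k))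
      + 4 * \<sigma>\<^sup>2 * (G k l * E (\<lambda>y. z k y * z l y)) + 4 * \<sigma>^4 * E (\<lambda>y. s k l y * s l k y))"
    unfolding E_vv E_TT by (intro sum.cong refl) (simp add: algebra_simps power2_eq_square power4_eq_xxxx)
  also have "\<dots> = 2 * \<sigma>^4 * (\<Sum>k\<in>UNIV. \<Sum>l\<in>UNIV. (G k l)\<^sup>2) - 4 * \<sigma>^4 * (\<Sum>k\<in>UNIV. \<Sum>l\<in>UNIV. G k l * E (s k l))
      - 4 * \<sigma>^4 * (\<Sum>k\<in>UNIV. \<Sum>l\<in>UNIV. G k l * E (s l k)) + 4 * \<sigma>\<^sup>2 * (\<Sum>k\<in>UNIV. \<Sum>l\<in>UNIV. G k l * E (\<lambda>y. z k y * z l y))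
      + 4 * \<sigma>^4 * (\<Sum>k\<in>UNIV. \<Sum>l\<in>UNIV. E (\<lambda>y. s k l y * s l k y))"
    by (simp only: sum.distrib sum_subtractf sum_distrib_left)
  also have "\<dots> = 2 * \<sigma>^4 * (\<Sum>k\<in>UNIV. \<Sum>l\<in>UNIV. (G k l)\<^sup>2) + 4 * \<sigma>\<^sup>2 * (\<Sum>k\<in>UNIV. \<Sum>l\<in>UNIV. G k l * E (\<lambda>y. z k y * z l y))
      - 4 * \<sigma>^4 * (\<Sum>k\<in>UNIV. \<Sum>l\<in>UNIV. 2 * G k l * E (s k l) - E (\<lambda>y. s k l y * s l k y))"
    unfolding swap by (simp add: sum_subtractf sum_distrib_left[symmetric] mult.assoc right_diff_distrib)
  finally show "(LINT y|lborel. \<rho> y * (\<delta> y)\<^sup>2) = 2 * \<sigma>^4 * trace ((transpose A ** A) ** (transpose A ** A))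
        + 4 * \<sigma>\<^sup>2 * (LINT y|lborel. \<rho> y * (norm ((transpose A ** A) *v (m - \<mu> y)))\<^sup>2)
        - 4 * \<sigma>^4 * (LINT y|lborel. \<rho> y * trace (A ** J y ** transpose A ** A
                                      ** (2 *\<^sub>R mat 1 - J y) ** transpose A))"
    unfolding trace_gram_square E_h[unfolded E_def] E_tr[unfolded E_def] E_def G_def .
qed

end

lemma integral_shifted_gaussian:
  fixes F :: "real^'q::finite \<Rightarrow> real"
  assumes w: "distributed M lborel w (\<lambda>v. ennreal (iso_gaussian_density \<sigma> v))" and [measurable]: "F \<in> borel_measurable borel"
  shows "integrable M (\<lambda>\<omega>. F (m + w \<omega>)) \<longleftrightarrow> integrable lborel (\<lambda>y. iso_gaussian_density \<sigma> (y - m) * F y)"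
    and "(LINT \<omega>|M. F (m + w \<omega>)) = (LINT y|lborel. iso_gaussian_density \<sigma> (y - m) * F y)"
proof -
  have nonneg: "0 \<le> iso_gaussian_density \<sigma> v" for v :: "real^'q"
    by (simp add: iso_gaussian_density_def prod_nonneg)
  have [measurable]: "iso_gaussian_density \<sigma> \<in> borel_measurable (borel :: (real^'q) measure)"
    unfolding iso_gaussian_density_def normal_density_def by measurable
  let ?H = "\<lambda>y. iso_gaussian_density \<sigma> (y - m) * F y"
  have H: "?H (m + v) = iso_gaussian_density \<sigma> v * F (m + v)" for v by simp
  have "integrable lborel (\<lambda>v. ?H (m + v)) \<longleftrightarrow> integrable lborel ?H"
    using lborel_integrable_translate[of ?H m] lborel_integrable_translate[of "\<lambda>v. ?H (m + v)" "- m"] by auto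
  then show "integrable M (\<lambda>\<omega>. F (m + w \<omega>)) \<longleftrightarrow> integrable lborel ?H"
    using distributed_integrable[OF w, of "\<lambda>v. F (m + v)"] nonneg by simp
  have "(LINT v|lborel. ?H (m + v)) = (LINT y|lborel. ?H y)"
    by (rule lborel_integral_translate) measurable
  then show "(LINT \<omega>|M. F (m + w \<omega>)) = (LINT y|lborel. ?H y)"
    using distributed_integral[OF w, of "\<lambda>v. F (m + v)"] nonneg by simp
qed

theorem theorem4:
  fixes A :: "real^'q::finite^'m::finite"
    and \<Phi> :: "real^'n::finite^'q"
    and x\<^sub>0 :: "real^'n"
    and \<sigma> :: real
    and x :: "'p \<Rightarrow> real^'q \<Rightarrow> real^'n"
    and \<theta> :: 'p
    and \<mu>\<^sub>0 :: "real^'q"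
    and \<mu> :: "real^'q \<Rightarrow> real^'q"
    and J :: "real^'q \<Rightarrow> real^'q^'q"
    and M :: "'a measure"
    and w y :: "'a \<Rightarrow> real^'q"
  assumes \<sigma>: "\<sigma> > 0"
    and \<mu>\<^sub>0: "\<mu>\<^sub>0 = \<Phi> *v x\<^sub>0"
    and \<mu>: "\<mu> = (\<lambda>v. \<Phi> *v x \<theta> v)"
    and weak_diff: "has_weak_jacobian \<mu> J"
    and M: "prob_space M"
    and w: "distributed M lborel w (\<lambda>v. ennreal (iso_gaussian_density \<sigma> v))"
    and y: "y = (\<lambda>\<omega>. \<Phi> *v x\<^sub>0 + w \<omega>)"
    and int_\<mu>: "integrable M (\<lambda>\<omega>. (norm ((transpose A ** A) *v (\<mu>\<^sub>0 - \<mu> (y \<omega>))))\<^sup>2)"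
    and int_J: "integrable M (\<lambda>\<omega>. (norm (A ** J (y \<omega>) ** transpose A))\<^sup>2)"
  shows "integrable M (\<lambda>\<omega>. (GSURE A \<Phi> \<sigma> (x \<theta>) J (y \<omega>) - SE A \<Phi> x\<^sub>0 (x \<theta>) (y \<omega>))\<^sup>2)
    \<and> (LINT \<omega>|M. (GSURE A \<Phi> \<sigma> (x \<theta>) J (y \<omega>) - SE A \<Phi> x\<^sub>0 (x \<theta>) (y \<omega>))\<^sup>2)
      = 2 * \<sigma>^4 * trace ((transpose A ** A) ** (transpose A ** A))
        + 4 * \<sigma>\<^sup>2 * (LINT \<omega>|M. (norm ((transpose A ** A) *v (\<mu>\<^sub>0 - \<mu> (y \<omega>))))\<^sup>2)
        - 4 * \<sigma>^4 * (LINT \<omega>|M. trace (A ** J (y \<omega>) ** transpose A ** A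
                                      ** (2 *\<^sub>R mat 1 - J (y \<omega>)) ** transpose A))"
proof -
  interpret prob_space M by (rule M)
  have [measurable]: "\<mu> \<in> borel_measurable borel" "J \<in> borel_measurable borel"
    using weak_diff locally_integrable_borel by (auto simp: has_weak_jacobian_def)
  have entry [measurable]: "(\<lambda>y. c \<bullet> \<mu> y) \<in> borel_measurable borel" "(\<lambda>y. c \<bullet> (J y *v a)) \<in> borel_measurable borel" for a c
    using weak_jacobian_weak_deriv[OF weak_diff, of a c] locally_integrable_borel by (auto simp: weak_deriv_def)
  note shift = integral_shifted_gaussian[OF w, where m="\<mu>\<^sub>0"]
  let ?\<rho> = "\<lambda>y. iso_gaussian_density \<sigma> (y - \<mu>\<^sub>0)"
  have y_eq: "y \<omega> = \<mu>\<^sub>0 + w \<omega>" for \<omega> by (simp add: y \<mu>\<^sub>0)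
  interpret gaussian_weight \<sigma> "\<mu>\<^sub>0"
  proof
    show "integrable lborel ?\<rho>" "(LINT y|lborel. ?\<rho> y) = 1"
      using shift[of "\<lambda>_. 1"] prob_space by auto
  qed (rule \<sigma>)
  define \<delta> where "\<delta> y = (\<Sum>k\<in>UNIV. A $ k \<bullet> (y - \<mu>\<^sub>0) * (A $ k \<bullet> (y - \<mu>\<^sub>0) + 2 * (A $ k \<bullet> (\<mu>\<^sub>0 - \<mu> y)))
      - \<sigma>\<^sup>2 * (A $ k \<bullet> A $ k - 2 * (A $ k \<bullet> (J y *v A $ k))))" for y
  have \<delta>: "GSURE A \<Phi> \<sigma> (x \<theta>) J y - SE A \<Phi> x\<^sub>0 (x \<theta>) y = \<delta> y" for y
    unfolding GSURE_minus_SE \<delta>_def by (simp add: \<mu>\<^sub>0 \<mu>)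
  have \<delta>_meas: "(\<lambda>y. (\<delta> y)\<^sup>2) \<in> borel_measurable borel"
    unfolding \<delta>_def inner_diff_right by measurable
  have h_meas: "(\<lambda>y. (norm ((transpose A ** A) *v (\<mu>\<^sub>0 - \<mu> y)))\<^sup>2) \<in> borel_measurable borel"
    unfolding norm_gram_mult_square inner_diff_right by measurable
  have S_meas: "(\<lambda>y. (norm (A ** J y ** transpose A))\<^sup>2) \<in> borel_measurable borel"
    unfolding power2_norm_eq_inner inner_vec_def[of "_ ** _"] inner_vec_def[of "(_ ** _) $ _"] sandwich_entry by measurable
  have tr_meas: "(\<lambda>y. trace (A ** J y ** transpose A ** A ** (2 *\<^sub>R mat 1 - J y) ** transpose A)) \<in> borel_measurable borel"
    unfolding trace_sandwich_product by measurable
  have h: "integrable lborel (\<lambda>y. ?\<rho> y * (norm ((transpose A ** A) *v (\<mu>\<^sub>0 - \<mu> y)))\<^sup>2)"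
    using int_\<mu> shift(1)[OF h_meas] by (simp add: y_eq)
  have S: "integrable lborel (\<lambda>y. ?\<rho> y * (norm (A ** J y ** transpose A))\<^sup>2)"
    using int_J shift(1)[OF S_meas] by (simp add: y_eq)
  note var = gaussian_second_moment[unfolded \<rho>_def, OF weak_diff h S, folded \<delta>_def]
  show ?thesis
    unfolding \<delta> y_eq shift(2)[OF \<delta>_meas] shift(1)[OF \<delta>_meas] shift(2)[OF h_meas] shift(2)[OF tr_meas]
    using var by blast
qed

end
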